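(* Let $s>\frac12$, let $(m_0,n_0)\in\big(H^s(\mathbb{R})\cap L^1(\mathbb{R})\big)\times\big(H^s(\mathbb{R})\cap L^1(\mathbb{R})\big)$, and let $T>0$ be the maximal existence time of the corresponding solution $(m,n)$ to the Cauchy problem $$m_t+w\,m_x=-M\,m,\qquad n_t+w\,n_x=-M\,n,\qquad m(0,x)=m_0(x),\quad n(0,x)=n_0(x),$$ where $m=u-u_{xx}$, $n=v-v_{xx}$, $w=(uv-u_xv_x)-(uv_x-u_xv)$ and $M=M(t,x)=\big((u_xn+v_xm)+(un-vm)\big)(t,x)$. Assume that $m_0(x),n_0(x)\ge0$ for all $x\in\mathbb{R}$, and that $m_0(x_0),n_0(x_0)>0$ for some $x_0\in\mathbb{R}$. Let $q$ be the flow of $w$, that is, $\frac{d}{dt}q(t,x)=w(t,q(t,x))$, $q(0,x)=x$, and set $$M(t):=M(t,q(t,x_0)),\qquad N(t):=(m+n)(t,q(t,x_0)),$$ $$H_1:=\int_{\mathbb{R}}m_0\,dx,\qquad H_2:=\int_{\mathbb{R}}n_0\,dx,\qquad \delta:=\tfrac32(H_1+H_2)^3 .$$ If $$M(0)<-\sqrt{2\delta N(0)},$$ then the solution $(m,n)$ blows up at a time $T_0\in(0,T_1]$, where $$T_1:=-\frac{M(0)+\sqrt{M^2(0)-2\delta N(0)}}{\delta N(0)}.$$ Moreover, when $T_0=T_1$, one has $$\liminf_{t\to T_0^-}\big((T_0-t)M(t)\big)\le-1.$$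
   Context: All functions are real-valued functions of $(t,x)$, $x\in\mathbb{R}$. The functions $u,v$ are recovered from $m,n$ by $u=(1-\partial_x^2)^{-1}m=p*m$ and $v=(1-\partial_x^2)^{-1}n=p*n$ with $p(x)=\frac12e^{-|x|}$ (convolution in $x$). Standing local well-posedness theory: for $(m_0,n_0)\in H^s(\mathbb{R})\times H^s(\mathbb{R})$ with $s>\frac12$ there are a maximal existence time $T\in(0,\infty]$ and a unique solution $(m,n)\in C([0,T);H^s\times H^s)\cap C^1([0,T);H^{s-1}\times H^{s-1})$, depending continuously on the initial data. "Maximal" means that the solution cannot be extended in this class beyond $T$. "Blows up at the time $T_0$" means that the maximal existence time is finite and equal to $T_0$. The flow $q$ is uniquely defined and of class $C^1$ on $[0,T)\times\mathbb{R}$. *)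

theory Defs
  imports "HOL-Analysis.Analysis"
begin

section \<open>Schwartz functions and distributions\<close>

definition vderiv :: "(real \<Rightarrow> complex) \<Rightarrow> real \<Rightarrow> complex" where
  "vderiv \<phi> x = vector_derivative \<phi> (at x)"

definition schwartz :: "(real \<Rightarrow> complex) set" where
  "schwartz = {\<phi>. (\<forall>k x. (vderiv ^^ k) \<phi> differentiable (at x)) \<and>
                   (\<forall>j k. bounded (range (\<lambda>x. x ^ j *\<^sub>R (vderiv ^^ k) \<phi> x)))}"

text \<open>A distribution is represented by a functional on all functions; only its restriction to
  \<^const>\<open>schwartz\<close> is meaningful, except for the concrete functionals built from
  \<open>distr_of\<close> and \<open>distr_deriv\<close> below, which also make sense on less regular functions.\<close>

type_synonym distr = "(real \<Rightarrow> complex) \<Rightarrow> complex"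

definition distr_of :: "(real \<Rightarrow> real) \<Rightarrow> distr" where
  "distr_of f \<phi> = (LINT x|lborel. complex_of_real (f x) * \<phi> x)"

definition distr_deriv :: "distr \<Rightarrow> distr" where
  "distr_deriv \<Lambda> \<phi> = - \<Lambda> (vderiv \<phi>)"

text \<open>For \<open>f\<close> in \<open>L\<^sup>2\<close> and \<open>a\<close> of class \<open>C\<^sup>1\<close>, bounded together with its derivative,
  \<open>distr_mult a (distr_deriv (distr_of f))\<close> is the product of \<open>a\<close> and the distributional derivative
  of \<open>f\<close>: this derivative has order at most one, so it may be applied to \<open>a \<phi>\<close>, which is only
  \<open>C\<^sup>1\<close>.\<close>

definition distr_mult :: "(real \<Rightarrow> real) \<Rightarrow> distr \<Rightarrow> distr" where
  "distr_mult a \<Lambda> \<phi> = \<Lambda> (\<lambda>x. complex_of_real (a x) * \<phi> x)"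


section \<open>Sobolev spaces of arbitrary real order\<close>

definition inv_fourier :: "(real \<Rightarrow> complex) \<Rightarrow> real \<Rightarrow> complex" where
  "inv_fourier \<phi> \<xi> = (LINT x|lborel. \<phi> x * cis (x * \<xi>)) / complex_of_real (2 * pi)"

text \<open>\<open>g\<close> is the Fourier transform of \<open>\<Lambda>\<close> (that is, \<open>\<Lambda>\<close> is the inverse Fourier transform of the
  tempered distribution \<open>g\<close>) and \<open>(1 + \<xi>\<^sup>2)\<^bsup>\<sigma>/2\<^esup> g\<close> belongs to \<open>L\<^sup>2\<close>. The weight makes the
  integral on the right absolutely convergent, also for negative \<open>\<sigma>\<close>.\<close>

definition sobolev_transform :: "real \<Rightarrow> distr \<Rightarrow> (real \<Rightarrow> complex) \<Rightarrow> bool" where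
  "sobolev_transform \<sigma> \<Lambda> g \<longleftrightarrow>
     g \<in> borel_measurable lborel \<and>
     integrable lborel (\<lambda>\<xi>. (1 + \<xi>\<^sup>2) powr \<sigma> * (cmod (g \<xi>))\<^sup>2) \<and>
     (\<forall>\<phi>\<in>schwartz. \<Lambda> \<phi> = (LINT \<xi>|lborel. g \<xi> * inv_fourier \<phi> \<xi>))"

definition sobolev :: "real \<Rightarrow> distr set" where
  "sobolev \<sigma> = {\<Lambda>. \<exists>g. sobolev_transform \<sigma> \<Lambda> g}"

text \<open>The transform is unique almost everywhere, so the choice does not affect the norm.\<close>

definition sobolev_norm :: "real \<Rightarrow> distr \<Rightarrow> real" where
  "sobolev_norm \<sigma> \<Lambda> =
     (let g = (SOME g. sobolev_transform \<sigma> \<Lambda> g)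
      in sqrt (LINT \<xi>|lborel. (1 + \<xi>\<^sup>2) powr \<sigma> * (cmod (g \<xi>))\<^sup>2))"

text \<open>The real space \<open>H\<^sup>s\<close> for \<open>s > 1/2\<close>. By the Sobolev embedding every class has exactly one
  continuous representative, with which it is identified; pointwise values refer to it.
  Square integrability makes \<^const>\<open>distr_of\<close> well defined.\<close>

definition Hs :: "real \<Rightarrow> (real \<Rightarrow> real) set" where
  "Hs s = {f. continuous_on UNIV f \<and> integrable lborel (\<lambda>x. (f x)\<^sup>2) \<and> distr_of f \<in> sobolev s}"


section \<open>Curves in Sobolev spaces\<close>

definition sobolev_continuous :: "real \<Rightarrow> real set \<Rightarrow> (real \<Rightarrow> distr) \<Rightarrow> bool" where
  "sobolev_continuous \<sigma> J \<Lambda> \<longleftrightarrow>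
     (\<forall>t\<in>J. \<Lambda> t \<in> sobolev \<sigma>) \<and>
     (\<forall>t\<in>J. ((\<lambda>\<tau>. sobolev_norm \<sigma> (\<lambda>\<phi>. \<Lambda> \<tau> \<phi> - \<Lambda> t \<phi>)) \<longlongrightarrow> 0) (at t within J))"

definition sobolev_C1 :: "real \<Rightarrow> real set \<Rightarrow> (real \<Rightarrow> distr) \<Rightarrow> (real \<Rightarrow> distr) \<Rightarrow> bool" where
  "sobolev_C1 \<sigma> J \<Lambda> \<Lambda>' \<longleftrightarrow>
     sobolev_continuous \<sigma> J \<Lambda> \<and> sobolev_continuous \<sigma> J \<Lambda>' \<and>
     (\<forall>t\<in>J. ((\<lambda>\<tau>. sobolev_norm \<sigma>
                   (\<lambda>\<phi>. (\<Lambda> \<tau> \<phi> - \<Lambda> t \<phi>) / complex_of_real (\<tau> - t) - \<Lambda>' t \<phi>)) \<longlongrightarrow> 0)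
              (at t within J))"

definition life_span :: "ereal \<Rightarrow> real set" where
  "life_span T = {t. 0 \<le> t \<and> ereal t < T}"


section \<open>The two-component system\<close>

text \<open>The operator \<open>(1 - \<partial>\<^sub>x\<^sup>2)\<^bsup>-1\<^esup>\<close>, i.e. convolution with \<open>p(x) = exp (- \<bar>x\<bar>) / 2\<close>;
  \<open>u = helmholtz_inv m\<close> and \<open>v = helmholtz_inv n\<close> below.\<close>

definition helmholtz_inv :: "(real \<Rightarrow> real) \<Rightarrow> real \<Rightarrow> real" where
  "helmholtz_inv f x = (LINT y|lborel. (1/2) * exp (- \<bar>x - y\<bar>) * f y)"

definition speed :: "(real \<Rightarrow> real) \<Rightarrow> (real \<Rightarrow> real) \<Rightarrow> real \<Rightarrow> real" where
  "speed m n x =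
     (let u = helmholtz_inv m; v = helmholtz_inv n
      in (u x * v x - deriv u x * deriv v x) - (u x * deriv v x - deriv u x * v x))"

definition big_M :: "(real \<Rightarrow> real) \<Rightarrow> (real \<Rightarrow> real) \<Rightarrow> real \<Rightarrow> real" where
  "big_M m n x =
     (let u = helmholtz_inv m; v = helmholtz_inv n
      in (deriv u x * n x + deriv v x * m x) + (u x * n x - v x * m x))"

text \<open>Solutions in \<open>C([0,T); H\<^sup>s \<times> H\<^sup>s) \<inter> C\<^sup>1([0,T); H\<^bsup>s-1\<^esup> \<times> H\<^bsup>s-1\<^esup>)\<close>, the equations being
  equalities in \<open>H\<^bsup>s-1\<^esup>\<close>, which contains genuine distributions when \<open>s < 1\<close>.\<close>

definition is_solution ::
    "real \<Rightarrow> (real \<Rightarrow> real) \<Rightarrow> (real \<Rightarrow> real) \<Rightarrow> ereal \<Rightarrow>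
     (real \<Rightarrow> real \<Rightarrow> real) \<Rightarrow> (real \<Rightarrow> real \<Rightarrow> real) \<Rightarrow> bool" where
  "is_solution s m0 n0 T m n \<longleftrightarrow>
     m 0 = m0 \<and> n 0 = n0 \<and>
     (\<forall>t\<in>life_span T. m t \<in> Hs s \<and> n t \<in> Hs s) \<and>
     sobolev_continuous s (life_span T) (\<lambda>t. distr_of (m t)) \<and>
     sobolev_continuous s (life_span T) (\<lambda>t. distr_of (n t)) \<and>
     (\<exists>m' n'.
        sobolev_C1 (s - 1) (life_span T) (\<lambda>t. distr_of (m t)) m' \<and>
        sobolev_C1 (s - 1) (life_span T) (\<lambda>t. distr_of (n t)) n' \<and>
        (\<forall>t\<in>life_span T. \<forall>\<phi>\<in>schwartz.
           m' t \<phi> + distr_mult (speed (m t) (n t)) (distr_deriv (distr_of (m t))) \<phi>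
             = distr_of (\<lambda>x. - big_M (m t) (n t) x * m t x) \<phi> \<and>
           n' t \<phi> + distr_mult (speed (m t) (n t)) (distr_deriv (distr_of (n t))) \<phi>
             = distr_of (\<lambda>x. - big_M (m t) (n t) x * n t x) \<phi>))"

definition is_maximal_solution ::
    "real \<Rightarrow> (real \<Rightarrow> real) \<Rightarrow> (real \<Rightarrow> real) \<Rightarrow> ereal \<Rightarrow>
     (real \<Rightarrow> real \<Rightarrow> real) \<Rightarrow> (real \<Rightarrow> real \<Rightarrow> real) \<Rightarrow> bool" where
  "is_maximal_solution s m0 n0 T m n \<longleftrightarrow>
     0 < T \<and> is_solution s m0 n0 T m n \<and>
     \<not> (\<exists>T' m' n'. T < T' \<and> is_solution s m0 n0 T' m' n' \<and>
          (\<forall>t\<in>life_span T. m' t = m t \<and> n' t = n t))"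

definition is_flow ::
    "ereal \<Rightarrow> (real \<Rightarrow> real \<Rightarrow> real) \<Rightarrow> (real \<Rightarrow> real \<Rightarrow> real) \<Rightarrow> (real \<Rightarrow> real \<Rightarrow> real) \<Rightarrow> bool" where
  "is_flow T m n q \<longleftrightarrow>
     (\<forall>x. q 0 x = x \<and>
        (\<forall>t\<in>life_span T.
           ((\<lambda>\<tau>. q \<tau> x) has_real_derivative speed (m t) (n t) (q t x)) (at t within life_span T)))"

end

theory Submission
  imports Defs "HOL-Real_Asymp.Real_Asymp"
begin

text \<open>Write \<open>A = u + u\<^sub>x\<close> and \<open>B = v - v\<^sub>x\<close>, that is \<open>A(x) = \<integral>\<^bsub>y \<ge> x\<^esub> exp (x - y) m(y)\<close> and
  \<open>B(x) = \<integral>\<^bsub>y \<le> x\<^esub> exp (y - x) n(y)\<close>. Then \<open>w = A B\<close> and \<open>w\<^sub>x = n A - m B\<close> is the coefficient \<open>M\<close>, so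
  both equations are conservation laws \<open>m\<^sub>t + (w m)\<^sub>x = 0\<close>. Testing the weak formulation with smoothed
  indicator functions shows that the mass of \<open>m\<close> between two trajectories is constant; hence
  \<open>m, n \<ge> 0\<close>, \<open>0 \<le> A \<le> H\<^sub>1\<close>, \<open>0 \<le> B \<le> H\<^sub>2\<close>, and along the trajectory of \<open>x\<^sub>0\<close> the Jacobian
  \<open>J = q\<^sub>x\<close> equals \<open>m\<^sub>0 / m = n\<^sub>0 / n\<close> and satisfies \<open>J' = n\<^sub>0 A - m\<^sub>0 B\<close>. As \<open>w \<ge> 0\<close>, the trajectories move to
  the right, which bounds the growth of \<open>A\<close> and the decay of \<open>B\<close>, and gives
  \<open>0 < J(t) \<le> 1 + M(0) t + K t\<^sup>2 / 2\<close> with \<open>K < \<delta> N(0)\<close>. Since \<open>T\<^sub>1\<close> is the smaller root of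
  \<open>1 + M(0) t + \<delta> N(0) t\<^sup>2 / 2\<close>, the solution ends strictly before \<open>T\<^sub>1\<close>; in particular the case
  \<open>T\<^sub>0 = T\<^sub>1\<close> never occurs.\<close>

section \<open>Integration and Schwartz functions\<close>

text \<open>For \<open>s < 1\<close> the space derivative of \<open>m\<close> is in general only a
  distribution, so the equations cannot be evaluated along a trajectory and \<open>M(t)\<close>
  cannot simply be differentiated. What is available: \<open>m\<close> and \<open>n\<close> are
  jointly continuous, and the averages \<open>A\<close> and \<open>B\<close>, hence
  \<open>w\<close>, gain a derivative in \<open>x\<close>. Conserved masses therefore replace
  pointwise equations, and the Jacobian arises as a limit of length ratios of intervals carrying the
  same mass. Passing from \<open>M\<close> to \<open>J'\<close> removes the later densities: only
  the values of \<open>m\<^sub>0\<close> and \<open>n\<^sub>0\<close> at \<open>x\<^sub>0\<close>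
  remain.

  Formally \<open>A' \<le> w A\<close> and \<open>B' \<ge> - w B\<close> along the trajectory, with
  \<open>0 \<le> w \<le> H\<^sub>1 H\<^sub>2\<close>, so \<open>J'' \<le> K\<close> for \<open>K =
  (n\<^sub>0 H\<^sub>1 + m\<^sub>0 H\<^sub>2) H\<^sub>1 H\<^sub>2\<close>; this is proved through
  increments, without differentiating \<open>A\<close> and \<open>B\<close> in time. Since
  \<open>K\<close> is at most \<open>N(0) (H\<^sub>1 + H\<^sub>2)^3\<close>, the factor 3/2 in
  \<open>\<delta>\<close> makes the comparison strict.\<close>

lemma Cauchy_Schwarz_lebesgue:
  fixes f g :: "'a \<Rightarrow> real"
  assumes [measurable]: "f \<in> borel_measurable M" "g \<in> borel_measurable M"
    and f2: "integrable M (\<lambda>x. (f x)\<^sup>2)" and g2: "integrable M (\<lambda>x. (g x)\<^sup>2)"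
  shows integrable_mult_square_integrable: "integrable M (\<lambda>x. f x * g x)"
    and integral_abs_mult_le: "(LINT x|M. \<bar>f x * g x\<bar>) \<le> sqrt (LINT x|M. (f x)\<^sup>2) * sqrt (LINT x|M. (g x)\<^sup>2)"
proof -
  have am: "\<bar>f x * g x\<bar> \<le> (f x)\<^sup>2 + (g x)\<^sup>2" for x
  proof -
    have "0 \<le> (f x)\<^sup>2 + (g x)\<^sup>2" by simp
    moreover have "2 * \<bar>f x\<bar> * \<bar>g x\<bar> \<le> (f x)\<^sup>2 + (g x)\<^sup>2"
      using sum_squares_bound[of "\<bar>f x\<bar>" "\<bar>g x\<bar>"] by simp
    ultimately show ?thesis unfolding abs_mult by linarith
  qed
  show *: "integrable M (\<lambda>x. f x * g x)"
    by (rule Bochner_Integration.integrable_bound[OF Bochner_Integration.integrable_add[OF f2 g2]])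
       (use am in \<open>auto intro!: AE_I2\<close>)
  define I where "I = (LINT x|M. \<bar>f x * g x\<bar>)"
  define a where "a = (LINT x|M. (f x)\<^sup>2)"
  define b where "b = (LINT x|M. (g x)\<^sup>2)"
  have I0: "I \<ge> 0" "a \<ge> 0" "b \<ge> 0" unfolding I_def a_def b_def by auto
  \<comment> \<open>The discriminant argument: \<open>c = I / b\<close> gives the claim, and if
    \<open>b = 0\<close>, then \<open>c = (a + 1) / I\<close> would make the right-hand side
    negative unless \<open>I = 0\<close>.\<close>
  have quad: "0 \<le> a - 2 * c * I + c\<^sup>2 * b" for c
  proof -
    have "0 \<le> (LINT x|M. (\<bar>f x\<bar> - c * \<bar>g x\<bar>)\<^sup>2)" by simp
    also have "\<dots> = (LINT x|M. (f x)\<^sup>2 - 2 * c * \<bar>f x * g x\<bar> + c\<^sup>2 * (g x)\<^sup>2)"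
      by (rule Bochner_Integration.integral_cong) (auto simp: power2_diff abs_mult power_mult_distrib algebra_simps)
    also have "\<dots> = a - 2 * c * I + c\<^sup>2 * b"
      unfolding a_def b_def I_def using * f2 g2 by simp
    finally show ?thesis .
  qed
  have "I\<^sup>2 \<le> a * b"
  proof (cases "b = 0")
    case True
    have "I = 0"
    proof (rule ccontr)
      assume "I \<noteq> 0"
      with quad[of "(a+1)/I"] True show False using I0 by simp
    qed
    then show ?thesis using I0 by simp
  next
    case False
    with quad[of "I/b"] I0 show ?thesis by (simp add: power2_eq_square field_simps)
  qed
  then have "I \<le> sqrt (a * b)" by (rule real_le_rsqrt)
  then show "(LINT x|M. \<bar>f x * g x\<bar>) \<le> sqrt (LINT x|M. (f x)\<^sup>2) * sqrt (LINT x|M. (g x)\<^sup>2)"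
    unfolding I_def a_def b_def real_sqrt_mult by simp
qed

lemma lborel_integral_FTC_UNIV:
  fixes F f :: "real \<Rightarrow> 'a::euclidean_space"
  assumes "\<And>x. (F has_vector_derivative f x) (at x)" "continuous_on UNIV f"
    "integrable lborel f" "(F \<longlongrightarrow> A) at_bot" "(F \<longlongrightarrow> B) at_top"
  shows "(LINT x|lborel. f x) = B - A"
proof -
  have "(LBINT x=-\<infinity>..\<infinity>. f x) = B - A"
  proof (rule interval_integral_FTC_integrable)
    show "((F \<circ> real_of_ereal) \<longlongrightarrow> A) (at_right (-\<infinity>))"
      by (simp add: ereal_tendsto_simps1 assms)
    show "((F \<circ> real_of_ereal) \<longlongrightarrow> B) (at_left \<infinity>)"
      by (simp add: ereal_tendsto_simps1 assms)
  qed (use assms in \<open>auto simp: continuous_on_eq_continuous_at set_integrable_def\<close>)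
  then show ?thesis
    by (simp add: interval_lebesgue_integral_def set_lebesgue_integral_def)
qed

lemma inverse_one_plus_square_integrable: "integrable lborel (\<lambda>x::real. inverse (1 + x\<^sup>2))"
proof -
  have "set_integrable lborel (einterval (-\<infinity>) \<infinity>) (\<lambda>x::real. inverse (1 + x\<^sup>2))"
  proof (rule interval_integral_FTC_nonneg)
    show "DERIV arctan x :> inverse (1 + x\<^sup>2)" for x by (rule DERIV_arctan)
    show "((arctan \<circ> real_of_ereal) \<longlongrightarrow> - (pi/2)) (at_right (-\<infinity>))"
      by (simp add: ereal_tendsto_simps1 tendsto_arctan_at_bot)
    show "((arctan \<circ> real_of_ereal) \<longlongrightarrow> (pi/2)) (at_left \<infinity>)"
      by (simp add: ereal_tendsto_simps1 tendsto_arctan_at_top)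
  qed (auto intro!: continuous_intros simp: add_nonneg_eq_0_iff add_pos_nonneg)
  then show ?thesis by (simp add: set_integrable_def)
qed

text \<open>Integrability of this weight is what lets the Sobolev norm of order \<open>s\<close>
  control point values. \<open>h\<close> and its reflection dominate the two tails, an indicator
  dominates the middle.\<close>

lemma one_plus_square_powr_integrable:
  assumes "s > 1/2"
  shows "integrable lborel (\<lambda>x::real. (1 + x\<^sup>2) powr (-s))"
proof -
  define h :: "real \<Rightarrow> real" where "h x = indicator {1<..} x * x powr (-2 * s)" for x
  have "set_integrable lborel (einterval 1 \<infinity>) (\<lambda>x::real. x powr (-2 * s))"
  proof (rule interval_integral_FTC_nonneg)
    fix x :: real assume "1 < ereal x"
    then have "x > 1" by simp
    then show "DERIV (\<lambda>x. x powr (1-2 * s) / (1-2 * s)) x :> x powr (-2 * s)"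
      using assms by (auto intro!: derivative_eq_intros)
    show "isCont (\<lambda>x. x powr (-2 * s)) x" using \<open>x > 1\<close> by (auto intro!: continuous_intros)
  next
    have "((\<lambda>x. x powr (1-2 * s) / (1-2 * s)) \<longlongrightarrow> 1 powr (1-2 * s) / (1-2 * s)) (at_right 1)"
      by (intro tendsto_divide tendsto_powr tendsto_ident_at tendsto_const) (use assms in auto)
    then show "(((\<lambda>x. x powr (1-2 * s) / (1-2 * s)) \<circ> real_of_ereal) \<longlongrightarrow> 1 powr (1-2 * s) / (1-2 * s)) (at_right 1)"
      by (simp add: ereal_tendsto_simps1 one_ereal_def)
    have "((\<lambda>x::real. x powr (1-2 * s)) \<longlongrightarrow> 0) at_top"
      by (rule tendsto_neg_powr) (use assms in \<open>auto simp: filterlim_ident\<close>)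
    then have "((\<lambda>x. x powr (1-2 * s) / (1-2 * s)) \<longlongrightarrow> 0) at_top"
      by (rule tendsto_divide_zero)
    then show "(((\<lambda>x. x powr (1-2 * s) / (1-2 * s)) \<circ> real_of_ereal) \<longlongrightarrow> 0) (at_left \<infinity>)"
      by (simp add: ereal_tendsto_simps1)
  qed auto
  moreover have "einterval 1 \<infinity> = {1::real<..}" by (auto simp: einterval_def)
  ultimately have h: "integrable lborel h"
    by (simp add: set_integrable_def h_def[abs_def])
  have h': "integrable lborel (\<lambda>x. h (- x))"
    using lborel_integrable_real_affine[OF h, of "-1" 0] by simp
  have i: "integrable lborel (indicator {-1..1::real} :: real \<Rightarrow> real)" by simp
  show ?thesis
  proof (rule Bochner_Integration.integrable_bound[OF Bochner_Integration.integrable_add[OF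
        Bochner_Integration.integrable_add[OF h h'] i]], safe intro!: AE_I2)
    fix x :: real
    have hn: "h y \<ge> 0" for y by (simp add: h_def)
    have big: "(1 + y\<^sup>2) powr (-s) \<le> h y" if "y > 1" for y
    proof -
      have "(1 + y\<^sup>2) powr (-s) \<le> (y\<^sup>2) powr (-s)"
        using that assms by (intro powr_mono2') auto
      also have "\<dots> = y powr (-2 * s)"
        using that by (simp add: powr_powr flip: powr_numeral)
      finally show ?thesis using that by (simp add: h_def)
    qed
    have "(1 + x\<^sup>2) powr (-s) \<le> h x + h (-x) + indicator {-1..1} x"
    proof -
      consider "x > 1" | "x < -1" | "x \<in> {-1..1}" by fastforce
      then show ?thesis
      proof cases
        case 1 then show ?thesis using big[of x] hn[of "-x"] by (simp add: add_increasing2)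
      next
        case 2 then show ?thesis using big[of "-x"] hn[of "x"] by (simp add: add_increasing2)
      next
        case 3
        have "(1 + x\<^sup>2) powr (-s) \<le> (1+x\<^sup>2) powr 0" by (rule powr_mono) (use assms in auto)
        also have "\<dots> = 1" by (simp add: add_nonneg_eq_0_iff)
        finally show ?thesis using 3 hn[of x] hn[of "-x"] by simp
      qed
    qed
    then show "norm ((1 + x\<^sup>2) powr (-s)) \<le> norm (h x + h (-x) + indicator {-1..1} x)"
      using hn[of x] hn[of "-x"] by simp
  qed measurable
qed

section \<open>Schwartz functions: decay, integrability and inverse Fourier transform\<close>

lemma schwartz_has_vector_derivative:
  assumes "\<phi> \<in> schwartz"
  shows "(\<phi> has_vector_derivative vderiv \<phi> x) (at x)"
proof -
  have "(vderiv ^^ 0) \<phi> differentiable (at x)" using assms unfolding schwartz_def by blast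
  then show ?thesis by (simp add: vderiv_def vector_derivative_works)
qed

lemma schwartz_vderiv:
  assumes "\<phi> \<in> schwartz"
  shows "vderiv \<phi> \<in> schwartz"
proof -
  have "(vderiv ^^ k) (vderiv \<phi>) = (vderiv ^^ Suc k) \<phi>" for k
    by (simp only: funpow_Suc_right comp_def)
  then show ?thesis using assms unfolding schwartz_def by (simp del: funpow.simps) 
qed

lemma schwartz_continuous: "\<phi> \<in> schwartz \<Longrightarrow> continuous_on UNIV \<phi>"
  by (metis continuous_at_imp_continuous_on has_vector_derivative_continuous schwartz_has_vector_derivative)

lemma schwartz_measurable: "\<phi> \<in> schwartz \<Longrightarrow> \<phi> \<in> borel_measurable borel"
  by (intro borel_measurable_continuous_onI schwartz_continuous)

lemma schwartz_decay:
  assumes "\<phi> \<in> schwartz"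
  obtains C where "\<And>x. cmod (\<phi> x) \<le> C * inverse (1 + x\<^sup>2)" "C > 0"
proof -
  have b: "bounded (range (\<lambda>x. x ^ j *\<^sub>R \<phi> x))" for j
  proof -
    have "bounded (range (\<lambda>x. x ^ j *\<^sub>R (vderiv ^^ 0) \<phi> x))"
      using assms unfolding schwartz_def by blast
    then show ?thesis by simp
  qed
  obtain C0 where C0: "\<And>x. cmod (\<phi> x) \<le> C0"
    using b[of 0] by (auto simp: bounded_iff)
  obtain C2 where C2: "\<And>x. x\<^sup>2 * cmod (\<phi> x) \<le> C2"
    using b[of 2] by (auto simp: bounded_iff)
  show ?thesis
  proof
    fix x
    have "(1 + x\<^sup>2) * cmod (\<phi> x) \<le> \<bar>C0\<bar> + \<bar>C2\<bar> + 1"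
      using C0[of x] C2[of x] by (simp add: algebra_simps)
    then show "cmod (\<phi> x) \<le> (\<bar>C0\<bar> + \<bar>C2\<bar> + 1) * inverse (1 + x\<^sup>2)"
      by (simp add: field_simps add_pos_nonneg)
  qed simp
qed

lemma schwartz_integrable: 
  assumes "\<phi> \<in> schwartz" shows "integrable lborel \<phi>"
proof -
  obtain C where C: "\<And>x. cmod (\<phi> x) \<le> C * inverse (1 + x\<^sup>2)" "C > 0"
    using schwartz_decay[OF assms] by blast
  show ?thesis
    by (rule Bochner_Integration.integrable_bound[OF integrable_mult_right[OF inverse_one_plus_square_integrable, of C]])
       (use C schwartz_measurable[OF assms] in \<open>auto intro!: AE_I2 simp: add_pos_nonneg\<close>)
qed

lemma schwartz_square_integrable: 
  assumes "\<phi> \<in> schwartz" shows "integrable lborel (\<lambda>x. (cmod (\<phi> x))\<^sup>2)"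
proof -
  obtain C where C: "\<And>x. cmod (\<phi> x) \<le> C * inverse (1 + x\<^sup>2)" "C > 0"
    using schwartz_decay[OF assms] by blast
  have "(cmod (\<phi> x))\<^sup>2 \<le> C * cmod (\<phi> x)" for x
  proof -
    have "C * inverse (1 + x\<^sup>2) \<le> C" using C(2) by (simp add: field_simps add_pos_nonneg)
    with C(1)[of x] show ?thesis by (simp add: power2_eq_square mult_right_mono)
  qed
  then show ?thesis
    by (intro Bochner_Integration.integrable_bound[OF integrable_mult_right[OF integrable_norm[OF schwartz_integrable[OF assms]], of C]])
       (use C(2) schwartz_measurable[OF assms] in \<open>auto intro!: AE_I2\<close>)
qed

lemma schwartz_tendsto_0:
  assumes "\<phi> \<in> schwartz" 
  shows "(\<phi> \<longlongrightarrow> 0) at_top" "(\<phi> \<longlongrightarrow> 0) at_bot"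
proof -
  obtain C where C: "\<And>x. cmod (\<phi> x) \<le> C * inverse (1 + x\<^sup>2)" "C > 0"
    using schwartz_decay[OF assms] by blast
  have "((\<lambda>x::real. C * inverse (1 + x\<^sup>2)) \<longlongrightarrow> 0) at_top" "((\<lambda>x::real. C * inverse (1 + x\<^sup>2)) \<longlongrightarrow> 0) at_bot"
    by real_asymp+
  then show "(\<phi> \<longlongrightarrow> 0) at_top" and "(\<phi> \<longlongrightarrow> 0) at_bot"
    using C(1) by (auto intro!: always_eventually Lim_null_comparison[where g="\<lambda>x. C * inverse (1 + x\<^sup>2)"])
qed

text \<open>Integration by parts: the sum of the two integrands is the derivative of
  \<open>\<phi> x * cis (x * \<xi>)\<close>, which vanishes at both ends of the line.\<close>

lemma inv_fourier_vderiv: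
  assumes "\<phi> \<in> schwartz"
  shows "inv_fourier (vderiv \<phi>) \<xi> = - \<i> * complex_of_real \<xi> * inv_fourier \<phi> \<xi>"
proof -
  have int: "integrable lborel (\<lambda>x. \<psi> x * cis (x * \<xi>))" if "\<psi> \<in> schwartz" for \<psi>
    by (rule Bochner_Integration.integrable_bound[OF schwartz_integrable[OF that]])
       (auto simp: norm_mult intro!: AE_I2 borel_measurable_times schwartz_measurable[OF that] borel_measurable_continuous_onI[of "\<lambda>x. cis (x * \<xi>)"] continuous_intros)
  have i1: "integrable lborel (\<lambda>x. vderiv \<phi> x * cis (x * \<xi>))" by (rule int[OF schwartz_vderiv[OF assms]])
  have i2: "integrable lborel (\<lambda>x. \<i> * complex_of_real \<xi> * (\<phi> x * cis (x * \<xi>)))"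
    by (rule integrable_mult_right[OF int[OF assms]])
  have "(LINT x|lborel. vderiv \<phi> x * cis (x * \<xi>) + \<i> * complex_of_real \<xi> * (\<phi> x * cis (x * \<xi>))) = 0 - 0"
  proof (rule lborel_integral_FTC_UNIV)
    fix x
    show "((\<lambda>x. \<phi> x * cis (x * \<xi>)) has_vector_derivative vderiv \<phi> x * cis (x * \<xi>) + \<i> * complex_of_real \<xi> * (\<phi> x * cis (x * \<xi>))) (at x)"
    proof -
      have "((\<lambda>x. cis (x * \<xi>)) has_vector_derivative \<xi> *\<^sub>R (\<i> * cis (x * \<xi>))) (at x)"
        by (auto intro!: derivative_eq_intros simp: has_vector_derivative_def scaleR_conv_of_real)
      from has_vector_derivative_mult[OF schwartz_has_vector_derivative[OF assms] this]
      show ?thesis by (simp add: scaleR_conv_of_real algebra_simps)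
    qed
  next
    show "continuous_on UNIV (\<lambda>x. vderiv \<phi> x * cis (x * \<xi>) + \<i> * complex_of_real \<xi> * (\<phi> x * cis (x * \<xi>)))"
      by (intro continuous_intros schwartz_continuous[OF assms] schwartz_continuous[OF schwartz_vderiv[OF assms]])
  next
    show "((\<lambda>x. \<phi> x * cis (x * \<xi>)) \<longlongrightarrow> 0) at_bot" "((\<lambda>x. \<phi> x * cis (x * \<xi>)) \<longlongrightarrow> 0) at_top"
      by (rule tendsto_norm_zero_cancel, simp add: norm_mult tendsto_norm_zero schwartz_tendsto_0[OF assms])+
  qed (intro Bochner_Integration.integrable_add i1 i2)
  then have "(LINT x|lborel. vderiv \<phi> x * cis (x * \<xi>)) + \<i> * complex_of_real \<xi> * (LINT x|lborel. \<phi> x * cis (x * \<xi>)) = 0"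
    by (subst (asm) Bochner_Integration.integral_add[OF i1 i2]) simp
  then show ?thesis
    unfolding inv_fourier_def by (simp add: field_simps eq_neg_iff_add_eq_0)
qed

lemma inv_fourier_bound:
  "cmod (inv_fourier \<phi> \<xi>) \<le> (LINT x|lborel. cmod (\<phi> x)) / (2 * pi)"
proof -
  have "cmod (LINT x|lborel. \<phi> x * cis (x * \<xi>)) \<le> (LINT x|lborel. cmod (\<phi> x * cis (x * \<xi>)))"
    by (rule integral_norm_bound)
  then show ?thesis unfolding inv_fourier_def by (simp add: norm_divide norm_mult divide_right_mono)
qed

text \<open>Two derivatives of \<open>\<phi>\<close> produce the factor
  \<open>\<xi>\<^sup>2\<close>. Quadratic decay suffices for the dual weight of every order
  \<open>\<sigma> \<ge> -1\<close>, which covers both \<open>s\<close> and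
  \<open>s - 1\<close>.\<close>

lemma inv_fourier_decay:
  assumes "\<phi> \<in> schwartz"
  obtains C where "\<And>\<xi>. cmod (inv_fourier \<phi> \<xi>) \<le> C * inverse (1 + \<xi>\<^sup>2)" "C > 0"
proof -
  define C0 where "C0 = (LINT x|lborel. cmod (\<phi> x)) / (2 * pi)"
  define C2 where "C2 = (LINT x|lborel. cmod (vderiv (vderiv \<phi>) x)) / (2 * pi)"
  have nn: "C0 \<ge> 0" "C2 \<ge> 0" by (auto simp: C0_def C2_def)
  show ?thesis
  proof
    fix \<xi>
    have "inv_fourier (vderiv (vderiv \<phi>)) \<xi> = - complex_of_real (\<xi>\<^sup>2) * inv_fourier \<phi> \<xi>"
      by (simp add: inv_fourier_vderiv assms schwartz_vderiv power2_eq_square algebra_simps)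
    then have "cmod (inv_fourier (vderiv (vderiv \<phi>)) \<xi>) = \<xi>\<^sup>2 * cmod (inv_fourier \<phi> \<xi>)"
      by (simp add: norm_mult norm_power)
    then have "\<xi>\<^sup>2 * cmod (inv_fourier \<phi> \<xi>) \<le> C2"
      using inv_fourier_bound[of "vderiv (vderiv \<phi>)" \<xi>] by (simp add: C2_def)
    moreover have "cmod (inv_fourier \<phi> \<xi>) \<le> C0"
      using inv_fourier_bound[of "\<phi>" \<xi>] by (simp add: C0_def)
    ultimately have "(1 + \<xi>\<^sup>2) * cmod (inv_fourier \<phi> \<xi>) \<le> C0 + C2 + 1"
      by (simp add: algebra_simps)
    then show "cmod (inv_fourier \<phi> \<xi>) \<le> (C0 + C2 + 1) * inverse (1 + \<xi>\<^sup>2)"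
      by (simp add: field_simps add_pos_nonneg)
  qed (use nn in simp)
qed

lemma inv_fourier_measurable [measurable]:
  assumes [measurable]: "\<phi> \<in> borel_measurable borel"
  shows "inv_fourier \<phi> \<in> borel_measurable borel"
proof -
  have [measurable]: "cis \<in> borel_measurable borel"
    by (intro borel_measurable_continuous_onI continuous_intros)
  show ?thesis unfolding inv_fourier_def by measurable
qed

section \<open>Sobolev norms as bounds on pairings\<close>

text \<open>The dual norm, of order \<open>-\<sigma>\<close>, of the test function, chosen so that a
  pairing is at most the Sobolev norm of the functional times this number.\<close>

definition sobolev_weight :: "real \<Rightarrow> (real \<Rightarrow> complex) \<Rightarrow> real" where
  "sobolev_weight \<sigma> \<phi> = sqrt (LINT \<xi>|lborel. (1 + \<xi>\<^sup>2) powr (-\<sigma>) * (cmod (inv_fourier \<phi> \<xi>))\<^sup>2)"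

lemma dual_weight_integrable:
  assumes "\<phi> \<in> schwartz" "\<sigma> \<ge> -1"
  shows "integrable lborel (\<lambda>\<xi>. (1 + \<xi>\<^sup>2) powr (-\<sigma>) * (cmod (inv_fourier \<phi> \<xi>))\<^sup>2)"
proof -
  note [measurable] = schwartz_measurable[OF assms(1)]
  obtain C where C: "\<And>x. cmod (inv_fourier \<phi> x) \<le> C * inverse (1 + x\<^sup>2)" "C > 0"
    using inv_fourier_decay[OF assms(1)] by blast
  show ?thesis
  proof (rule Bochner_Integration.integrable_bound[OF integrable_mult_right[OF inverse_one_plus_square_integrable, of "C\<^sup>2"]], safe intro!: AE_I2)
    fix x :: real
    have p: "1 + x\<^sup>2 > 0" by (simp add: add_pos_nonneg)
    have "(1 + x\<^sup>2) powr (-\<sigma>) \<le> (1 + x\<^sup>2) powr 1" by (rule powr_mono) (use assms in auto)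
    then have "(1 + x\<^sup>2) powr (-\<sigma>) \<le> 1 + x\<^sup>2" using p by simp
    then have "(1 + x\<^sup>2) powr (-\<sigma>) * (cmod (inv_fourier \<phi> x))\<^sup>2 \<le> (1 + x\<^sup>2) * (C * inverse (1 + x\<^sup>2))\<^sup>2"
      using C(1)[of x] p by (intro mult_mono power_mono) auto
    also have "\<dots> = C\<^sup>2 * inverse (1 + x\<^sup>2)" using p by (simp add: power_mult_distrib power2_eq_square[of "inverse (1 + x\<^sup>2)"])
    finally show "norm ((1 + x\<^sup>2) powr (-\<sigma>) * (cmod (inv_fourier \<phi> x))\<^sup>2) \<le> norm (C\<^sup>2 * inverse (1 + x\<^sup>2))"
      using p by simp
  qed measurable
qed

text \<open>Cauchy-Schwarz after splitting the weight evenly: \<open>a\<close> carries the exponent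
  \<open>\<sigma>/2\<close>, \<open>b\<close> the exponent \<open>-\<sigma>/2\<close>, and the
  product of the two powers is 1.\<close>

lemma sobolev_transform_pairing:
  assumes g: "sobolev_transform \<sigma> \<Lambda> g" and phi: "\<phi> \<in> schwartz" and s: "\<sigma> \<ge> -1"
  shows "integrable lborel (\<lambda>\<xi>. g \<xi> * inv_fourier \<phi> \<xi>)"
    and "cmod (\<Lambda> \<phi>) \<le> sqrt (LINT \<xi>|lborel. (1 + \<xi>\<^sup>2) powr \<sigma> * (cmod (g \<xi>))\<^sup>2) * sobolev_weight \<sigma> \<phi>"
proof -
  note [measurable] = schwartz_measurable[OF phi]
  have [measurable]: "g \<in> borel_measurable borel" using g unfolding sobolev_transform_def by simp
  define a where "a \<xi> = (1 + \<xi>\<^sup>2) powr (\<sigma>/2) * cmod (g \<xi>)" for \<xi>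
  define b where "b \<xi> = (1 + \<xi>\<^sup>2) powr (-\<sigma>/2) * cmod (inv_fourier \<phi> \<xi>)" for \<xi>
  have [measurable]: "a \<in> borel_measurable borel" "b \<in> borel_measurable borel"
    unfolding a_def[abs_def] b_def[abs_def] by measurable
  have p: "1 + \<xi>\<^sup>2 > 0" for \<xi> :: real by (simp add: add_pos_nonneg)
  have sq: "(x powr r)\<^sup>2 = x powr (2 * r)" if "x > 0" for x r :: real
    using that by (simp add: power2_eq_square flip: powr_add)
  have a2: "(a \<xi>)\<^sup>2 = (1 + \<xi>\<^sup>2) powr \<sigma> * (cmod (g \<xi>))\<^sup>2" for \<xi>
    using p[of \<xi>] by (simp add: a_def power_mult_distrib sq)
  have b2: "(b \<xi>)\<^sup>2 = (1 + \<xi>\<^sup>2) powr (-\<sigma>) * (cmod (inv_fourier \<phi> \<xi>))\<^sup>2" for \<xi>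
    using p[of \<xi>] by (simp add: b_def power_mult_distrib sq)
  have ab: "a \<xi> * b \<xi> = cmod (g \<xi> * inv_fourier \<phi> \<xi>)" for \<xi>
  proof -
    have "(1 + \<xi>\<^sup>2) powr (\<sigma>/2) * (1 + \<xi>\<^sup>2) powr (-\<sigma>/2) = 1"
      using p[of \<xi>] by (simp flip: powr_add)
    then show ?thesis by (simp add: a_def b_def norm_mult mult_ac)
  qed
  have ia: "integrable lborel (\<lambda>\<xi>. (a \<xi>)\<^sup>2)" using g by (simp add: a2 sobolev_transform_def)
  have ib: "integrable lborel (\<lambda>\<xi>. (b \<xi>)\<^sup>2)" using dual_weight_integrable[OF phi s] by (simp add: b2)
  have iab: "integrable lborel (\<lambda>\<xi>. a \<xi> * b \<xi>)"
    by (rule integrable_mult_square_integrable[OF _ _ ia ib]) auto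
  then show i: "integrable lborel (\<lambda>\<xi>. g \<xi> * inv_fourier \<phi> \<xi>)"
    by (subst integrable_norm_iff[symmetric]) (auto simp: ab)
  have "cmod (\<Lambda> \<phi>) = cmod (LINT \<xi>|lborel. g \<xi> * inv_fourier \<phi> \<xi>)"
    using g phi by (simp add: sobolev_transform_def)
  also have "\<dots> \<le> (LINT \<xi>|lborel. cmod (g \<xi> * inv_fourier \<phi> \<xi>))"
    by (rule integral_norm_bound)
  also have "\<dots> = (LINT \<xi>|lborel. \<bar>a \<xi> * b \<xi>\<bar>)" by (simp add: ab)
  also have "\<dots> \<le> sqrt (LINT x|lborel. (a x)\<^sup>2) * sqrt (LINT x|lborel. (b x)\<^sup>2)"
    by (rule integral_abs_mult_le[OF _ _ ia ib]) auto
  finally show "cmod (\<Lambda> \<phi>) \<le> sqrt (LINT \<xi>|lborel. (1 + \<xi>\<^sup>2) powr \<sigma> * (cmod (g \<xi>))\<^sup>2) * sobolev_weight \<sigma> \<phi>"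
    by (simp add: a2 b2 sobolev_weight_def)
qed

text \<open>The pairing bound holds for every transform of \<open>\<Lambda>\<close>, hence for the
  one that \<open>SOME\<close> picks inside \<open>sobolev_norm\<close>.\<close>

lemma sobolev_pairing_le_norm:
  assumes "\<Lambda> \<in> sobolev \<sigma>" "\<phi> \<in> schwartz" "\<sigma> \<ge> -1"
  shows "cmod (\<Lambda> \<phi>) \<le> sobolev_norm \<sigma> \<Lambda> * sobolev_weight \<sigma> \<phi>"
proof -
  have "sobolev_transform \<sigma> \<Lambda> (SOME g. sobolev_transform \<sigma> \<Lambda> g)"
    using assms(1) unfolding sobolev_def mem_Collect_eq by (rule someI_ex)
  from sobolev_transform_pairing(2)[OF this assms(2,3)] show ?thesis
    unfolding sobolev_norm_def Let_def .
qed

lemma sobolev_norm_nonneg: "sobolev_norm \<sigma> \<Lambda> \<ge> 0"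
  unfolding sobolev_norm_def Let_def by (intro real_sqrt_ge_zero integral_nonneg_AE) auto

text \<open>The pairing bound speaks only of members of the Sobolev space. Continuity and
  differentiability of curves involve norms of differences and difference quotients, which must
  first be shown to be members.\<close>

lemma sobolev_linear_combination:
  assumes "\<Lambda>1 \<in> sobolev \<sigma>" "\<Lambda>2 \<in> sobolev \<sigma>" and s: "\<sigma> \<ge> -1"
  shows "(\<lambda>\<phi>. c1 * \<Lambda>1 \<phi> + c2 * \<Lambda>2 \<phi>) \<in> sobolev \<sigma>"
proof -
  obtain g1 g2 where g: "sobolev_transform \<sigma> \<Lambda>1 g1" "sobolev_transform \<sigma> \<Lambda>2 g2"
    using assms unfolding sobolev_def by auto
  have [measurable]: "g1 \<in> borel_measurable borel" "g2 \<in> borel_measurable borel"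
    using g unfolding sobolev_transform_def by auto
  define g where "g = (\<lambda>\<xi>. c1 * g1 \<xi> + c2 * g2 \<xi>)"
  have i: "integrable lborel (\<lambda>\<xi>. 2 * (cmod c1)\<^sup>2 * ((1 + \<xi>\<^sup>2) powr \<sigma> * (cmod (g1 \<xi>))\<^sup>2) +
      2 * (cmod c2)\<^sup>2 * ((1 + \<xi>\<^sup>2) powr \<sigma> * (cmod (g2 \<xi>))\<^sup>2))"
    using g unfolding sobolev_transform_def by auto
  have "sobolev_transform \<sigma> (\<lambda>\<phi>. c1 * \<Lambda>1 \<phi> + c2 * \<Lambda>2 \<phi>) g"
    unfolding sobolev_transform_def
  proof (intro conjI ballI)
    show "g \<in> borel_measurable lborel" unfolding g_def by measurable
    show "integrable lborel (\<lambda>\<xi>. (1 + \<xi>\<^sup>2) powr \<sigma> * (cmod (g \<xi>))\<^sup>2)"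
    proof (rule Bochner_Integration.integrable_bound[OF i], safe intro!: AE_I2)
      fix \<xi> :: real
      have "(cmod (g \<xi>))\<^sup>2 \<le> (cmod c1 * cmod (g1 \<xi>) + cmod c2 * cmod (g2 \<xi>))\<^sup>2"
        unfolding g_def by (intro power_mono) (metis norm_mult norm_triangle_ineq, simp)
      also have "\<dots> \<le> 2 * (cmod c1 * cmod (g1 \<xi>))\<^sup>2 + 2 * (cmod c2 * cmod (g2 \<xi>))\<^sup>2"
        using sum_squares_bound[of "cmod c1 * cmod (g1 \<xi>)" "cmod c2 * cmod (g2 \<xi>)"]
        by (simp add: power2_sum)
      finally have "(1 + \<xi>\<^sup>2) powr \<sigma> * (cmod (g \<xi>))\<^sup>2 \<le> (1 + \<xi>\<^sup>2) powr \<sigma> * (2 * (cmod c1 * cmod (g1 \<xi>))\<^sup>2 + 2 * (cmod c2 * cmod (g2 \<xi>))\<^sup>2)"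
        by (intro mult_left_mono) auto
      then show "norm ((1 + \<xi>\<^sup>2) powr \<sigma> * (cmod (g \<xi>))\<^sup>2) \<le>
         norm (2 * (cmod c1)\<^sup>2 * ((1 + \<xi>\<^sup>2) powr \<sigma> * (cmod (g1 \<xi>))\<^sup>2) + 2 * (cmod c2)\<^sup>2 * ((1 + \<xi>\<^sup>2) powr \<sigma> * (cmod (g2 \<xi>))\<^sup>2))"
        by (simp add: power_mult_distrib algebra_simps)
    qed (unfold g_def, measurable)
    fix \<phi> :: "real \<Rightarrow> complex" assume phi: "\<phi> \<in> schwartz"
    have "c1 * \<Lambda>1 \<phi> + c2 * \<Lambda>2 \<phi> =
       (LINT \<xi>|lborel. c1 * (g1 \<xi> * inv_fourier \<phi> \<xi>) + c2 * (g2 \<xi> * inv_fourier \<phi> \<xi>))"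
      using g phi sobolev_transform_pairing(1)[OF g(1) phi s] sobolev_transform_pairing(1)[OF g(2) phi s]
      by (simp add: sobolev_transform_def)
    also have "\<dots> = (LINT \<xi>|lborel. g \<xi> * inv_fourier \<phi> \<xi>)"
      by (simp add: g_def algebra_simps)
    finally show "c1 * \<Lambda>1 \<phi> + c2 * \<Lambda>2 \<phi> = (LINT \<xi>|lborel. g \<xi> * inv_fourier \<phi> \<xi>)" .
  qed
  then show ?thesis unfolding sobolev_def by blast
qed

text \<open>The inverse transform is bounded by the L1 norm of \<open>\<phi>\<close>, and the
  remaining weight is integrable for \<open>s > 1/2\<close>. Having the L1 norm on the right is the
  point: kernels of unit mass get a bound that does not grow as they concentrate.\<close>

lemma sobolev_weight_le:
  assumes "s > 1/2"
  obtains C where "C \<ge> 0" "\<And>\<phi>. \<phi> \<in> schwartz \<Longrightarrow> sobolev_weight s \<phi> \<le> C * (LINT x|lborel. cmod (\<phi> x))"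
proof
  define I where "I = (LINT \<xi>|lborel. (1 + \<xi>\<^sup>2) powr (-s))"
  have "I \<ge> 0" unfolding I_def by simp
  then show "sqrt I / (2 * pi) \<ge> 0" by simp
  fix \<phi> :: "real \<Rightarrow> complex" assume phi: "\<phi> \<in> schwartz"
  define L where "L = (LINT x|lborel. cmod (\<phi> x)) / (2 * pi)"
  have L: "L \<ge> 0" unfolding L_def by simp
  have "(LINT \<xi>|lborel. (1 + \<xi>\<^sup>2) powr (-s) * (cmod (inv_fourier \<phi> \<xi>))\<^sup>2) \<le> (LINT \<xi>|lborel. (1 + \<xi>\<^sup>2) powr (-s) * L\<^sup>2)"
    using one_plus_square_powr_integrable[OF assms] assms inv_fourier_bound[of \<phi>]
    by (intro integral_mono dual_weight_integrable phi) (auto simp: L_def intro!: mult_left_mono power_mono)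
  also have "\<dots> = L\<^sup>2 * I" unfolding I_def by simp
  finally have "sobolev_weight s \<phi> \<le> sqrt (L\<^sup>2 * I)" unfolding sobolev_weight_def by simp
  also have "\<dots> = L * sqrt I" using L by (simp add: real_sqrt_mult)
  finally show "sobolev_weight s \<phi> \<le> sqrt I / (2 * pi) * (LINT x|lborel. cmod (\<phi> x))"
    by (simp add: L_def mult.commute)
qed

section \<open>Logistic test functions\<close>

lemma vderiv_eqI: "(\<And>x. (\<phi> has_vector_derivative \<psi> x) (at x)) \<Longrightarrow> vderiv \<phi> = \<psi>"
  unfolding vderiv_def[abs_def] by (rule ext) (rule vector_derivative_at)

text \<open>Meant for antiderivatives of known Schwartz functions: only the decay of order zero is
  left to check.\<close>

lemma schwartzI_vderiv:
  assumes "\<And>x. \<phi> differentiable (at x)" "vderiv \<phi> \<in> schwartz"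
    and "\<And>j. bounded (range (\<lambda>x. x ^ j *\<^sub>R \<phi> x))"
  shows "\<phi> \<in> schwartz"
proof -
  have "(vderiv ^^ Suc k) \<phi> = (vderiv ^^ k) (vderiv \<phi>)" for k
    by (simp only: funpow_Suc_right comp_def)
  then have 1: "(vderiv ^^ Suc k) \<phi> differentiable (at x)"
    and 2: "bounded (range (\<lambda>x. x ^ j *\<^sub>R (vderiv ^^ Suc k) \<phi> x))" for k j x
    using assms(2) unfolding schwartz_def by auto
  show ?thesis unfolding schwartz_def
  proof (safe)
    show "(vderiv ^^ k) \<phi> differentiable (at x)" for k x
      using 1 assms(1) by (cases k) auto
    show "bounded (range (\<lambda>x. x ^ j *\<^sub>R (vderiv ^^ k) \<phi> x))" for j k
      using 2 assms(3) by (cases k) auto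
  qed
qed

lemma schwartz_diff:
  assumes "\<phi> \<in> schwartz" "\<psi> \<in> schwartz"
  shows "(\<lambda>x. \<phi> x - \<psi> x) \<in> schwartz"
proof -
  have d: "(vderiv ^^ k) f differentiable (at x)" if "f \<in> schwartz" for k x f
    using that unfolding schwartz_def by blast
  have b: "bounded (range (\<lambda>x. x ^ j *\<^sub>R (vderiv ^^ k) f x))" if "f \<in> schwartz" for j k f
    using that unfolding schwartz_def by blast
  have eq: "(vderiv ^^ k) (\<lambda>x. \<phi> x - \<psi> x) = (\<lambda>x. (vderiv ^^ k) \<phi> x - (vderiv ^^ k) \<psi> x)" for k
  proof (induction k)
    case (Suc k)
    have "((vderiv ^^ k) f has_vector_derivative (vderiv ^^ Suc k) f x) (at x)" if "f \<in> schwartz" for f x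
      using d[OF that] by (simp add: vderiv_def vector_derivative_works)
    note * = this[OF assms(1)] this[OF assms(2)]
    show ?case
      unfolding funpow.simps(2)[of k vderiv, THEN fun_cong, of "\<lambda>x. \<phi> x - \<psi> x"] comp_def Suc
      by (intro vderiv_eqI has_vector_derivative_diff *)
  qed simp
  show ?thesis unfolding schwartz_def
  proof (safe)
    show "(vderiv ^^ k) (\<lambda>x. \<phi> x - \<psi> x) differentiable (at x)" for k x
      unfolding eq by (intro differentiable_diff d assms)
    show "bounded (range (\<lambda>x. x ^ j *\<^sub>R (vderiv ^^ k) (\<lambda>x. \<phi> x - \<psi> x) x))" for j k
      using bounded_minus_comp[OF b[OF assms(1)] b[OF assms(2)], of j k j k]
      unfolding eq by (simp add: scaleR_right_diff_distrib)
  qed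
qed

text \<open>This function solves \<open>L' = L (1 - L)\<close>, so all its derivatives are
  polynomials in \<open>L\<close> itself. Its rescalings give smoothed indicators and approximate
  identities that are Schwartz by one explicit estimate.\<close>

definition logistic :: "real \<Rightarrow> real" where
  "logistic z = 1 / (1 + exp (- z))"

lemma logistic_has_derivative:
  "(logistic has_real_derivative logistic z * (1 - logistic z)) (at z)"
proof -
  have p: "1 + exp (-z) > 0" by (simp add: add_pos_pos)
  show ?thesis unfolding logistic_def[abs_def]
    using p by (auto intro!: derivative_eq_intros simp: field_simps power2_eq_square)
qed

lemma logistic_pos: "logistic z > 0" and logistic_less_1: "logistic z < 1"
proof -
  have "0 < 1 / (1 + e)" "1 / (1 + e) < 1" if "e > 0" for e :: real using that by auto
  from this[of "exp (-z)"] show "logistic z > 0" "logistic z < 1" by (simp_all add: logistic_def)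
qed

lemma logistic_continuous: "continuous_on S logistic"
  by (metis DERIV_isCont continuous_at_imp_continuous_on logistic_has_derivative)

lemma logistic_density_eq: "logistic z * (1 - logistic z) = exp (- z) / (1 + exp (- z))\<^sup>2"
proof -
  have *: "1 / (1 + e) * (1 - 1 / (1 + e)) = e / (1 + e)\<^sup>2" if "e > 0" for e :: real
    using that by (simp add: field_simps power2_eq_square)
  show ?thesis unfolding logistic_def by (rule *) simp
qed

lemma logistic_density_nonneg: "logistic z * (1 - logistic z) \<ge> 0"
  using logistic_pos[of z] logistic_less_1[of z] by simp

lemma logistic_density_le: "logistic z * (1 - logistic z) \<le> exp (- \<bar>z\<bar>)"
proof -
  have *: "e / (1 + e)\<^sup>2 \<le> e" "e / (1 + e)\<^sup>2 \<le> 1 / e" if "e > 0" for e :: real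
  proof -
    have "1 \<le> (1 + e)\<^sup>2" "e\<^sup>2 \<le> (1 + e)\<^sup>2" using that by (auto simp: power2_eq_square algebra_simps)
    note le = this
    have 1: "e / (1 + e)\<^sup>2 \<le> e / 1" by (rule divide_left_mono) (use le that in auto)
    have 2: "e / (1 + e)\<^sup>2 \<le> e / e\<^sup>2" by (rule divide_left_mono) (use le that in auto)
    show "e / (1 + e)\<^sup>2 \<le> e" using 1 by simp
    have "e / e\<^sup>2 = 1 / e" by (simp add: power2_eq_square)
    with 2 show "e / (1 + e)\<^sup>2 \<le> 1 / e" by (simp only:)
  qed
  show ?thesis
    using *[of "exp (-z)"] by (cases "z \<ge> 0") (simp_all add: logistic_density_eq exp_minus inverse_eq_divide)
qed

lemma logistic_tendsto:
  "(logistic \<longlongrightarrow> 1) at_top" "(logistic \<longlongrightarrow> 0) at_bot"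
  unfolding logistic_def[abs_def] by real_asymp+

lemma logistic_density_integral:
  "integrable lborel (\<lambda>z. logistic z * (1 - logistic z))" (is ?I)
  "(LINT z|lborel. logistic z * (1 - logistic z)) = 1"
proof -
  have "set_integrable lborel (einterval (-\<infinity>) \<infinity>) (\<lambda>z. logistic z * (1 - logistic z))"
  proof (rule interval_integral_FTC_nonneg)
    show "DERIV logistic x :> logistic x * (1 - logistic x)" for x by (rule logistic_has_derivative)
    show "((logistic \<circ> real_of_ereal) \<longlongrightarrow> 0) (at_right (-\<infinity>))"
      "((logistic \<circ> real_of_ereal) \<longlongrightarrow> 1) (at_left \<infinity>)"
      by (simp_all add: ereal_tendsto_simps1 logistic_tendsto)
    show "isCont (\<lambda>z. logistic z * (1 - logistic z)) x" for x
      using DERIV_isCont[OF logistic_has_derivative] by (intro continuous_intros)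
  qed (auto simp: logistic_density_nonneg)
  then show I: ?I by (simp add: set_integrable_def)
  have "(LINT z|lborel. logistic z * (1 - logistic z)) = 1 - 0"
    by (rule lborel_integral_FTC_UNIV[where F=logistic])
       (auto simp: has_real_derivative_iff_has_vector_derivative[symmetric] intro!: logistic_has_derivative logistic_tendsto I continuous_intros logistic_continuous)
  then show "(LINT z|lborel. logistic z * (1 - logistic z)) = 1" by simp
qed

text \<open>An approximate identity of unit mass, concentrating at \<open>c\<close> as
  \<open>k\<close> grows; it is the derivative in \<open>x\<close> of
  \<open>logistic (k * (x - c))\<close>.\<close>

definition logistic_kernel :: "real \<Rightarrow> real \<Rightarrow> real \<Rightarrow> real" where
  "logistic_kernel k c x = k * (logistic (k * (x - c)) * (1 - logistic (k * (x - c))))"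

lemma logistic_kernel_nonneg: "k \<ge> 0 \<Longrightarrow> logistic_kernel k c x \<ge> 0"
  unfolding logistic_kernel_def using logistic_density_nonneg by simp

lemma logistic_kernel_continuous: "continuous_on UNIV (logistic_kernel k c)"
  unfolding logistic_kernel_def[abs_def]
  by (intro continuous_intros continuous_on_compose2[OF logistic_continuous[of UNIV]]) auto

lemma logistic_kernel_measurable [measurable]: "logistic_kernel k c \<in> borel_measurable borel"
  by (rule borel_measurable_continuous_onI[OF logistic_kernel_continuous])

lemma logistic_step_derivative:
  "((\<lambda>x. logistic (k * (x - c))) has_real_derivative logistic_kernel k c x) (at x)"
  unfolding logistic_kernel_def
  by (rule DERIV_chain2[OF logistic_has_derivative, THEN DERIV_cong]) (auto intro!: derivative_eq_intros)

lemma logistic_kernel_le: "k \<ge> 0 \<Longrightarrow> logistic_kernel k c x \<le> k * exp (- k * \<bar>x - c\<bar>)"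
  unfolding logistic_kernel_def using logistic_density_le[of "k * (x - c)"]
  by (auto simp: abs_mult intro!: mult_left_mono)

text \<open>One term of the series of \<open>exp (k * \<bar>x\<bar>)\<close> bounds the power, and
  the triangle inequality moves the centre to \<open>c\<close> at the price of
  \<open>exp (k * \<bar>c\<bar>)\<close>.\<close>

lemma power_mult_exp_le:
  fixes x c k :: real
  assumes "k > 0"
  shows "\<bar>x\<bar> ^ j * exp (- k * \<bar>x - c\<bar>) \<le> fact j / k ^ j * exp (k * \<bar>c\<bar>)"
proof -
  have "(\<Sum>n\<in>{j}. (k * \<bar>x\<bar>) ^ n /\<^sub>R fact n) \<le> (\<Sum>n. (k * \<bar>x\<bar>) ^ n /\<^sub>R fact n)"
    using assms sums_summable[OF exp_converges[of "k * \<bar>x\<bar>"]] by (intro sum_le_suminf) auto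
  then have "(k * \<bar>x\<bar>) ^ j / fact j \<le> exp (k * \<bar>x\<bar>)"
    by (simp add: exp_def divide_inverse mult.commute)
  also have "\<dots> \<le> exp (k * \<bar>c\<bar> + k * \<bar>x - c\<bar>)"
    using assms by (auto simp flip: distrib_left)
  finally have "k ^ j * \<bar>x\<bar> ^ j / fact j * exp (- k * \<bar>x - c\<bar>) \<le> exp (k * \<bar>c\<bar>)"
    by (simp add: exp_add exp_minus field_simps)
  then show ?thesis using assms by (simp add: field_simps)
qed

lemma logistic_power_bound:
  assumes "k > 0"
  shows "\<bar>x\<bar> ^ j * logistic_kernel k c x \<le> k * (fact j / k ^ j * exp (k * \<bar>c\<bar>))"
proof -
  have "\<bar>x\<bar> ^ j * logistic_kernel k c x \<le> \<bar>x\<bar> ^ j * (k * exp (- k * \<bar>x - c\<bar>))"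
    using logistic_kernel_le[of k c x] assms by (intro mult_left_mono) auto
  also have "\<dots> \<le> k * (fact j / k ^ j * exp (k * \<bar>c\<bar>))"
    using mult_left_mono[OF power_mult_exp_le[OF assms, of x j c], of k] assms by (simp add: mult_ac)
  finally show ?thesis .
qed

text \<open>The family is closed under differentiation, and \<open>D\<close> computes the new
  polynomial from \<open>L' = k L (1 - L)\<close>. All derivatives thus share the decay of the
  kernel, since a polynomial is bounded on \<open>{0..1}\<close>, where \<open>logistic\<close>
  takes its values.\<close>

lemma logistic_poly_schwartz:
  assumes "k > 0"
  shows "(\<lambda>x. complex_of_real (logistic_kernel k c x * poly p (logistic (k * (x - c))))) \<in> schwartz"
proof -
  define f where "f p x = complex_of_real (logistic_kernel k c x * poly p (logistic (k * (x - c))))" for p x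
  define D where "D p = smult k ([:1, -2:] * p + [:0, 1:] * [:1, -1:] * pderiv p)" for p :: "real poly"
  have deriv: "(f p has_vector_derivative f (D p) x) (at x)" for p x
  proof -
    have "((\<lambda>x. logistic_kernel k c x * poly p (logistic (k * (x - c)))) has_real_derivative
       logistic_kernel k c x * poly (D p) (logistic (k * (x - c)))) (at x)"
      unfolding logistic_kernel_def
      by (rule derivative_eq_intros refl poly_DERIV logistic_step_derivative DERIV_chain2[of "poly p"])+
         (simp add: D_def logistic_kernel_def algebra_simps)
    then show ?thesis
      unfolding f_def[abs_def] by (rule has_vector_derivative_of_real)
  qed
  have iter: "(vderiv ^^ n) (f p) = f ((D ^^ n) p)" for n
    by (induction n) (simp_all add: vderiv_eqI[OF deriv])
  have bdd: "bounded (range (\<lambda>x. x ^ j *\<^sub>R f p x))" for j p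
  proof -
    have "bounded (poly p ` {0..1})"
      by (intro compact_imp_bounded compact_continuous_image continuous_intros) auto
    then obtain B where "\<forall>z\<in>poly p ` {0..1}. norm z \<le> B" unfolding bounded_iff by blast
    then have B: "\<bar>poly p y\<bar> \<le> B" if "y \<in> {0..1}" for y using that by auto
    have "norm (x ^ j *\<^sub>R f p x) \<le> k * (fact j / k ^ j * exp (k * \<bar>c\<bar>)) * B" for x
    proof -
      have "norm (x ^ j *\<^sub>R f p x) = (\<bar>x\<bar> ^ j * logistic_kernel k c x) * \<bar>poly p (logistic (k * (x - c)))\<bar>"
        using logistic_kernel_nonneg[of k c x] assms unfolding f_def norm_scaleR norm_of_real by (simp add: abs_mult power_abs)
      also have "\<dots> \<le> k * (fact j / k ^ j * exp (k * \<bar>c\<bar>)) * B"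
        using assms logistic_pos[of "k * (x - c)"] logistic_less_1[of "k * (x - c)"]
        by (intro mult_mono logistic_power_bound B) auto
      finally show ?thesis .
    qed
    then show ?thesis by (auto simp: bounded_iff)
  qed
  have "f p \<in> schwartz" unfolding schwartz_def
  proof safe
    show "(vderiv ^^ n) (f p) differentiable (at x)" for n x
      unfolding iter using deriv by (blast intro: differentiableI_vector)
    show "bounded (range (\<lambda>x. x ^ j *\<^sub>R (vderiv ^^ n) (f p) x))" for j n
      unfolding iter by (rule bdd)
  qed
  then show ?thesis by (simp add: f_def[abs_def])
qed

lemma logistic_kernel_schwartz:
  "k > 0 \<Longrightarrow> (\<lambda>x. complex_of_real (logistic_kernel k c x)) \<in> schwartz"
  using logistic_poly_schwartz[of k c 1] by simp

text \<open>A single \<open>logistic\<close> tends to 1 at infinity; only the difference decays. The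
  mean value theorem in the centre writes it as \<open>b - a\<close> times a kernel centred at some
  \<open>y\<close> between \<open>a\<close> and \<open>b\<close>, and the kernel decay is uniform
  over such \<open>y\<close>.\<close>

lemma logistic_step_schwartz:
  assumes "k > 0" "a < b"
  defines "step \<equiv> \<lambda>x. complex_of_real (logistic (k * (x - a)) - logistic (k * (x - b)))"
  shows "step \<in> schwartz" and "vderiv step = (\<lambda>x. complex_of_real (logistic_kernel k a x - logistic_kernel k b x))"
proof -
  have d: "(step has_vector_derivative complex_of_real (logistic_kernel k a x - logistic_kernel k b x)) (at x)" for x
    unfolding step_def
    by (intro has_vector_derivative_of_real derivative_intros logistic_step_derivative)
  then show vd: "vderiv step = (\<lambda>x. complex_of_real (logistic_kernel k a x - logistic_kernel k b x))"
    by (auto simp: vderiv_def fun_eq_iff intro!: vector_derivative_at)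
  show "step \<in> schwartz"
  proof (rule schwartzI_vderiv)
    show "step differentiable (at x)" for x using d by (blast intro: differentiableI_vector)
    show "vderiv step \<in> schwartz"
      unfolding vd using schwartz_diff[OF logistic_kernel_schwartz logistic_kernel_schwartz, OF assms(1,1), of a b] by simp
    fix j
    define m where "m = max \<bar>a\<bar> \<bar>b\<bar>"
    have "norm (x ^ j *\<^sub>R step x) \<le> (b - a) * (k * (fact j / k ^ j * exp (k * m)))" for x
    proof -
      obtain y where y: "a < y" "y < b" "logistic (k * (x - b)) - logistic (k * (x - a)) = (b - a) * (- logistic_kernel k y x)"
      proof -
        have "\<exists>y>a. y < b \<and> logistic (k * (x - b)) - logistic (k * (x - a)) = (b - a) * (- logistic_kernel k y x)"
        proof (rule MVT2[OF assms(2)])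
          fix y
          show "((\<lambda>y. logistic (k * (x - y))) has_real_derivative - logistic_kernel k y x) (at y)"
            unfolding logistic_kernel_def
            by (rule DERIV_chain2[OF logistic_has_derivative, THEN DERIV_cong]) (auto intro!: derivative_eq_intros)
        qed
        then show ?thesis using that by blast
      qed
      have "norm (x ^ j *\<^sub>R step x) = (b - a) * (\<bar>x\<bar> ^ j * logistic_kernel k y x)"
      proof -
        have e: "logistic (k * (x - a)) - logistic (k * (x - b)) = (b - a) * logistic_kernel k y x"
          using y(3) by simp
        show ?thesis unfolding step_def e norm_scaleR norm_of_real
          using logistic_kernel_nonneg[of k y x] assms(1,2) by (simp add: abs_mult power_abs)
      qed
      also have "\<dots> \<le> (b - a) * (k * (fact j / k ^ j * exp (k * \<bar>y\<bar>)))"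
        using assms by (intro mult_left_mono logistic_power_bound) auto
      also have "\<dots> \<le> (b - a) * (k * (fact j / k ^ j * exp (k * m)))"
        using assms y by (intro mult_left_mono) (auto simp: m_def)
      finally show ?thesis .
    qed
    then show "bounded (range (\<lambda>x. x ^ j *\<^sub>R step x))" by (auto simp: bounded_iff)
  qed
qed

lemma logistic_kernel_integral:
  assumes "k > 0" and [measurable]: "g \<in> borel_measurable borel"
  shows "(LINT x|lborel. g x * logistic_kernel k c x) = (LINT z|lborel. g (c + z / k) * (logistic z * (1 - logistic z)))"
proof -
  have "(LINT x|lborel. g x * logistic_kernel k c x) = \<bar>1/k\<bar> *\<^sub>R (LINT z|lborel. g (c + 1/k * z) * logistic_kernel k c (c + 1/k * z))"
    by (rule lborel_integral_real_affine) (use assms in auto)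
  also have "\<dots> = (LINT z|lborel. \<bar>1/k\<bar> * (g (c + 1/k * z) * logistic_kernel k c (c + 1/k * z)))"
    by simp
  also have "\<dots> = (LINT z|lborel. g (c + z / k) * (logistic z * (1 - logistic z)))"
    using assms by (intro Bochner_Integration.integral_cong) (auto simp: logistic_kernel_def)
  finally show ?thesis .
qed

text \<open>The substitution \<open>x = c + z / k\<close> moves the parameter from the kernel into
  the argument of \<open>g\<close>; the bound on \<open>g\<close> then gives a dominating
  function.\<close>

lemma logistic_kernel_tendsto:
  assumes [measurable]: "g \<in> borel_measurable borel" and b: "\<And>x. \<bar>g x\<bar> \<le> B" and c: "isCont g c"
  shows "(\<lambda>n. LINT x|lborel. g x * logistic_kernel (real (Suc n)) c x) \<longlonglongrightarrow> g c"
proof -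
  have [measurable]: "logistic \<in> borel_measurable borel"
    by (rule borel_measurable_continuous_onI[OF logistic_continuous])
  have "(\<lambda>n. LINT z|lborel. g (c + z / real (Suc n)) * (logistic z * (1 - logistic z))) \<longlonglongrightarrow> (LINT z|lborel. g c * (logistic z * (1 - logistic z)))"
  proof (rule integral_dominated_convergence)
    show "integrable lborel (\<lambda>z. B * (logistic z * (1 - logistic z)))"
      by (intro integrable_mult_right logistic_density_integral)
    show "AE z in lborel. (\<lambda>n. g (c + z / real (Suc n)) * (logistic z * (1 - logistic z))) \<longlonglongrightarrow> g c * (logistic z * (1 - logistic z))"
    proof (rule AE_I2)
      fix z :: real
      have "(\<lambda>n. c + z / real (Suc n)) \<longlonglongrightarrow> c" by real_asymp
      then have "(\<lambda>n. g (c + z / real (Suc n))) \<longlonglongrightarrow> g c"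
        by (rule isCont_tendsto_compose[OF c])
      then show "(\<lambda>n. g (c + z / real (Suc n)) * (logistic z * (1 - logistic z))) \<longlonglongrightarrow> g c * (logistic z * (1 - logistic z))"
        by (intro tendsto_intros)
    qed
    show "AE z in lborel. norm (g (c + z / real (Suc n)) * (logistic z * (1 - logistic z))) \<le> B * (logistic z * (1 - logistic z))" for n
    proof (rule AE_I2)
      fix z
      show "norm (g (c + z / real (Suc n)) * (logistic z * (1 - logistic z))) \<le> B * (logistic z * (1 - logistic z))"
        unfolding norm_mult[of "g _"] using mult_right_mono[OF b logistic_density_nonneg] logistic_density_nonneg[of z]
        by simp
    qed
  qed auto
  then show ?thesis
    using logistic_kernel_integral[OF _ assms(1), of "real (Suc _)" c] by (simp add: logistic_density_integral)
qed

section \<open>Sobolev embedding and time derivatives\<close>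

text \<open>Together with the upper bound this makes the density comparable to
  \<open>exp (- \<bar>z\<bar>)\<close>, so that integrals with the exponential weight can be
  controlled by integrals with the kernel.\<close>

lemma logistic_density_ge: "exp (- \<bar>z\<bar>) / 4 \<le> logistic z * (1 - logistic z)"
proof -
  have *: "e / 4 \<le> e / (1 + e)\<^sup>2" if "0 < e" "e \<le> 1" for e :: real
  proof (rule divide_left_mono)
    show "(1 + e)\<^sup>2 \<le> 4" using power_mono[of "1 + e" 2 2] that by simp
  qed (use that in auto)
  show ?thesis
  proof (cases "z \<ge> 0")
    case True
    then show ?thesis using *[of "exp (-z)"] by (simp add: logistic_density_eq)
  next
    case False
    have "(1 / e) / (1 + 1 / e)\<^sup>2 = e / (1 + e)\<^sup>2" if "e > 0" for e :: real
      using that by (simp add: field_simps power2_eq_square)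
    from this[of "exp z"] have "exp (-z) / (1 + exp (-z))\<^sup>2 = exp z / (1 + exp z)\<^sup>2"
      by (simp add: exp_minus inverse_eq_divide)
    then show ?thesis using *[of "exp z"] False by (simp add: logistic_density_eq)
  qed
qed

lemma exp_abs_integrable: "integrable lborel (\<lambda>y::real. exp (- \<bar>x - y\<bar>))"
proof -
  have "integrable lborel (\<lambda>z. 4 * (logistic (-x + 1 * z) * (1 - logistic (-x + 1 * z))))"
    by (intro integrable_mult_right lborel_integrable_real_affine[OF logistic_density_integral(1)]) auto
  then show ?thesis
  proof (rule Bochner_Integration.integrable_bound, safe intro!: AE_I2)
    fix y
    show "norm (exp (- \<bar>x - y\<bar>)) \<le> norm (4 * (logistic (-x + 1 * y) * (1 - logistic (-x + 1 * y))))"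
      using logistic_density_ge[of "-x + y"] logistic_density_nonneg[of "-x + y"]
      by (simp add: abs_minus_commute)
  qed measurable
qed

lemma square_integrable_mult_schwartz:
  assumes [measurable]: "f \<in> borel_measurable borel" and f2: "integrable lborel (\<lambda>x. (f x)\<^sup>2)" and phi: "\<phi> \<in> schwartz"
  shows "integrable lborel (\<lambda>x. complex_of_real (f x) * \<phi> x)"
proof -
  note [measurable] = schwartz_measurable[OF phi]
  have "integrable lborel (\<lambda>x. \<bar>f x\<bar> * cmod (\<phi> x))"
    by (rule integrable_mult_square_integrable) (use f2 schwartz_square_integrable[OF phi] in auto)
  then show ?thesis
    by (subst integrable_norm_iff[symmetric]) (auto simp: norm_mult)
qed

lemma distr_of_real:
  "distr_of f (\<lambda>x. complex_of_real (g x)) = complex_of_real (LINT x|lborel. f x * g x)"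
  unfolding distr_of_def by (simp flip: of_real_mult)

text \<open>Here \<open>f\<close> need not be bounded: the part of \<open>f\<close> away from \<open>c\<close> is only known to be square
  integrable, and it is killed by the exponential decay of the kernels.\<close>

lemma logistic_kernel_tendsto_square_integrable:
  assumes f: "continuous_on UNIV f" and f2: "integrable lborel (\<lambda>x. (f x)\<^sup>2)"
  shows "(\<lambda>n. LINT x|lborel. f x * logistic_kernel (real (Suc n)) c x) \<longlonglongrightarrow> f c"
proof -
  have [measurable]: "f \<in> borel_measurable borel" by (rule borel_measurable_continuous_onI[OF f])
  define K where "K n = logistic_kernel (real (Suc n)) c" for n
  have [measurable]: "K n \<in> borel_measurable borel" for n unfolding K_def by measurable
  have Kn: "K n x \<ge> 0" for n x unfolding K_def by (rule logistic_kernel_nonneg) simp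
  have fK: "integrable lborel (\<lambda>x. f x * K n x)" for n
  proof -
    have "integrable lborel (\<lambda>x. complex_of_real (f x) * complex_of_real (K n x))"
      unfolding K_def by (intro square_integrable_mult_schwartz f2 logistic_kernel_schwartz) auto
    then show ?thesis by (simp add: complex_of_real_integrable_eq flip: of_real_mult)
  qed
  define near where "near x = indicator (ball c 1) x * f x" for x
  define far where "far x = indicator (- ball c 1) x * f x" for x
  have [measurable]: "near \<in> borel_measurable borel" "far \<in> borel_measurable borel"
    unfolding near_def[abs_def] far_def[abs_def]
    by (auto intro!: borel_measurable_times borel_measurable_indicator)
  have split: "f x = near x + far x" for x by (auto simp: near_def far_def indicator_def)
  have iN: "integrable lborel (\<lambda>x. near x * K n x)" for n
    by (rule Bochner_Integration.integrable_bound[OF fK[of n]]) (auto simp: near_def indicator_def)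
  have iF: "integrable lborel (\<lambda>x. far x * K n x)" for n
    by (rule Bochner_Integration.integrable_bound[OF fK[of n]]) (auto simp: far_def indicator_def)
  have "bounded (f ` cball c 1)"
    by (intro compact_imp_bounded compact_continuous_image continuous_on_subset[OF f]) auto
  then obtain B where B: "\<forall>y\<in>f ` cball c 1. norm y \<le> B" unfolding bounded_iff by blast
  have "0 \<le> norm (f c)" by simp
  also have "\<dots> \<le> B" using B by (auto simp del: norm_ge_zero)
  finally have "0 \<le> B" .
  have "(\<lambda>n. LINT x|lborel. near x * K n x) \<longlonglongrightarrow> near c"
    unfolding K_def
  proof (rule logistic_kernel_tendsto)
    show "\<bar>near x\<bar> \<le> B" for x using B \<open>0 \<le> B\<close> by (auto simp: near_def indicator_def)
    have "isCont f c" using f by (simp add: continuous_on_eq_continuous_at)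
    moreover have "\<forall>\<^sub>F x in nhds c. x \<in> ball c 1" by (intro eventually_nhds_in_open) auto
    then have "\<forall>\<^sub>F x in nhds c. near x = f x" by eventually_elim (simp add: near_def)
    ultimately show "isCont near c" by (simp add: isCont_cong)
  qed measurable
  moreover have "near c = f c" by (simp add: near_def)
  moreover have "(\<lambda>n. LINT x|lborel. far x * K n x) \<longlonglongrightarrow> 0"
  proof (rule Lim_null_comparison)
    \<comment> \<open>\<open>K 0\<close> is the kernel with parameter 1. At distance at least 1 from
      \<open>c\<close>, each \<open>K n\<close> is at most
      \<open>real (Suc n) * exp (- real n) * 4\<close> times \<open>K 0\<close>, and this factor
      tends to 0.\<close>
    define A where "A = (LINT x|lborel. \<bar>f x * K 0 x\<bar>)"
    show "\<forall>\<^sub>F n in sequentially. norm (LINT x|lborel. far x * K n x) \<le> real (Suc n) * exp (- real n) * 4 * A"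
    proof (rule always_eventually, rule allI)
      fix n
      have "norm (LINT x|lborel. far x * K n x) \<le> (LINT x|lborel. norm (far x * K n x))"
        by (rule integral_norm_bound)
      also have "\<dots> \<le> (LINT x|lborel. real (Suc n) * exp (- real n) * 4 * \<bar>f x * K 0 x\<bar>)"
      proof (rule integral_mono)
        fix x
        show "norm (far x * K n x) \<le> real (Suc n) * exp (- real n) * 4 * \<bar>f x * K 0 x\<bar>"
        proof (cases "\<bar>x - c\<bar> \<ge> 1")
          case True
          have "K n x \<le> real (Suc n) * exp (- real (Suc n) * \<bar>x - c\<bar>)"
            unfolding K_def by (rule logistic_kernel_le) simp
          also have "\<dots> = real (Suc n) * exp (- real n * \<bar>x - c\<bar>) * exp (- \<bar>x - c\<bar>)"
            by (simp add: algebra_simps flip: exp_add)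
          also have "\<dots> \<le> real (Suc n) * exp (- real n) * exp (- \<bar>x - c\<bar>)"
            using True by (intro mult_mono) (auto simp: mult_le_cancel_left1)
          also have "\<dots> \<le> real (Suc n) * exp (- real n) * (4 * K 0 x)"
            using logistic_density_ge[of "x - c"] by (intro mult_left_mono) (auto simp: K_def logistic_kernel_def)
          finally have "\<bar>f x\<bar> * K n x \<le> \<bar>f x\<bar> * (real (Suc n) * exp (- real n) * (4 * K 0 x))"
            by (intro mult_left_mono) auto
          then show ?thesis using Kn[of n x] Kn[of 0 x] by (simp add: far_def indicator_def abs_mult mult_ac)
        next
          case False
          then show ?thesis by (simp add: far_def dist_real_def abs_minus_commute)
        qed
      qed (use iF fK in auto)
      also have "\<dots> = real (Suc n) * exp (- real n) * 4 * A" by (simp add: A_def)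
      finally show "norm (LINT x|lborel. far x * K n x) \<le> real (Suc n) * exp (- real n) * 4 * A" .
    qed
    show "(\<lambda>n. real (Suc n) * exp (- real n) * 4 * A) \<longlonglongrightarrow> 0"
    proof -
      have "(\<lambda>n. real (Suc n) * exp (- real n)) \<longlonglongrightarrow> 0" by real_asymp
      then show ?thesis by (intro tendsto_mult_left_zero) 
    qed
  qed
  ultimately have "(\<lambda>n. (LINT x|lborel. near x * K n x) + (LINT x|lborel. far x * K n x)) \<longlonglongrightarrow> f c + 0"
    by (metis tendsto_add)
  moreover have "(LINT x|lborel. near x * K n x) + (LINT x|lborel. far x * K n x) = (LINT x|lborel. f x * K n x)" for n
    by (simp add: split distrib_right iN iF)
  ultimately show ?thesis by (simp add: K_def)
qed

text \<open>Pairings with kernels of unit mass are bounded uniformly in \<open>n\<close> and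
  converge to the point value. \<open>\<Lambda>\<close> is kept apart from \<open>distr_of f\<close>
  because the norms in question are those of differences of functionals, which agree with
  \<open>distr_of\<close> of the difference of the functions on \<open>schwartz\<close> but not
  necessarily elsewhere.\<close>

lemma sobolev_embedding:
  assumes "s > 1/2"
  obtains C where "C \<ge> 0"
    "\<And>f \<Lambda> x. \<lbrakk>continuous_on UNIV f; integrable lborel (\<lambda>x. (f x)\<^sup>2); \<Lambda> \<in> sobolev s;
        \<And>\<phi>. \<phi> \<in> schwartz \<Longrightarrow> \<Lambda> \<phi> = distr_of f \<phi>\<rbrakk> \<Longrightarrow> \<bar>f x\<bar> \<le> C * sobolev_norm s \<Lambda>"
proof -
  obtain C where C: "C \<ge> 0" "\<And>\<phi>. \<phi> \<in> schwartz \<Longrightarrow> sobolev_weight s \<phi> \<le> C * (LINT x|lborel. cmod (\<phi> x))"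
    using sobolev_weight_le[OF assms] by blast
  show ?thesis
  proof (rule that[OF C(1)])
    fix f :: "real \<Rightarrow> real" and \<Lambda> x
    assume f: "continuous_on UNIV f" "integrable lborel (\<lambda>x. (f x)\<^sup>2)" "\<Lambda> \<in> sobolev s"
      and eq: "\<And>\<phi>. \<phi> \<in> schwartz \<Longrightarrow> \<Lambda> \<phi> = distr_of f \<phi>"
    have "\<bar>LINT y|lborel. f y * logistic_kernel (real (Suc n)) x y\<bar> \<le> C * sobolev_norm s \<Lambda>" for n
    proof -
      define \<phi> where "\<phi> y = complex_of_real (logistic_kernel (real (Suc n)) x y)" for y
      have phi: "\<phi> \<in> schwartz" unfolding \<phi>_def[abs_def] by (rule logistic_kernel_schwartz) simp
      have "(LINT y|lborel. cmod (\<phi> y)) = (LINT y|lborel. 1 * logistic_kernel (real (Suc n)) x y)"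
        by (simp add: \<phi>_def logistic_kernel_nonneg)
      also have "\<dots> = 1"
        by (subst logistic_kernel_integral) (auto simp: logistic_density_integral)
      finally have "sobolev_weight s \<phi> \<le> C" using C(2)[OF phi] by simp
      have "distr_of f \<phi> = complex_of_real (LINT y|lborel. f y * logistic_kernel (real (Suc n)) x y)"
        unfolding \<phi>_def[abs_def] by (rule distr_of_real)
      then have "\<bar>LINT y|lborel. f y * logistic_kernel (real (Suc n)) x y\<bar> = cmod (\<Lambda> \<phi>)"
        unfolding eq[OF phi] by (simp only: norm_of_real)
      also have "\<dots> \<le> sobolev_norm s \<Lambda> * sobolev_weight s \<phi>"
        using assms by (intro sobolev_pairing_le_norm f phi) auto
      also have "\<dots> \<le> sobolev_norm s \<Lambda> * C"
        by (intro mult_left_mono sobolev_norm_nonneg) fact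
      finally show ?thesis by (simp add: mult.commute)
    qed
    then show "\<bar>f x\<bar> \<le> C * sobolev_norm s \<Lambda>"
      by (intro tendsto_le[OF _ tendsto_const tendsto_rabs[OF logistic_kernel_tendsto_square_integrable[OF f(1,2), of x]]])
         auto
  qed
qed

lemma Hs_bounded:
  assumes "s > 1/2" "f \<in> Hs s"
  shows "\<exists>B. \<forall>x. \<bar>f x\<bar> \<le> B"
proof -
  obtain C where C: "C \<ge> 0" "\<And>f \<Lambda> x. \<lbrakk>continuous_on UNIV f; integrable lborel (\<lambda>x. (f x)\<^sup>2); \<Lambda> \<in> sobolev s;
        \<And>\<phi>. \<phi> \<in> schwartz \<Longrightarrow> \<Lambda> \<phi> = distr_of f \<phi>\<rbrakk> \<Longrightarrow> \<bar>f x\<bar> \<le> C * sobolev_norm s \<Lambda>"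
    using sobolev_embedding[OF assms(1)] by blast
  have "\<bar>f x\<bar> \<le> C * sobolev_norm s (distr_of f)" for x
    using assms(2) by (intro C(2)[of f "distr_of f"]) (auto simp: Hs_def)
  then show ?thesis by blast
qed

lemma Hs_continuous_imp_uniform_limit:
  assumes s: "s > 1/2" and m: "\<And>t. t \<in> J \<Longrightarrow> m t \<in> Hs s"
    and c: "sobolev_continuous s J (\<lambda>t. distr_of (m t))" and t: "t \<in> J"
  shows "uniform_limit UNIV m (m t) (at t within J)"
proof (rule uniform_limitI)
  fix e :: real assume "e > 0"
  obtain C where C: "C \<ge> 0" "\<And>f \<Lambda> x. \<lbrakk>continuous_on UNIV f; integrable lborel (\<lambda>x. (f x)\<^sup>2); \<Lambda> \<in> sobolev s;
        \<And>\<phi>. \<phi> \<in> schwartz \<Longrightarrow> \<Lambda> \<phi> = distr_of f \<phi>\<rbrakk> \<Longrightarrow> \<bar>f x\<bar> \<le> C * sobolev_norm s \<Lambda>"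
    using sobolev_embedding[OF s] by blast
  have mt: "continuous_on UNIV (m \<tau>)" "integrable lborel (\<lambda>x. (m \<tau> x)\<^sup>2)" "distr_of (m \<tau>) \<in> sobolev s" if "\<tau> \<in> J" for \<tau>
    using m[OF that] by (auto simp: Hs_def)
  note meas = borel_measurable_continuous_onI[OF mt(1)]
  have le: "\<bar>m \<tau> x - m t x\<bar> \<le> C * sobolev_norm s (\<lambda>\<phi>. distr_of (m \<tau>) \<phi> - distr_of (m t) \<phi>)" if tau: "\<tau> \<in> J" for \<tau> x
  proof (rule C(2)[of "\<lambda>x. m \<tau> x - m t x"])
    show "continuous_on UNIV (\<lambda>x. m \<tau> x - m t x)" by (intro continuous_intros mt t tau)
    show "integrable lborel (\<lambda>x. (m \<tau> x - m t x)\<^sup>2)"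
    proof (rule Bochner_Integration.integrable_bound)
      show "integrable lborel (\<lambda>x. 2 * (m \<tau> x)\<^sup>2 + 2 * (m t x)\<^sup>2)" using mt tau t by simp
      show "AE x in lborel. norm ((m \<tau> x - m t x)\<^sup>2) \<le> norm (2 * (m \<tau> x)\<^sup>2 + 2 * (m t x)\<^sup>2)"
      proof (rule AE_I2)
        fix x
        have "0 \<le> (m \<tau> x + m t x)\<^sup>2" by simp
        then show "norm ((m \<tau> x - m t x)\<^sup>2) \<le> norm (2 * (m \<tau> x)\<^sup>2 + 2 * (m t x)\<^sup>2)"
          using zero_le_power2[of "m \<tau> x - m t x"] unfolding real_norm_def abs_power2 power2_sum power2_diff
          by (auto simp: abs_if)
      qed
    qed (use meas[OF tau] meas[OF t] in measurable)
    show "(\<lambda>\<phi>. distr_of (m \<tau>) \<phi> - distr_of (m t) \<phi>) \<in> sobolev s"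
      using sobolev_linear_combination[OF mt(3)[OF tau] mt(3)[OF t], of 1 "-1"] s by simp
    show "distr_of (m \<tau>) \<phi> - distr_of (m t) \<phi> = distr_of (\<lambda>x. m \<tau> x - m t x) \<phi>" if "\<phi> \<in> schwartz" for \<phi>
      unfolding distr_of_def
      using square_integrable_mult_schwartz[OF meas mt(2) that, OF tau tau]
        square_integrable_mult_schwartz[OF meas mt(2) that, OF t t]
      by (simp add: left_diff_distrib)
  qed
  have "((\<lambda>\<tau>. C * sobolev_norm s (\<lambda>\<phi>. distr_of (m \<tau>) \<phi> - distr_of (m t) \<phi>)) \<longlongrightarrow> C * 0) (at t within J)"
    using c t unfolding sobolev_continuous_def by (intro tendsto_mult tendsto_const) auto
  then have "\<forall>\<^sub>F \<tau> in at t within J. C * sobolev_norm s (\<lambda>\<phi>. distr_of (m \<tau>) \<phi> - distr_of (m t) \<phi>) < e"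
    by (rule order_tendstoD) (use \<open>e > 0\<close> in simp)
  moreover have "\<forall>\<^sub>F \<tau> in at t within J. \<tau> \<in> J" by (simp add: eventually_at_filter)
  ultimately show "\<forall>\<^sub>F \<tau> in at t within J. \<forall>x\<in>UNIV. dist (m \<tau> x) (m t x) < e"
    by eventually_elim (use le in \<open>auto simp: dist_real_def intro: le_less_trans\<close>)
qed

text \<open>For a fixed test function the pairing is bounded by a constant times the Sobolev norm,
  so convergence of difference quotients in norm becomes an ordinary derivative of each
  pairing.\<close>

lemma sobolev_C1_has_vector_derivative:
  assumes C1: "sobolev_C1 \<sigma> J \<Lambda> \<Lambda>'" and s: "\<sigma> \<ge> -1" and phi: "\<phi> \<in> schwartz" and t: "t \<in> J"
  shows "((\<lambda>\<tau>. \<Lambda> \<tau> \<phi>) has_vector_derivative \<Lambda>' t \<phi>) (at t within J)"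
  unfolding has_vector_derivative_def has_derivative_iff_norm
proof (intro conjI)
  show "bounded_linear (\<lambda>x. x *\<^sub>R \<Lambda>' t \<phi>)" by (rule bounded_linear_scaleR_left)
  define N where "N \<tau> = sobolev_norm \<sigma> (\<lambda>\<phi>. (\<Lambda> \<tau> \<phi> - \<Lambda> t \<phi>) / complex_of_real (\<tau> - t) - \<Lambda>' t \<phi>)" for \<tau>
  have mem: "\<Lambda> \<tau> \<in> sobolev \<sigma>" "\<Lambda>' \<tau> \<in> sobolev \<sigma>" if "\<tau> \<in> J" for \<tau>
    using C1 that unfolding sobolev_C1_def sobolev_continuous_def by auto
  show "((\<lambda>\<tau>. norm (\<Lambda> \<tau> \<phi> - \<Lambda> t \<phi> - (\<tau> - t) *\<^sub>R \<Lambda>' t \<phi>) / norm (\<tau> - t)) \<longlongrightarrow> 0) (at t within J)"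
  proof (rule Lim_null_comparison)
    have "\<forall>\<^sub>F \<tau> in at t within J. \<tau> \<in> J \<and> \<tau> \<noteq> t" by (simp add: eventually_at_filter)
    then show "\<forall>\<^sub>F \<tau> in at t within J. norm (norm (\<Lambda> \<tau> \<phi> - \<Lambda> t \<phi> - (\<tau> - t) *\<^sub>R \<Lambda>' t \<phi>) / norm (\<tau> - t)) \<le> N \<tau> * sobolev_weight \<sigma> \<phi>"
    proof eventually_elim
      case (elim \<tau>)
      have 1: "(\<lambda>\<phi>. 1 * \<Lambda> \<tau> \<phi> + (-1) * \<Lambda> t \<phi>) \<in> sobolev \<sigma>"
        by (intro sobolev_linear_combination mem s t) (use elim in auto)
      have "(\<lambda>\<phi>. 1 / complex_of_real (\<tau> - t) * (1 * \<Lambda> \<tau> \<phi> + (-1) * \<Lambda> t \<phi>) + (-1) * \<Lambda>' t \<phi>) \<in> sobolev \<sigma>"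
        by (rule sobolev_linear_combination[OF 1 mem(2)[OF t] s])
      then have "(\<lambda>\<phi>. (\<Lambda> \<tau> \<phi> - \<Lambda> t \<phi>) / complex_of_real (\<tau> - t) - \<Lambda>' t \<phi>) \<in> sobolev \<sigma>"
        by simp
      from sobolev_pairing_le_norm[OF this phi s]
      have "cmod ((\<Lambda> \<tau> \<phi> - \<Lambda> t \<phi>) / complex_of_real (\<tau> - t) - \<Lambda>' t \<phi>) \<le> N \<tau> * sobolev_weight \<sigma> \<phi>"
        by (simp add: N_def)
      moreover have "cmod ((\<Lambda> \<tau> \<phi> - \<Lambda> t \<phi>) / complex_of_real (\<tau> - t) - \<Lambda>' t \<phi>)
        = norm (\<Lambda> \<tau> \<phi> - \<Lambda> t \<phi> - (\<tau> - t) *\<^sub>R \<Lambda>' t \<phi>) / norm (\<tau> - t)"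
      proof -
        have "(\<Lambda> \<tau> \<phi> - \<Lambda> t \<phi>) / complex_of_real (\<tau> - t) - \<Lambda>' t \<phi> = (\<Lambda> \<tau> \<phi> - \<Lambda> t \<phi> - (\<tau> - t) *\<^sub>R \<Lambda>' t \<phi>) / complex_of_real (\<tau> - t)"
          using elim by (simp add: field_simps scaleR_conv_of_real)
        then show ?thesis by (simp only: norm_divide norm_of_real real_norm_def)
      qed
      ultimately show ?case by simp
    qed
    have "((\<lambda>\<tau>. N \<tau> * sobolev_weight \<sigma> \<phi>) \<longlongrightarrow> 0 * sobolev_weight \<sigma> \<phi>) (at t within J)"
      using C1 t unfolding sobolev_C1_def N_def by (intro tendsto_mult tendsto_const) auto
    then show "((\<lambda>\<tau>. N \<tau> * sobolev_weight \<sigma> \<phi>) \<longlongrightarrow> 0) (at t within J)" by simp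
  qed
qed

section \<open>Factorisation of the speed\<close>

text \<open>\<open>exp_right m\<close> and \<open>exp_left n\<close> are \<open>A\<close> and
  \<open>B\<close>: the two halves of the convolution with \<open>exp (- \<bar>x - y\<bar>)\<close>,
  whose half sum is \<open>helmholtz_inv\<close> and whose half difference is its
  derivative.\<close>

definition exp_right :: "(real \<Rightarrow> real) \<Rightarrow> real \<Rightarrow> real" where
  "exp_right f x = (LINT y|lborel. indicator {x..} y * (exp (x - y) * f y))"

definition exp_left :: "(real \<Rightarrow> real) \<Rightarrow> real \<Rightarrow> real" where
  "exp_left f x = (LINT y|lborel. indicator {..x} y * (exp (y - x) * f y))"

text \<open>The derivative and the bound of \<open>exp_left\<close> are transferred from
  \<open>exp_right\<close> by this reflection.\<close>

lemma exp_left_reflect: "exp_left f x = exp_right (\<lambda>y. f (- y)) (- x)"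
proof -
  have "exp_left f x = \<bar>-1\<bar> *\<^sub>R (LINT y|lborel. indicator {..x} (0 + (-1) * y) * (exp ((0 + (-1) * y) - x) * f (0 + (-1) * y)))"
    unfolding exp_left_def by (rule lborel_integral_real_affine) simp
  also have "\<dots> = exp_right (\<lambda>y. f (- y)) (- x)"
    unfolding exp_right_def by (auto intro!: Bochner_Integration.integral_cong simp: indicator_def)
  finally show ?thesis .
qed

lemma integral_exp_half_line: "(LINT y|lborel. indicator {x..} y * exp (x - y)) = 1" for x :: real
proof -
  have "(LBINT y=ereal x..\<infinity>. exp (x - y)) = 0 - (- 1)"
  proof (rule interval_integral_FTC_nonneg)
    show "DERIV (\<lambda>y. - exp (x - y)) y :> exp (x - y)" for y
      by (auto intro!: derivative_eq_intros)
    have "((\<lambda>y. - exp (x - y)) \<longlongrightarrow> - exp (x - x)) (at_right x)" by (intro tendsto_intros)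
    then show "(((\<lambda>y. - exp (x - y)) \<circ> real_of_ereal) \<longlongrightarrow> - 1) (at_right (ereal x))"
      by (simp add: ereal_tendsto_simps1)
    have "((\<lambda>y. - exp (x - y)) \<longlongrightarrow> 0) at_top" by real_asymp
    then show "(((\<lambda>y. - exp (x - y)) \<circ> real_of_ereal) \<longlongrightarrow> 0) (at_left \<infinity>)"
      by (simp add: ereal_tendsto_simps1)
  qed auto
  then have "(LINT y|lborel. indicator {x<..} y * exp (x - y)) = 1"
    by (simp add: interval_lebesgue_integral_def set_lebesgue_integral_def einterval_def greaterThan_def)
  moreover have "(LINT y|lborel. indicator {x..} y * exp (x - y)) = (LINT y|lborel. indicator {x<..} y * exp (x - y))"
    using AE_lborel_singleton[of x] by (intro integral_cong_AE) (auto elim!: eventually_mono simp: indicator_def)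
  ultimately show ?thesis by simp
qed

context
  fixes f :: "real \<Rightarrow> real" and K :: real
  assumes f: "continuous_on UNIV f" and K: "\<And>x. \<bar>f x\<bar> \<le> K"
begin

lemma exp_right_left_integrable:
  shows exp_right_integrable: "integrable lborel (\<lambda>y. indicator {x..} y * (exp (x - y) * f y))"
    and exp_left_integrable: "integrable lborel (\<lambda>y. indicator {..x} y * (exp (y - x) * f y))"
proof -
  have [measurable]: "f \<in> borel_measurable borel" by (rule borel_measurable_continuous_onI[OF f])
  have i: "integrable lborel (\<lambda>y. K * exp (- \<bar>x - y\<bar>))" by (intro integrable_mult_right exp_abs_integrable)
  have K0: "K \<ge> 0" using K[of 0] by simp
  have le: "exp r * \<bar>f y\<bar> \<le> K * exp r" for r y using mult_right_mono[OF K[of y], of "exp r"] by (simp add: mult.commute)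
  show "integrable lborel (\<lambda>y. indicator {x..} y * (exp (x - y) * f y))"
    by (rule Bochner_Integration.integrable_bound[OF i])
       (use le[of "- \<bar>x - _\<bar>"] K0 in \<open>auto simp: abs_mult indicator_def intro!: AE_I2\<close>)
  show "integrable lborel (\<lambda>y. indicator {..x} y * (exp (y - x) * f y))"
    by (rule Bochner_Integration.integrable_bound[OF i])
       (use le[of "- \<bar>x - _\<bar>"] K0 in \<open>auto simp: abs_mult indicator_def intro!: AE_I2\<close>)
qed

lemma helmholtz_inv_eq: "helmholtz_inv f x = (exp_right f x + exp_left f x) / 2"
proof -
  have [measurable]: "f \<in> borel_measurable borel" by (rule borel_measurable_continuous_onI[OF f])
  have "helmholtz_inv f x = (LINT y|lborel. (1/2) * (indicator {x..} y * (exp (x - y) * f y) + indicator {..x} y * (exp (y - x) * f y)))"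
    unfolding helmholtz_inv_def
    using AE_lborel_singleton[of x] by (intro integral_cong_AE) (auto elim!: eventually_mono simp: indicator_def)
  also have "\<dots> = (exp_right f x + exp_left f x) / 2"
    unfolding exp_right_def exp_left_def
    using Bochner_Integration.integral_add[OF exp_right_integrable[of x] exp_left_integrable[of x]] by simp
  finally show ?thesis .
qed

text \<open>With a fixed base point \<open>c\<close>, the dependence on \<open>x\<close> sits in
  exponentials and in an integral over a compact interval, so the fundamental theorem of calculus
  gives the derivative without differentiating under an improper integral.\<close>

lemma exp_right_split:
  assumes "c \<le> x"
  shows "exp_right f x = exp (x - c) * exp_right f c - exp x * integral {c..x} (\<lambda>y. exp (- y) * f y)"
proof -
  have [measurable]: "f \<in> borel_measurable borel" by (rule borel_measurable_continuous_onI[OF f])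
  have si: "set_integrable lborel {c..x} (\<lambda>y. exp (- y) * f y)"
    by (intro borel_integrable_atLeastAtMost' continuous_intros continuous_on_subset[OF f]) auto
  have i: "integrable lborel (\<lambda>y. indicator {c..x} y * (exp (- y) * f y))"
    using si by (simp add: set_integrable_def)
  have e: "exp (x - c) * (exp (c - y) * z) = exp (x - y) * z" "exp x * (exp (- y) * z) = exp (x - y) * z" for y z
    by (simp_all flip: exp_add mult.assoc)
  have "exp (x - c) * exp_right f c - exp x * integral {c..x} (\<lambda>y. exp (- y) * f y)
    = (LINT y|lborel. exp (x - c) * (indicator {c..} y * (exp (c - y) * f y))) - (LINT y|lborel. exp x * (indicator {c..x} y * (exp (- y) * f y)))"
    using set_borel_integral_eq_integral(2)[OF si]
    by (simp add: exp_right_def set_lebesgue_integral_def)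
  also have "\<dots> = (LINT y|lborel. exp (x - c) * (indicator {c..} y * (exp (c - y) * f y)) - exp x * (indicator {c..x} y * (exp (- y) * f y)))"
    by (rule Bochner_Integration.integral_diff[symmetric]) (intro integrable_mult_right exp_right_integrable i)+
  also have "\<dots> = exp_right f x"
    unfolding exp_right_def
    using AE_lborel_singleton[of x] assms by (intro integral_cong_AE) (auto elim!: eventually_mono simp: indicator_def e)
  finally show ?thesis by simp
qed

lemma exp_right_has_derivative: "(exp_right f has_real_derivative exp_right f x - f x) (at x)"
proof -
  define c where "c = x - 1"
  have cont: "continuous_on {c..x+1} (\<lambda>y. exp (- y) * f y)"
    by (intro continuous_intros continuous_on_subset[OF f]) auto
  have "((\<lambda>u. integral {c..u} (\<lambda>y. exp (- y) * f y)) has_vector_derivative exp (- x) * f x) (at x within {c..x+1})"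
    by (rule integral_has_vector_derivative[OF cont]) (simp add: c_def)
  moreover have "at x within {c..x+1} = at x"
    by (rule at_within_interior) (simp add: c_def)
  ultimately have d: "((\<lambda>u. integral {c..u} (\<lambda>y. exp (- y) * f y)) has_real_derivative exp (- x) * f x) (at x)"
    by (simp add: has_real_derivative_iff_has_vector_derivative)
  have "((\<lambda>u. exp (u - c) * exp_right f c - exp u * integral {c..u} (\<lambda>y. exp (- y) * f y)) has_real_derivative
     (exp (x - c) * exp_right f c - (exp x * integral {c..x} (\<lambda>y. exp (- y) * f y) + exp x * (exp (- x) * f x)))) (at x)"
    by (rule derivative_eq_intros refl d)+ simp
  moreover have "exp (x - c) * exp_right f c - (exp x * integral {c..x} (\<lambda>y. exp (- y) * f y) + exp x * (exp (- x) * f x)) = exp_right f x - f x"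
    using exp_right_split[of c x] by (simp add: c_def exp_minus)
  ultimately have "((\<lambda>u. exp (u - c) * exp_right f c - exp u * integral {c..u} (\<lambda>y. exp (- y) * f y)) has_real_derivative exp_right f x - f x) (at x)"
    by simp
  then show ?thesis
  proof (rule has_field_derivative_transform_within_open[where S="{c<..}"])
    show "exp (y - c) * exp_right f c - exp y * integral {c..y} (\<lambda>y. exp (- y) * f y) = exp_right f y" if "y \<in> {c<..}" for y
      using exp_right_split[of c y] that by simp
  qed (auto simp: c_def)
qed

lemma exp_right_bound: "\<bar>exp_right f x\<bar> \<le> K"
proof -
  have [measurable]: "f \<in> borel_measurable borel" by (rule borel_measurable_continuous_onI[OF f])
  have i: "integrable lborel (\<lambda>y. K * (indicator {x..} y * exp (x - y)))"
    by (intro integrable_mult_right, rule Bochner_Integration.integrable_bound[OF exp_abs_integrable[of x]])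
       (auto simp: indicator_def intro!: AE_I2)
  have "norm (exp_right f x) \<le> (LINT y|lborel. K * (indicator {x..} y * exp (x - y)))"
    unfolding exp_right_def
    by (rule Bochner_Integration.integral_norm_bound_integral)
       (use K exp_right_integrable i in \<open>auto simp: indicator_def abs_mult mult.commute[of K]\<close>)
  then show ?thesis using integral_exp_half_line[of x] by simp
qed

end

lemma exp_left_has_derivative: 
  assumes f: "continuous_on UNIV f" and K: "\<And>x. \<bar>f x\<bar> \<le> K"
  shows "(exp_left f has_real_derivative f x - exp_left f x) (at x)"
proof -
  have "((\<lambda>x. exp_right (\<lambda>y. f (- y)) (- x)) has_real_derivative (exp_right (\<lambda>y. f (- y)) (- x) - f (- (- x))) * (- 1)) (at x)"
    by (rule DERIV_chain2[OF exp_right_has_derivative[of "\<lambda>y. f (- y)" K]])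
       (use K in \<open>auto intro!: derivative_eq_intros continuous_on_compose2[OF f] continuous_intros\<close>)
  then show ?thesis by (simp add: exp_left_reflect[abs_def])
qed

lemma exp_left_bound: 
  assumes f: "continuous_on UNIV f" and K: "\<And>x. \<bar>f x\<bar> \<le> K"
  shows "\<bar>exp_left f x\<bar> \<le> K"
  unfolding exp_left_reflect
  by (rule exp_right_bound) (use K in \<open>auto intro!: continuous_on_compose2[OF f] continuous_intros\<close>)

lemma exp_right_diff:
  assumes f: "continuous_on UNIV f" "\<And>x. \<bar>f x\<bar> \<le> K" and g: "continuous_on UNIV g" "\<And>x. \<bar>g x\<bar> \<le> L"
  shows "exp_right (\<lambda>x. f x - g x) x = exp_right f x - exp_right g x"
  using Bochner_Integration.integral_diff[OF exp_right_integrable[OF f] exp_right_integrable[OF g], of x x]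
  by (simp add: exp_right_def right_diff_distrib)

lemma exp_left_diff:
  assumes f: "continuous_on UNIV f" "\<And>x. \<bar>f x\<bar> \<le> K" and g: "continuous_on UNIV g" "\<And>x. \<bar>g x\<bar> \<le> L"
  shows "exp_left (\<lambda>x. f x - g x) x = exp_left f x - exp_left g x"
  using Bochner_Integration.integral_diff[OF exp_left_integrable[OF f] exp_left_integrable[OF g], of x x]
  by (simp add: exp_left_def right_diff_distrib)

lemma deriv_helmholtz_inv:
  assumes f: "continuous_on UNIV f" and K: "\<And>x. \<bar>f x\<bar> \<le> K"
  shows "deriv (helmholtz_inv f) x = (exp_right f x - exp_left f x) / 2"
proof (rule DERIV_imp_deriv)
  have "helmholtz_inv f = (\<lambda>x. (exp_right f x + exp_left f x) / 2)"
    using helmholtz_inv_eq[OF f K] by auto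
  then show "(helmholtz_inv f has_real_derivative (exp_right f x - exp_left f x) / 2) (at x)"
    by (auto intro!: derivative_eq_intros exp_right_has_derivative[OF f K] exp_left_has_derivative[OF f K])
qed

lemma speed_eq:
  assumes f: "continuous_on UNIV f" "\<And>x. \<bar>f x\<bar> \<le> K" and g: "continuous_on UNIV g" "\<And>x. \<bar>g x\<bar> \<le> L"
  shows "speed f g x = exp_right f x * exp_left g x"
  unfolding speed_def Let_def deriv_helmholtz_inv[OF f] deriv_helmholtz_inv[OF g] helmholtz_inv_eq[OF f] helmholtz_inv_eq[OF g]
  by (simp add: field_simps)

lemma big_M_eq:
  assumes f: "continuous_on UNIV f" "\<And>x. \<bar>f x\<bar> \<le> K" and g: "continuous_on UNIV g" "\<And>x. \<bar>g x\<bar> \<le> L"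
  shows "big_M f g x = g x * exp_right f x - f x * exp_left g x"
  unfolding big_M_def Let_def deriv_helmholtz_inv[OF f] deriv_helmholtz_inv[OF g] helmholtz_inv_eq[OF f] helmholtz_inv_eq[OF g]
  by (simp add: field_simps)

text \<open>In \<open>(A B)' = (A - f) B + A (g - B)\<close> the products \<open>A B\<close> cancel.
  This puts the equations in divergence form.\<close>

lemma speed_has_derivative:
  assumes f: "continuous_on UNIV f" "\<And>x. \<bar>f x\<bar> \<le> K" and g: "continuous_on UNIV g" "\<And>x. \<bar>g x\<bar> \<le> L"
  shows "(speed f g has_real_derivative big_M f g x) (at x)"
proof -
  have "((\<lambda>x. exp_right f x * exp_left g x) has_real_derivative big_M f g x) (at x)"
    by (rule derivative_eq_intros exp_right_has_derivative[OF f] exp_left_has_derivative[OF g])+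
       (simp add: big_M_eq[OF f g] algebra_simps)
  moreover have "speed f g = (\<lambda>x. exp_right f x * exp_left g x)" using speed_eq[OF f g] by auto
  ultimately show ?thesis by simp
qed

section \<open>From the weak formulation to fluxes through points\<close>

text \<open>The distribution is applied to \<open>w \<psi>\<close>, which is differentiable but need
  not be Schwartz. The product rule splits \<open>(w \<psi>)'\<close>; the part with
  \<open>w'\<close> cancels against the right-hand side, and what remains is the flux
  \<open>\<rho> w\<close> tested with \<open>\<psi>'\<close>.\<close>

lemma transport_weak_form:
  assumes \<rho>: "continuous_on UNIV \<rho>" "\<And>x. \<bar>\<rho> x\<bar> \<le> K"
    and w: "\<And>x. (w has_real_derivative w' x) (at x)" "\<And>x. \<bar>w x\<bar> \<le> L"
    and w': "w' \<in> borel_measurable borel" "\<And>x. \<bar>w' x\<bar> \<le> L'"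
    and \<phi>: "(\<lambda>x. complex_of_real (\<psi> x)) \<in> schwartz" "vderiv (\<lambda>x. complex_of_real (\<psi> x)) = (\<lambda>x. complex_of_real (\<psi>' x))"
    and eq: "D + distr_mult w (distr_deriv (distr_of \<rho>)) (\<lambda>x. complex_of_real (\<psi> x)) = distr_of (\<lambda>x. - w' x * \<rho> x) (\<lambda>x. complex_of_real (\<psi> x))"
  shows "D = complex_of_real (LINT x|lborel. \<rho> x * w x * \<psi>' x)"
proof -
  have \<phi>': "(\<lambda>x. complex_of_real (\<psi>' x)) \<in> schwartz" using schwartz_vderiv[OF \<phi>(1)] by (simp add: \<phi>(2))
  have [measurable]: "\<rho> \<in> borel_measurable borel" by (rule borel_measurable_continuous_onI[OF \<rho>(1)])
  have [measurable]: "w \<in> borel_measurable borel"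
    by (rule borel_measurable_continuous_onI) (use w(1) DERIV_isCont continuous_at_imp_continuous_on in blast)
  note [measurable] = w'(1)
  have bi: "integrable lborel (\<lambda>x. complex_of_real (g x) * \<psi> x)"
    if [measurable]: "g \<in> borel_measurable borel" and "\<And>x. \<bar>g x\<bar> \<le> C" and s: "(\<lambda>x. complex_of_real (\<psi> x)) \<in> schwartz" for g \<psi> C
  proof -
    note [measurable] = schwartz_measurable[OF s]
    have C: "C \<ge> 0" using that(2)[of 0] by simp
    show ?thesis
      by (rule Bochner_Integration.integrable_bound[OF integrable_mult_right[OF schwartz_integrable[OF s], of "complex_of_real C"]])
         (use that(2) C in \<open>auto simp: norm_mult intro!: AE_I2 mult_right_mono\<close>)
  qed
  have W: "vderiv (\<lambda>x. complex_of_real (w x) * complex_of_real (\<psi> x)) = (\<lambda>x. complex_of_real (w' x) * complex_of_real (\<psi> x) + complex_of_real (w x) * complex_of_real (\<psi>' x))"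
  proof (rule vderiv_eqI)
    fix x
    have "((\<lambda>x. complex_of_real (\<psi> x)) has_vector_derivative complex_of_real (\<psi>' x)) (at x)"
      using schwartz_has_vector_derivative[OF \<phi>(1), of x] by (simp add: \<phi>(2))
    from has_vector_derivative_mult[OF has_vector_derivative_of_real[OF w(1)] this]
    show "((\<lambda>x. complex_of_real (w x) * complex_of_real (\<psi> x)) has_vector_derivative complex_of_real (w' x) * complex_of_real (\<psi> x) + complex_of_real (w x) * complex_of_real (\<psi>' x)) (at x)"
      by (simp add: add.commute)
  qed
  have nn: "K \<ge> 0" using \<rho>(2)[of 0] by simp
  have i1: "integrable lborel (\<lambda>x. complex_of_real (\<rho> x * w' x) * complex_of_real (\<psi> x))"
    by (rule bi[where C="K * L'"]) (use \<rho> w' \<phi> nn in \<open>auto simp: abs_mult intro!: mult_mono\<close>)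
  have i2: "integrable lborel (\<lambda>x. complex_of_real (\<rho> x * w x) * complex_of_real (\<psi>' x))"
    by (rule bi[where C="K * L"]) (use \<rho> w \<phi>' nn in \<open>auto simp: abs_mult intro!: mult_mono\<close>)
  have "distr_mult w (distr_deriv (distr_of \<rho>)) (\<lambda>x. complex_of_real (\<psi> x)) =
     - (LINT x|lborel. complex_of_real (\<rho> x * w' x) * complex_of_real (\<psi> x) + complex_of_real (\<rho> x * w x) * complex_of_real (\<psi>' x))"
    unfolding distr_mult_def distr_deriv_def distr_of_def W
    by (simp add: algebra_simps)
  also have "\<dots> = - (LINT x|lborel. complex_of_real (\<rho> x * w' x) * complex_of_real (\<psi> x)) - (LINT x|lborel. complex_of_real (\<rho> x * w x) * complex_of_real (\<psi>' x))"
    by (subst Bochner_Integration.integral_add[OF i1 i2]) simp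
  finally have X: "distr_mult w (distr_deriv (distr_of \<rho>)) (\<lambda>x. complex_of_real (\<psi> x)) =
     - (LINT x|lborel. complex_of_real (\<rho> x * w' x) * complex_of_real (\<psi> x)) - (LINT x|lborel. complex_of_real (\<rho> x * w x) * complex_of_real (\<psi>' x))" .
  have alg: "D = E + P + Q" if "D + X = E" "X = - P - Q" for D X E P Q :: complex
    using that by (auto simp: algebra_simps)
  note alg[OF eq X]
  also have "distr_of (\<lambda>x. - w' x * \<rho> x) (\<lambda>x. complex_of_real (\<psi> x)) = - (LINT x|lborel. complex_of_real (\<rho> x * w' x) * complex_of_real (\<psi> x))"
    unfolding distr_of_def by (subst Bochner_Integration.integral_minus[symmetric]) (simp add: mult_ac)
  finally show ?thesis by (simp flip: of_real_mult)
qed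

section \<open>Smoothed indicators of intervals and their limits\<close>

lemma logistic_minus: "logistic (- z) = 1 - logistic z"
proof -
  have "1 / (1 + 1 / e) = 1 - 1 / (1 + e)" if "e > 0" for e :: real using that by (simp add: field_simps)
  from this[of "exp (-z)"] show ?thesis by (simp add: logistic_def exp_minus inverse_eq_divide)
qed

lemma logistic_le_exp: "logistic z \<le> exp z"
proof -
  have "1 / (1 + 1 / e) \<le> e" if "e > 0" for e :: real using that by (simp add: field_simps)
  from this[of "exp z"] show ?thesis by (simp add: logistic_def exp_minus inverse_eq_divide)
qed

lemma logistic_mono: "x \<le> y \<Longrightarrow> logistic x \<le> logistic y"
  by (simp add: logistic_def frac_le add_pos_pos)

definition logistic_step :: "real \<Rightarrow> real \<Rightarrow> real \<Rightarrow> real \<Rightarrow> real" where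
  "logistic_step k a b x = logistic (k * (x - a)) - logistic (k * (x - b))"

lemma logistic_step_nonneg: "k \<ge> 0 \<Longrightarrow> a \<le> b \<Longrightarrow> logistic_step k a b x \<ge> 0"
  by (auto simp: logistic_step_def intro!: logistic_mono mult_left_mono)

text \<open>A majorant independent of \<open>k\<close>, for dominated convergence. It needs
  \<open>k \<ge> 1\<close>, which is why the parameters run through
  \<open>real (Suc n)\<close>.\<close>

lemma logistic_step_le:
  assumes "k \<ge> 1" "a \<le> b"
  shows "logistic_step k a b x \<le> indicator {a..b} x + exp (- \<bar>a - x\<bar>) + exp (- \<bar>b - x\<bar>)"
proof -
  consider "x < a" | "x > b" | "x \<in> {a..b}" by fastforce
  then show ?thesis
  proof cases
    case 1
    have "logistic_step k a b x \<le> logistic (k * (x - a))" using logistic_pos[of "k * (x - b)"] by (simp add: logistic_step_def)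
    also have "\<dots> \<le> exp (k * (x - a))" by (rule logistic_le_exp)
    also have "\<dots> \<le> exp (1 * (x - a))" using 1 assms by (subst exp_le_cancel_iff) (rule mult_right_mono_neg, auto)
    finally show ?thesis using 1 by (simp add: add_increasing2)
  next
    case 2
    have "logistic_step k a b x \<le> 1 - logistic (k * (x - b))" using logistic_less_1[of "k * (x - a)"] by (simp add: logistic_step_def)
    also have "\<dots> = logistic (- (k * (x - b)))" by (simp add: logistic_minus)
    also have "\<dots> \<le> exp (- (k * (x - b)))" by (rule logistic_le_exp)
    also have "\<dots> \<le> exp (- (1 * (x - b)))" using 2 assms by (subst exp_le_cancel_iff, subst neg_le_iff_le) (rule mult_right_mono, auto)
    finally show ?thesis using 2 by (simp add: add_increasing2 add_increasing)
  next
    case 3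
    have "logistic_step k a b x \<le> 1"
      using logistic_less_1[of "k * (x - a)"] logistic_pos[of "k * (x - b)"] by (simp add: logistic_step_def)
    then show ?thesis using 3 by (simp add: add_increasing2)
  qed
qed

lemma logistic_scaled_tendsto:
  assumes "z \<noteq> 0"
  shows "(\<lambda>n. logistic (real (Suc n) * z)) \<longlonglongrightarrow> (if z > 0 then 1 else 0)"
proof (cases "z > 0")
  case True
  then have "filterlim (\<lambda>n. real (Suc n) * z) at_top sequentially" by real_asymp
  from filterlim_compose[OF logistic_tendsto(1) this] show ?thesis using True by simp
next
  case False
  then have "z < 0" using assms by simp
  then have "filterlim (\<lambda>n. real (Suc n) * z) at_bot sequentially" by real_asymp
  from filterlim_compose[OF logistic_tendsto(2) this] show ?thesis using False by simp
qed

lemma logistic_step_tendsto: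
  assumes \<rho>: "continuous_on UNIV \<rho>" "\<And>x. \<bar>\<rho> x\<bar> \<le> K" and "a < b"
  shows "(\<lambda>n. LINT x|lborel. \<rho> x * logistic_step (real (Suc n)) a b x) \<longlonglongrightarrow> integral {a..b} \<rho>"
proof -
  have [measurable]: "\<rho> \<in> borel_measurable borel" by (rule borel_measurable_continuous_onI[OF \<rho>(1)])
  have [measurable]: "logistic \<in> borel_measurable borel" by (rule borel_measurable_continuous_onI[OF logistic_continuous])
  have K: "K \<ge> 0" using \<rho>(2)[of 0] by simp
  have "(\<lambda>n. LINT x|lborel. \<rho> x * logistic_step (real (Suc n)) a b x) \<longlonglongrightarrow> (LINT x|lborel. \<rho> x * indicator {a..b} x)"
  proof (rule integral_dominated_convergence)
    show "integrable lborel (\<lambda>x. K * (indicator {a..b} x + exp (- \<bar>a - x\<bar>) + exp (- \<bar>b - x\<bar>)))"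
      using \<open>a < b\<close> by (intro integrable_mult_right Bochner_Integration.integrable_add exp_abs_integrable integrable_real_indicator) auto
    show "AE x in lborel. norm (\<rho> x * logistic_step (real (Suc n)) a b x) \<le> K * (indicator {a..b} x + exp (- \<bar>a - x\<bar>) + exp (- \<bar>b - x\<bar>))" for n
    proof (rule AE_I2)
      fix x
      show "norm (\<rho> x * logistic_step (real (Suc n)) a b x) \<le> K * (indicator {a..b} x + exp (- \<bar>a - x\<bar>) + exp (- \<bar>b - x\<bar>))"
        unfolding real_norm_def abs_mult using logistic_step_le[of "real (Suc n)" a b x] logistic_step_nonneg[of "real (Suc n)" a b x] \<open>a < b\<close> K
        by (intro mult_mono \<rho>) auto
    qed
    show "AE x in lborel. (\<lambda>n. \<rho> x * logistic_step (real (Suc n)) a b x) \<longlonglongrightarrow> \<rho> x * indicator {a..b} x"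
      using AE_lborel_singleton[of a] AE_lborel_singleton[of b]
    proof eventually_elim
      case (elim x)
      have "(\<lambda>n. logistic_step (real (Suc n)) a b x) \<longlonglongrightarrow> (if x - a > 0 then 1 else 0) - (if x - b > 0 then 1 else 0)"
        unfolding logistic_step_def using elim by (intro tendsto_diff logistic_scaled_tendsto) auto
      also have "(if x - a > 0 then 1 else 0) - (if x - b > 0 then 1 else 0) = (indicator {a..b} x :: real)"
        using elim \<open>a < b\<close> by (auto simp: indicator_def)
      finally show ?case by (intro tendsto_mult tendsto_const)
    qed
  qed (unfold logistic_step_def, measurable)
  also have "(LINT x|lborel. \<rho> x * indicator {a..b} x) = integral {a..b} \<rho>"
  proof -
    have "set_integrable lborel {a..b} \<rho>" by (intro borel_integrable_atLeastAtMost' continuous_on_subset[OF \<rho>(1)]) auto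
    from set_borel_integral_eq_integral(2)[OF this] show ?thesis by (simp add: set_lebesgue_integral_def mult.commute)
  qed
  finally show ?thesis .
qed

text \<open>The identity for each smoothed indicator is integrated in time first, and only then
  \<open>k\<close> tends to infinity under the time integral, so the mass of an interval never has
  to be differentiated. As the kernels have unit mass, \<open>2 * (K * L)\<close> dominates the
  integrands.\<close>

lemma flux_identity:
  fixes \<rho> w :: "real \<Rightarrow> real \<Rightarrow> real"
  assumes t: "0 \<le> t" and ab: "a < b"
    and \<rho>: "\<And>\<tau>. \<tau> \<in> {0..t} \<Longrightarrow> continuous_on UNIV (\<rho> \<tau>)" "\<And>\<tau> x. \<tau> \<in> {0..t} \<Longrightarrow> \<bar>\<rho> \<tau> x\<bar> \<le> K"
    and w: "\<And>\<tau>. \<tau> \<in> {0..t} \<Longrightarrow> continuous_on UNIV (w \<tau>)" "\<And>\<tau> x. \<tau> \<in> {0..t} \<Longrightarrow> \<bar>w \<tau> x\<bar> \<le> L"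
    and deriv: "\<And>k \<tau>. k > 0 \<Longrightarrow> \<tau> \<in> {0..t} \<Longrightarrow>
      ((\<lambda>\<tau>. LINT x|lborel. \<rho> \<tau> x * logistic_step k a b x) has_real_derivative
        (LINT x|lborel. \<rho> \<tau> x * w \<tau> x * (logistic_kernel k a x - logistic_kernel k b x))) (at \<tau> within {0..t})"
  shows "((\<lambda>\<tau>. \<rho> \<tau> a * w \<tau> a - \<rho> \<tau> b * w \<tau> b) has_integral (integral {a..b} (\<rho> t) - integral {a..b} (\<rho> 0))) {0..t}"
proof -
  define k where "k n = real (Suc n)" for n
  have k: "k n > 0" for n by (simp add: k_def)
  have K: "K \<ge> 0" using \<rho>(2)[of 0 0] t by simp
  have b: "\<bar>\<rho> \<tau> x * w \<tau> x\<bar> \<le> K * L" if "\<tau> \<in> {0..t}" for \<tau> x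
    unfolding abs_mult by (intro mult_mono \<rho> w that K) auto
  have cont: "continuous_on UNIV (\<lambda>x. \<rho> \<tau> x * w \<tau> x)" if "\<tau> \<in> {0..t}" for \<tau>
    by (intro continuous_intros \<rho> w that)
  have int: "integrable lborel (\<lambda>x. \<rho> \<tau> x * w \<tau> x * logistic_kernel (k n) c x)" if "\<tau> \<in> {0..t}" for \<tau> n c
  proof -
    have [measurable]: "(\<lambda>x. \<rho> \<tau> x * w \<tau> x) \<in> borel_measurable borel" by (rule borel_measurable_continuous_onI[OF cont[OF that]])
    have "integrable lborel (\<lambda>x. complex_of_real (logistic_kernel (k n) c x))"
      by (intro schwartz_integrable logistic_kernel_schwartz k)
    then have "integrable lborel (\<lambda>x. (K * L) * logistic_kernel (k n) c x)" by (simp add: complex_of_real_integrable_eq)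
    then show ?thesis
    proof (rule Bochner_Integration.integrable_bound, safe intro!: AE_I2)
      fix x
      have "0 \<le> logistic_kernel (k n) c x" using k[of n] by (intro logistic_kernel_nonneg) simp
      moreover have "0 \<le> K * L" using b[OF that, of x] by (meson abs_ge_zero order_trans)
      ultimately show "norm (\<rho> \<tau> x * w \<tau> x * logistic_kernel (k n) c x) \<le> norm ((K * L) * logistic_kernel (k n) c x)"
        using mult_right_mono[OF b[OF that, of x], of "logistic_kernel (k n) c x"]
        unfolding norm_mult[of _ "logistic_kernel (k n) c x"] by simp
    qed measurable
  qed
  have one: "integrable lborel (logistic_kernel (k n) c)" "(LINT x|lborel. logistic_kernel (k n) c x) = 1" for n c
  proof -
    have "integrable lborel (\<lambda>x. complex_of_real (logistic_kernel (k n) c x))"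
      by (intro schwartz_integrable logistic_kernel_schwartz k)
    then show "integrable lborel (logistic_kernel (k n) c)" by (simp add: complex_of_real_integrable_eq)
    show "(LINT x|lborel. logistic_kernel (k n) c x) = 1"
      using logistic_kernel_integral[OF k, of "\<lambda>_. 1" n c] by (simp add: logistic_density_integral)
  qed
  have bnd: "\<bar>LINT x|lborel. \<rho> \<tau> x * w \<tau> x * logistic_kernel (k n) c x\<bar> \<le> K * L" if "\<tau> \<in> {0..t}" for \<tau> n c
  proof -
    have "norm (LINT x|lborel. \<rho> \<tau> x * w \<tau> x * logistic_kernel (k n) c x) \<le> (LINT x|lborel. (K * L) * logistic_kernel (k n) c x)"
      by (rule Bochner_Integration.integral_norm_bound_integral)
         (use int[OF that] one b[OF that] logistic_kernel_nonneg[of "k n" c] k[of n] in \<open>auto simp: abs_mult intro!: mult_right_mono\<close>)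
    then show ?thesis by (simp add: one)
  qed
  show ?thesis
  proof (rule has_integral_dominated_convergence)
    show "((\<lambda>\<tau>. LINT x|lborel. \<rho> \<tau> x * w \<tau> x * (logistic_kernel (k n) a x - logistic_kernel (k n) b x)) has_integral
       ((LINT x|lborel. \<rho> t x * logistic_step (k n) a b x) - (LINT x|lborel. \<rho> 0 x * logistic_step (k n) a b x))) {0..t}" for n
      using deriv[OF k] by (intro fundamental_theorem_of_calculus t) (simp add: has_real_derivative_iff_has_vector_derivative)
    show "(\<lambda>\<tau>::real. 2 * (K * L)) integrable_on {0..t}" by (rule integrable_const_ivl)
    have split: "(LINT x|lborel. \<rho> \<tau> x * w \<tau> x * (logistic_kernel (k n) a x - logistic_kernel (k n) b x)) = 
        (LINT x|lborel. \<rho> \<tau> x * w \<tau> x * logistic_kernel (k n) a x) - (LINT x|lborel. \<rho> \<tau> x * w \<tau> x * logistic_kernel (k n) b x)"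
      if "\<tau> \<in> {0..t}" for \<tau> n
      by (simp add: right_diff_distrib int[OF that])
    show "\<forall>\<tau>\<in>{0..t}. norm (LINT x|lborel. \<rho> \<tau> x * w \<tau> x * (logistic_kernel (k n) a x - logistic_kernel (k n) b x)) \<le> 2 * (K * L)" for n
    proof
      fix \<tau> assume tau: "\<tau> \<in> {0..t}"
      show "norm (LINT x|lborel. \<rho> \<tau> x * w \<tau> x * (logistic_kernel (k n) a x - logistic_kernel (k n) b x)) \<le> 2 * (K * L)"
        unfolding split[OF tau] using bnd[OF tau, of n a] bnd[OF tau, of n b] by simp
    qed
    show "\<forall>\<tau>\<in>{0..t}. (\<lambda>n. LINT x|lborel. \<rho> \<tau> x * w \<tau> x * (logistic_kernel (k n) a x - logistic_kernel (k n) b x)) \<longlonglongrightarrow> \<rho> \<tau> a * w \<tau> a - \<rho> \<tau> b * w \<tau> b"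
    proof
      fix \<tau> assume tau: "\<tau> \<in> {0..t}"
      have "(\<lambda>n. LINT x|lborel. \<rho> \<tau> x * w \<tau> x * logistic_kernel (k n) c x) \<longlonglongrightarrow> \<rho> \<tau> c * w \<tau> c" for c
        unfolding k_def
        by (rule logistic_kernel_tendsto[OF borel_measurable_continuous_onI[OF cont[OF tau]] b[OF tau]])
           (use cont[OF tau] in \<open>auto simp: continuous_on_eq_continuous_at\<close>)
      then show "(\<lambda>n. LINT x|lborel. \<rho> \<tau> x * w \<tau> x * (logistic_kernel (k n) a x - logistic_kernel (k n) b x)) \<longlonglongrightarrow> \<rho> \<tau> a * w \<tau> a - \<rho> \<tau> b * w \<tau> b"
        unfolding split[OF tau] by (intro tendsto_diff)
    qed
    have "(\<lambda>n. LINT x|lborel. \<rho> \<tau> x * logistic_step (k n) a b x) \<longlonglongrightarrow> integral {a..b} (\<rho> \<tau>)" if "\<tau> \<in> {0..t}" for \<tau>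
      unfolding k_def by (rule logistic_step_tendsto[OF \<rho>(1)[OF that] \<rho>(2)[OF that] ab])
    then show "(\<lambda>n. (LINT x|lborel. \<rho> t x * logistic_step (k n) a b x) - (LINT x|lborel. \<rho> 0 x * logistic_step (k n) a b x)) \<longlonglongrightarrow>
        integral {a..b} (\<rho> t) - integral {a..b} (\<rho> 0)"
      using t by (intro tendsto_diff) auto
  qed
qed

section \<open>Mass between trajectories\<close>

lemma uniform_limit_jointly_continuous:
  fixes f :: "real \<Rightarrow> real \<Rightarrow> real"
  assumes lim: "\<And>t. t \<in> J \<Longrightarrow> uniform_limit UNIV f (f t) (at t within J)"
    and cont: "\<And>t. t \<in> J \<Longrightarrow> continuous_on UNIV (f t)"
  shows "continuous_on (J \<times> UNIV) (\<lambda>(t, x). f t x)"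
proof (rule continuous_onI)
  fix p :: "real \<times> real" and e :: real assume e: "e > 0" and "p \<in> J \<times> UNIV"
  then obtain t x where t: "t \<in> J" and p: "p = (t, x)" by auto
  have "\<forall>\<^sub>F \<tau> in at t within J. \<forall>x\<in>UNIV. dist (f \<tau> x) (f t x) < e/2"
    using uniform_limitD[OF lim[OF t], of "e/2"] e by simp
  then obtain d1 where d1: "d1 > 0" "\<And>\<tau> y. \<tau> \<in> J \<Longrightarrow> dist \<tau> t < d1 \<Longrightarrow> dist (f \<tau> y) (f t y) < e/2"
    unfolding eventually_at using e by (metis UNIV_I dist_self half_gt_zero)
  obtain d2 where d2: "d2 > 0" "\<And>y. dist y x < d2 \<Longrightarrow> dist (f t y) (f t x) < e/2"
    using cont[OF t] e unfolding continuous_on_iff by (metis UNIV_I half_gt_zero)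
  show "\<exists>d>0. \<forall>p'\<in>J \<times> UNIV. dist p' p < d \<longrightarrow> dist (case p' of (t, x) \<Rightarrow> f t x) (case p of (t, x) \<Rightarrow> f t x) \<le> e"
    unfolding p
  proof (intro exI[of _ "min d1 d2"] conjI ballI impI)
    fix p' assume "p' \<in> J \<times> (UNIV :: real set)" "dist p' (t, x) < min d1 d2"
    obtain \<tau> y where p': "p' = (\<tau>, y)" by (cases p')
    have "dist \<tau> t \<le> dist p' (t, x)" "dist y x \<le> dist p' (t, x)"
      unfolding p' using dist_fst_le[of "(\<tau>, y)" "(t, x)"] dist_snd_le[of "(\<tau>, y)" "(t, x)"] by auto
    then have "dist (f \<tau> y) (f t y) < e/2" "dist (f t y) (f t x) < e/2"
      using \<open>p' \<in> _\<close> \<open>dist p' _ < _\<close> d1(2) d2(2) p' by auto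
    then show "dist (case p' of (t, x) \<Rightarrow> f t x) (case (t, x) of (t, x) \<Rightarrow> f t x) \<le> e"
      using dist_triangle_half_r[of "f t y" "f \<tau> y" e "f t x"] by (simp add: p' dist_commute)
  qed (use d1 d2 in auto)
qed

lemma uniform_limit_bounded_on_compact:
  fixes f :: "real \<Rightarrow> real \<Rightarrow> real"
  assumes lim: "\<And>t. t \<in> J \<Longrightarrow> uniform_limit UNIV f (f t) (at t within J)"
    and bdd: "\<And>t. t \<in> J \<Longrightarrow> \<exists>K. \<forall>x. \<bar>f t x\<bar> \<le> K" and I: "compact I" "I \<subseteq> J"
  obtains K where "K \<ge> 0" "\<And>t x. t \<in> I \<Longrightarrow> \<bar>f t x\<bar> \<le> K"
proof -
  define N where "N t = (SUP x. \<bar>f t x\<bar>)" for t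
  have bd: "bdd_above (range (\<lambda>x. \<bar>f t x\<bar>))" if "t \<in> J" for t
    using bdd[OF that] by (auto simp: bdd_above_def)
  have le: "\<bar>f t x\<bar> \<le> N t" if "t \<in> J" for t x
    unfolding N_def by (rule cSUP_upper[OF _ bd[OF that]]) simp
  have mono: "N \<tau> \<le> N t + e" if "t \<in> J" "\<And>x. \<bar>f \<tau> x - f t x\<bar> < e" for \<tau> t e
    unfolding N_def[of \<tau>]
  proof (rule cSUP_least)
    fix x show "\<bar>f \<tau> x\<bar> \<le> N t + e" using le[OF that(1), of x] that(2)[of x] by linarith
  qed simp
  have "continuous_on J N"
    unfolding continuous_on_def
  proof (intro ballI tendstoI)
    fix t e :: real assume t: "t \<in> J" and e: "e > 0"
    have "\<forall>\<^sub>F \<tau> in at t within J. \<forall>x\<in>UNIV. dist (f \<tau> x) (f t x) < e/2"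
      using uniform_limitD[OF lim[OF t], of "e/2"] e by simp
    moreover have "\<forall>\<^sub>F \<tau> in at t within J. \<tau> \<in> J" by (simp add: eventually_at_filter)
    ultimately show "\<forall>\<^sub>F \<tau> in at t within J. dist (N \<tau>) (N t) < e"
    proof eventually_elim
      case (elim \<tau>)
      have "N \<tau> \<le> N t + e/2" using elim t by (intro mono) (auto simp: dist_real_def)
      moreover have "N t \<le> N \<tau> + e/2" using elim t by (intro mono) (auto simp: dist_real_def abs_minus_commute)
      ultimately show ?case using e by (simp add: dist_real_def abs_if)
    qed
  qed
  then have "bounded (N ` I)"
    using I by (intro compact_imp_bounded compact_continuous_image) (auto intro: continuous_on_subset)
  then obtain K where K: "\<forall>y\<in>N ` I. norm y \<le> K" unfolding bounded_iff by blast
  show ?thesis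
  proof (rule that[of "\<bar>K\<bar>"])
    show "\<bar>f t x\<bar> \<le> \<bar>K\<bar>" if "t \<in> I" for t x
      using le[of t x] K that I(2) by force
  qed simp
qed

text \<open>Gronwall in both directions. The argument uses \<open>D\<^sup>2\<close> because
  \<open>\<bar>D\<bar>\<close> may fail to be differentiable at zeros: multiplied by
  \<open>exp (- 2 * L * \<tau>)\<close> the square decreases, by \<open>exp (2 * L * \<tau>)\<close>
  it increases.\<close>

lemma exponential_growth_bounds:
  fixes D :: "real \<Rightarrow> real"
  assumes t: "0 \<le> t" and cont: "continuous_on {0..t} D"
    and deriv: "\<And>\<tau>. 0 < \<tau> \<Longrightarrow> \<tau> < t \<Longrightarrow> (D has_real_derivative D' \<tau>) (at \<tau>)"
    and le: "\<And>\<tau>. 0 < \<tau> \<Longrightarrow> \<tau> < t \<Longrightarrow> \<bar>D' \<tau>\<bar> \<le> L * \<bar>D \<tau>\<bar>"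
  shows "\<bar>D t\<bar> \<le> \<bar>D 0\<bar> * exp (L * t)" and "\<bar>D 0\<bar> * exp (- L * t) \<le> \<bar>D t\<bar>"
proof -
  have e1: "exp (2 * L * t) = (exp (L * t))\<^sup>2" and e2: "exp (- 2 * L * t) = (exp (- L * t))\<^sup>2"
    using exp_double[of "L * t"] exp_double[of "- L * t"] by (simp_all add: mult.assoc)
  have DD: "\<bar>D' \<tau> * D \<tau>\<bar> \<le> L * (D \<tau>)\<^sup>2" if "0 < \<tau>" "\<tau> < t" for \<tau>
    using mult_right_mono[OF le[OF that], of "\<bar>D \<tau>\<bar>"] by (simp add: abs_mult power2_eq_square mult.assoc)
  have d: "((\<lambda>\<tau>. (D \<tau>)\<^sup>2 * exp (c * \<tau>)) has_real_derivative (2 * (D' \<tau> * D \<tau>) + c * (D \<tau>)\<^sup>2) * exp (c * \<tau>)) (at \<tau>)"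
    if "0 < \<tau>" "\<tau> < t" for \<tau> c
    by (auto intro!: derivative_eq_intros deriv that simp: algebra_simps power2_eq_square)
  have c: "continuous_on {0..t} (\<lambda>\<tau>. (D \<tau>)\<^sup>2 * exp (c * \<tau>))" for c
    by (intro continuous_intros cont)
  have "(D 0)\<^sup>2 * exp (- 2 * L * 0) \<ge> (D t)\<^sup>2 * exp (- 2 * L * t)"
  proof (rule DERIV_nonpos_imp_decreasing_open[OF t _ c])
    fix \<tau> assume tau: "0 < \<tau>" "\<tau> < t"
    show "\<exists>y. ((\<lambda>\<tau>. (D \<tau>)\<^sup>2 * exp (- 2 * L * \<tau>)) has_real_derivative y) (at \<tau>) \<and> y \<le> 0"
      using DD[OF tau] d[OF tau, of "- 2 * L"] by (intro exI[of _ "(2 * (D' \<tau> * D \<tau>) + - 2 * L * (D \<tau>)\<^sup>2) * exp (- 2 * L * \<tau>)"] conjI) (auto simp: mult_le_0_iff)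
  qed
  then have "(D t)\<^sup>2 * exp (- 2 * L * t) * exp (2 * L * t) \<le> (D 0)\<^sup>2 * exp (2 * L * t)"
    by (intro mult_right_mono) auto
  then have "(D t)\<^sup>2 \<le> (D 0)\<^sup>2 * exp (2 * L * t)" by (simp add: mult.assoc flip: exp_add)
  also have "\<dots> = (\<bar>D 0\<bar> * exp (L * t))\<^sup>2" by (simp only: power_mult_distrib e1 power2_abs)
  finally show "\<bar>D t\<bar> \<le> \<bar>D 0\<bar> * exp (L * t)" by (simp add: abs_le_square_iff[symmetric] abs_mult)
  have "(D 0)\<^sup>2 * exp (2 * L * 0) \<le> (D t)\<^sup>2 * exp (2 * L * t)"
  proof (rule DERIV_nonneg_imp_increasing_open[OF t _ c])
    fix \<tau> assume tau: "0 < \<tau>" "\<tau> < t"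
    show "\<exists>y. ((\<lambda>\<tau>. (D \<tau>)\<^sup>2 * exp (2 * L * \<tau>)) has_real_derivative y) (at \<tau>) \<and> y \<ge> 0"
      using DD[OF tau] d[OF tau, of "2 * L"] by (intro exI[of _ "(2 * (D' \<tau> * D \<tau>) + 2 * L * (D \<tau>)\<^sup>2) * exp (2 * L * \<tau>)"] conjI) auto
  qed
  then have "(D 0)\<^sup>2 * exp (- 2 * L * t) \<le> (D t)\<^sup>2 * exp (2 * L * t) * exp (- 2 * L * t)"
    by (intro mult_right_mono) auto
  then have "(D 0)\<^sup>2 * exp (- 2 * L * t) \<le> (D t)\<^sup>2" by (simp add: mult.assoc flip: exp_add)
  moreover have "(D 0)\<^sup>2 * exp (- 2 * L * t) = (\<bar>D 0\<bar> * exp (- L * t))\<^sup>2" by (simp only: power_mult_distrib e2 power2_abs)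
  ultimately show "\<bar>D 0\<bar> * exp (- L * t) \<le> \<bar>D t\<bar>" by (simp add: abs_le_square_iff[symmetric] abs_mult)
qed

text \<open>With \<open>L\<close> to the left of both trajectories, the mass of \<open>\<rho>\<close> between \<open>L\<close> and either
  trajectory has the same time derivative, namely the flux through \<open>L\<close>. This chain rule only
  needs continuity of \<open>\<rho>\<close>.\<close>

lemma transport_mass:
  fixes \<rho> w :: "real \<Rightarrow> real \<Rightarrow> real" and qa qb :: "real \<Rightarrow> real"
  assumes t1: "0 \<le> t1"
    and \<rho>: "continuous_on ({0..t1} \<times> UNIV) (\<lambda>(t, x). \<rho> t x)"
    and w: "continuous_on ({0..t1} \<times> UNIV) (\<lambda>(t, x). w t x)"
    and flux: "\<And>t a b. t \<in> {0..t1} \<Longrightarrow> a < b \<Longrightarrow>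
      ((\<lambda>\<tau>. \<rho> \<tau> a * w \<tau> a - \<rho> \<tau> b * w \<tau> b) has_integral (integral {a..b} (\<rho> t) - integral {a..b} (\<rho> 0))) {0..t}"
    and qa: "\<And>t. t \<in> {0..t1} \<Longrightarrow> (qa has_real_derivative w t (qa t)) (at t within {0..t1})"
    and qb: "\<And>t. t \<in> {0..t1} \<Longrightarrow> (qb has_real_derivative w t (qb t)) (at t within {0..t1})"
    and ab: "\<And>t. t \<in> {0..t1} \<Longrightarrow> qa t \<le> qb t"
  shows "integral {qa t1..qb t1} (\<rho> t1) = integral {qa 0..qb 0} (\<rho> 0)"
proof -
  have ct: "continuous_on {0..t1} (\<lambda>\<tau>. f \<tau> x)" if "continuous_on ({0..t1} \<times> UNIV) (\<lambda>(t, x). f t x)" for f :: "real \<Rightarrow> real \<Rightarrow> real" and x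
  proof -
    have "continuous_on {0..t1} (\<lambda>\<tau>. case (\<tau>, x) of (t, x) \<Rightarrow> f t x)"
      by (rule continuous_on_compose2[OF that]) (auto intro!: continuous_intros)
    then show ?thesis by simp
  qed
  have cx: "continuous_on S (f t)" if "continuous_on ({0..t1} \<times> UNIV) (\<lambda>(t, x). f t x)" "t \<in> {0..t1}" for f :: "real \<Rightarrow> real \<Rightarrow> real" and t S
  proof -
    have "continuous_on S (\<lambda>x. case (t, x) of (t, x) \<Rightarrow> f t x)"
      by (rule continuous_on_compose2[OF that(1)]) (use that(2) in \<open>auto intro!: continuous_intros\<close>)
    then show ?thesis by simp
  qed
  have "bounded (qa ` {0..t1} \<union> qb ` {0..t1})"
    using DERIV_continuous_on[OF qa] DERIV_continuous_on[OF qb]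
    by (auto intro!: compact_imp_bounded compact_continuous_image)
  then obtain R where "\<forall>y\<in>qa ` {0..t1} \<union> qb ` {0..t1}. norm y \<le> R" unfolding bounded_iff by blast
  then have R: "\<bar>qa t\<bar> \<le> R" "\<bar>qb t\<bar> \<le> R" if "t \<in> {0..t1}" for t using that by auto
  \<comment> \<open>The open interval \<open>Y\<close> contains both trajectories for the whole
    time, and its left end \<open>L\<close> stays at distance at least 1 from them.\<close>
  define L where "L = - R - 1"
  define Y where "Y = {L<..<R + 1}"
  define f where "f t x = integral {L..x} (\<rho> t)" for t x
  define g where "g x t = \<rho> t L * w t L - \<rho> t x * w t x" for x t
  have gc: "continuous_on {0..t1} (g x)" for x
    unfolding g_def by (intro continuous_intros ct \<rho> w)
  \<comment> \<open>The flux identity with left end \<open>L\<close> exhibits \<open>f\<close> as a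
    time integral of a continuous function, so \<open>f\<close> is differentiable in
    \<open>t\<close>.\<close>
  have f_eq: "f t x = f 0 x + integral {0..t} (g x)" if "t \<in> {0..t1}" "x \<in> Y" for t x
    using integral_unique[OF flux[OF that(1), of L x]] that(2) by (simp add: f_def g_def[abs_def] Y_def)
  have ft: "((\<lambda>t. f t x) has_derivative (\<lambda>h. g x t * h)) (at t within {0..t1})" if "t \<in> {0..t1}" "x \<in> Y" for t x
  proof -
    have "((\<lambda>t. f 0 x + integral {0..t} (g x)) has_real_derivative g x t) (at t within {0..t1})"
      by (auto intro!: derivative_eq_intros integral_has_real_derivative gc that)
    then have "((\<lambda>t. f t x) has_real_derivative g x t) (at t within {0..t1})"
      by (rule has_field_derivative_transform_within[where d=1]) (use that in \<open>auto simp: f_eq[symmetric]\<close>)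
    then show ?thesis by (simp add: has_field_derivative_def)
  qed
  have fx: "((\<lambda>x. f t x) has_derivative blinfun_apply (blinfun_scaleR_left (\<rho> t x))) (at x within Y)" if "t \<in> {0..t1}" "x \<in> Y" for t x
  proof -
    have "((\<lambda>x. f t x) has_real_derivative \<rho> t x) (at x within {L..R+1})"
      unfolding f_def using that(2) by (intro integral_has_real_derivative cx \<rho> that) (auto simp: Y_def)
    then have "((\<lambda>x. f t x) has_real_derivative \<rho> t x) (at x within Y)"
      by (rule DERIV_subset) (auto simp: Y_def)
    moreover have "blinfun_apply (blinfun_scaleR_left (\<rho> t x)) = (*) (\<rho> t x)" by auto
    ultimately show ?thesis by (simp add: has_field_derivative_def)
  qed
  have chain: "((\<lambda>t. f t (q t)) has_real_derivative \<rho> t L * w t L) (at t within {0..t1})"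
    if t: "t \<in> {0..t1}" and q: "\<And>t. t \<in> {0..t1} \<Longrightarrow> (q has_real_derivative w t (q t)) (at t within {0..t1})"
      and qY: "\<And>t. t \<in> {0..t1} \<Longrightarrow> q t \<in> Y" for t q
  proof -
    have rc: "((\<lambda>(t, x). \<rho> t x) \<longlongrightarrow> \<rho> t (q t)) (at (t, q t) within {0..t1} \<times> Y)"
      using \<rho> t unfolding continuous_on_def by (force intro: tendsto_within_subset)
    have "((\<lambda>(t, x). f t x) has_derivative (\<lambda>(ht, hx). g (q t) t * ht + blinfun_apply (blinfun_scaleR_left (\<rho> t (q t))) hx)) (at (t, q t) within {0..t1} \<times> Y)"
    \<comment> \<open>The rule asks for joint continuity of the space derivative only, and that
      derivative is \<open>\<rho>\<close>; in time, mere differentiability is enough.\<close>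
    proof (rule has_derivative_partialsI[where fy="\<lambda>t x. blinfun_scaleR_left (\<rho> t x)"])
      show "continuous (at (t, q t) within {0..t1} \<times> Y) (\<lambda>(t, x). blinfun_scaleR_left (\<rho> t x))"
        unfolding continuous_within
        using bounded_linear.tendsto[OF bounded_linear_blinfun_scaleR_left rc] by (simp add: case_prod_unfold)
    qed (use ft fx t qY in \<open>auto simp: Y_def\<close>)
    then have 1: "((\<lambda>(t, x). f t x) has_derivative (\<lambda>(ht, hx). g (q t) t * ht + blinfun_apply (blinfun_scaleR_left (\<rho> t (q t))) hx)) (at (t, q t) within (\<lambda>t. (t, q t)) ` {0..t1})"
      by (rule has_derivative_subset) (use qY in auto)
    have 2: "((\<lambda>t. (t, q t)) has_derivative (\<lambda>h. (h, w t (q t) * h))) (at t within {0..t1})"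
      using q[OF t] by (intro has_derivative_Pair has_derivative_ident) (simp add: has_field_derivative_def)
    from has_derivative_in_compose[OF 2 1]
    have "((\<lambda>t. f t (q t)) has_derivative (\<lambda>h. g (q t) t * h + (w t (q t) * h) *\<^sub>R \<rho> t (q t))) (at t within {0..t1})"
      by (simp add: blinfun_scaleR_left.rep_eq)
    \<comment> \<open>The outflow \<open>\<rho> w\<close> at the moving end cancels against
      \<open>\<rho>\<close> times the velocity of that end.\<close>
    moreover have "(\<lambda>h. g (q t) t * h + (w t (q t) * h) *\<^sub>R \<rho> t (q t)) = (*) (\<rho> t L * w t L)"
      by (auto simp: g_def algebra_simps)
    ultimately show ?thesis by (simp add: has_field_derivative_def)
  qed
  have Y: "qa t \<in> Y" "qb t \<in> Y" if "t \<in> {0..t1}" for t using R[OF that] by (auto simp: Y_def L_def)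
  have "\<exists>c. \<forall>t\<in>{0..t1}. f t (qb t) - f t (qa t) = c"
  proof (rule has_field_derivative_zero_constant)
    fix t assume t: "t \<in> {0..t1}"
    show "((\<lambda>t. f t (qb t) - f t (qa t)) has_real_derivative 0) (at t within {0..t1})"
      using DERIV_diff[OF chain[OF t qb Y(2)] chain[OF t qa Y(1)]] by simp
  qed simp
  then obtain c where c: "\<forall>t\<in>{0..t1}. f t (qb t) - f t (qa t) = c" by blast
  have I: "f t (qb t) - f t (qa t) = integral {qa t..qb t} (\<rho> t)" if t: "t \<in> {0..t1}" for t
  proof -
    have "integral {L..qa t} (\<rho> t) + integral {qa t..qb t} (\<rho> t) = integral {L..qb t} (\<rho> t)"
      using Y[OF t] ab[OF t] by (intro Henstock_Kurzweil_Integration.integral_combine integrable_continuous_real cx \<rho> t) (auto simp: Y_def)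
    then show ?thesis by (simp add: f_def)
  qed
  show ?thesis using c I[of t1] I[of 0] t1 by auto
qed

section \<open>Densities transported by a Lipschitz flow\<close>

lemma zero_mem_life_span: "0 < T \<Longrightarrow> 0 \<in> life_span T"
  by (simp add: life_span_def zero_ereal_def)

lemma Icc_subset_life_span: "t \<in> life_span T \<Longrightarrow> {0..t} \<subseteq> life_span T"
  by (auto simp: life_span_def) (metis ereal_less_eq(3) le_less_trans)

text \<open>The speed is treated as given, so that \<open>m\<close> and \<open>n\<close> become two
  densities carried by one flow. The bounds are required on each \<open>{0..t}\<close> only, since
  nothing is known to be uniform up to \<open>T\<close>.\<close>

locale lipschitz_flow =
  fixes T :: ereal and w :: "real \<Rightarrow> real \<Rightarrow> real" and q :: "real \<Rightarrow> real \<Rightarrow> real"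
  assumes speed_continuous: "continuous_on (life_span T \<times> UNIV) (\<lambda>(t, x). w t x)"
    and speed_bounded: "t \<in> life_span T \<Longrightarrow> \<exists>K. \<forall>\<tau>\<in>{0..t}. \<forall>x. \<bar>w \<tau> x\<bar> \<le> K"
    and speed_lipschitz: "t \<in> life_span T \<Longrightarrow> \<exists>L\<ge>0. \<forall>\<tau>\<in>{0..t}. \<forall>x y. \<bar>w \<tau> x - w \<tau> y\<bar> \<le> L * \<bar>x - y\<bar>"
    and flow_0: "q 0 x = x"
    and flow_deriv: "t \<in> life_span T \<Longrightarrow> ((\<lambda>\<tau>. q \<tau> x) has_real_derivative w t (q t x)) (at t within life_span T)"
begin

lemma flow_deriv_Icc:
  assumes "t \<in> life_span T" "\<tau> \<in> {0..t}"
  shows "((\<lambda>\<tau>. q \<tau> x) has_real_derivative w \<tau> (q \<tau> x)) (at \<tau> within {0..t})"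
  using Icc_subset_life_span[OF assms(1)] assms(2) by (intro DERIV_subset[OF flow_deriv]) auto

lemma flow_deriv_at:
  assumes "t \<in> life_span T" "0 < \<tau>" "\<tau> < t"
  shows "((\<lambda>\<tau>. q \<tau> x) has_real_derivative w \<tau> (q \<tau> x)) (at \<tau>)"
  using flow_deriv_Icc[OF assms(1), of \<tau>] assms at_within_interior[of \<tau> "{0..t}"] by simp

lemma flow_continuous_in_time: "t \<in> life_span T \<Longrightarrow> continuous_on {0..t} (\<lambda>\<tau>. q \<tau> x)"
  by (rule DERIV_continuous_on[OF flow_deriv_Icc])

lemma flow_separation:
  assumes t: "t \<in> life_span T"
  obtains L where "L \<ge> 0"
    "\<And>\<tau> x y. \<tau> \<in> {0..t} \<Longrightarrow> \<bar>w \<tau> x - w \<tau> y\<bar> \<le> L * \<bar>x - y\<bar>"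
    "\<And>\<tau> x y. \<tau> \<in> {0..t} \<Longrightarrow> \<bar>q \<tau> x - q \<tau> y\<bar> \<le> \<bar>x - y\<bar> * exp (L * \<tau>)"
    "\<And>\<tau> x y. \<tau> \<in> {0..t} \<Longrightarrow> \<bar>x - y\<bar> * exp (- L * \<tau>) \<le> \<bar>q \<tau> x - q \<tau> y\<bar>"
proof -
  obtain L where L: "L \<ge> 0" "\<forall>\<tau>\<in>{0..t}. \<forall>x y. \<bar>w \<tau> x - w \<tau> y\<bar> \<le> L * \<bar>x - y\<bar>"
    using speed_lipschitz[OF t] by blast
  have *: "\<bar>q \<tau> x - q \<tau> y\<bar> \<le> \<bar>x - y\<bar> * exp (L * \<tau>)" "\<bar>x - y\<bar> * exp (- L * \<tau>) \<le> \<bar>q \<tau> x - q \<tau> y\<bar>"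
    if tau: "\<tau> \<in> {0..t}" for \<tau> x y
  proof -
    have tauJ: "\<tau> \<in> life_span T" using Icc_subset_life_span[OF t] tau by blast
    have c: "continuous_on {0..\<tau>} (\<lambda>\<tau>. q \<tau> x - q \<tau> y)"
      by (intro continuous_on_diff flow_continuous_in_time tauJ)
    have d: "((\<lambda>\<tau>. q \<tau> x - q \<tau> y) has_real_derivative w r (q r x) - w r (q r y)) (at r)" if "0 < r" "r < \<tau>" for r
      by (intro DERIV_diff flow_deriv_at[OF tauJ] that)
    have l: "\<bar>w r (q r x) - w r (q r y)\<bar> \<le> L * \<bar>q r x - q r y\<bar>" if "0 < r" "r < \<tau>" for r
      using L(2) that tau by auto
    show "\<bar>q \<tau> x - q \<tau> y\<bar> \<le> \<bar>x - y\<bar> * exp (L * \<tau>)" "\<bar>x - y\<bar> * exp (- L * \<tau>) \<le> \<bar>q \<tau> x - q \<tau> y\<bar>"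
      using exponential_growth_bounds[OF _ c d l] tau by (simp_all add: flow_0)
  qed
  show ?thesis by (rule that[of L]) (use L * in auto)
qed

text \<open>Two trajectories could only change order by meeting, by the intermediate value theorem,
  and the lower separation bound excludes a meeting.\<close>

lemma flow_strict_mono:
  assumes t: "t \<in> life_span T"
  shows "strict_mono (q t)"
proof (rule strict_monoI, rule ccontr)
  fix a b :: real assume ab: "a < b" and "\<not> q t a < q t b"
  obtain L where L: "\<And>\<tau> x y. \<tau> \<in> {0..t} \<Longrightarrow> \<bar>x - y\<bar> * exp (- L * \<tau>) \<le> \<bar>q \<tau> x - q \<tau> y\<bar>"
    using flow_separation[OF t] by metis
  have "\<exists>\<tau>. 0 \<le> \<tau> \<and> \<tau> \<le> t \<and> q \<tau> b - q \<tau> a = 0"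
  proof (rule IVT2')
    show "continuous_on {0..t} (\<lambda>\<tau>. q \<tau> b - q \<tau> a)"
      by (rule continuous_on_diff) (rule flow_continuous_in_time[OF t])+
  qed (use \<open>\<not> q t a < q t b\<close> ab t in \<open>auto simp: flow_0 life_span_def\<close>)
  then obtain \<tau> where tau: "\<tau> \<in> {0..t}" "q \<tau> b - q \<tau> a = 0" by auto
  have "0 < \<bar>b - a\<bar> * exp (- L * \<tau>)" using ab by simp
  then show False using L[OF tau(1), of b a] tau(2) by simp
qed

lemma flow_less_iff: "t \<in> life_span T \<Longrightarrow> q t a < q t b \<longleftrightarrow> a < b"
  by (simp add: flow_strict_mono strict_mono_less)

lemma flow_le_iff: "t \<in> life_span T \<Longrightarrow> q t a \<le> q t b \<longleftrightarrow> a \<le> b"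
  by (simp add: flow_strict_mono strict_mono_less_eq)

lemma flow_continuous:
  assumes t: "t \<in> life_span T"
  shows "continuous_on UNIV (q t)"
proof -
  obtain L where L: "\<And>\<tau> x y. \<tau> \<in> {0..t} \<Longrightarrow> \<bar>q \<tau> x - q \<tau> y\<bar> \<le> \<bar>x - y\<bar> * exp (L * \<tau>)"
    using flow_separation[OF t] by metis
  have "(exp (L * t))-lipschitz_on UNIV (q t)"
    using L[of t] t by (intro lipschitz_onI) (auto simp: dist_real_def life_span_def mult.commute)
  then show ?thesis by (rule lipschitz_on_continuous_on)
qed

lemma flow_displacement:
  assumes t: "t \<in> life_span T"
  obtains K where "\<And>x. \<bar>q t x - x\<bar> \<le> K"
proof -
  have t0: "0 \<le> t" using t by (simp add: life_span_def)
  obtain K where K: "\<forall>\<tau>\<in>{0..t}. \<forall>x. \<bar>w \<tau> x\<bar> \<le> K" using speed_bounded[OF t] by blast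
  have "\<bar>q t x - x\<bar> \<le> K * t" for x
  proof -
    have "norm (q t x - q 0 x) \<le> K * norm (t - 0)"
      by (rule field_differentiable_bound[where S="{0..t}"])
         (use K t0 in \<open>auto intro: flow_deriv_Icc[OF t, simplified]\<close>)
    then show ?thesis using t0 by (simp add: flow_0)
  qed
  then show ?thesis by (rule that)
qed

text \<open>The displacement at time \<open>t\<close> is bounded by one constant \<open>K\<close>,
  so the intermediate value theorem applies on \<open>{y - K..y + K}\<close>.\<close>

lemma flow_surj:
  assumes t: "t \<in> life_span T"
  obtains x where "q t x = y"
proof -
  obtain K where K: "\<And>x. \<bar>q t x - x\<bar> \<le> K" using flow_displacement[OF t] by blast
  have K0: "K \<ge> 0" using K[of 0] by linarith
  have "\<exists>x. y - K \<le> x \<and> x \<le> y + K \<and> q t x = y"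
  proof (rule IVT')
    show "q t (y - K) \<le> y" using K[of "y - K"] by linarith
    show "y \<le> q t (y + K)" using K[of "y + K"] by linarith
    show "continuous_on {y - K..y + K} (q t)" by (rule continuous_on_subset[OF flow_continuous[OF t]]) simp
  qed (use K0 in simp)
  then show ?thesis using that by blast
qed

end

text \<open>The differential equation enters only through \<open>flux\<close>, its integrated form
  with fixed end points.\<close>

locale transported_density = lipschitz_flow +
  fixes \<rho> :: "real \<Rightarrow> real \<Rightarrow> real"
  assumes alive: "0 < T"
    and density_continuous: "continuous_on (life_span T \<times> UNIV) (\<lambda>(t, x). \<rho> t x)"
    and flux: "\<And>t a b. t \<in> life_span T \<Longrightarrow> a < b \<Longrightarrow>
      ((\<lambda>\<tau>. \<rho> \<tau> a * w \<tau> a - \<rho> \<tau> b * w \<tau> b) has_integral (integral {a..b} (\<rho> t) - integral {a..b} (\<rho> 0))) {0..t}"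
    and initial_nonneg: "\<And>x. \<rho> 0 x \<ge> 0"
    and initial_integrable: "integrable lborel (\<rho> 0)"
begin

lemma density_continuous_in_space:
  assumes "t \<in> life_span T" shows "continuous_on S (\<rho> t)"
proof -
  have "continuous_on S (\<lambda>x. case (t, x) of (t, x) \<Rightarrow> \<rho> t x)"
    by (rule continuous_on_compose2[OF density_continuous]) (use assms in \<open>auto intro!: continuous_intros\<close>)
  then show ?thesis by simp
qed

lemma density_measurable: "t \<in> life_span T \<Longrightarrow> \<rho> t \<in> borel_measurable borel"
  by (intro borel_measurable_continuous_onI density_continuous_in_space)

lemma flow_measurable: "t \<in> life_span T \<Longrightarrow> q t \<in> borel_measurable borel"
  by (intro borel_measurable_continuous_onI flow_continuous)

lemma mass_conservation:
  assumes t: "t \<in> life_span T" and "a \<le> b"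
  shows "integral {q t a..q t b} (\<rho> t) = integral {a..b} (\<rho> 0)"
proof -
  note J = Icc_subset_life_span[OF t]
  have "integral {q t a..q t b} (\<rho> t) = integral {q 0 a..q 0 b} (\<rho> 0)"
  proof (rule transport_mass)
    show "0 \<le> t" using t by (simp add: life_span_def)
    show "continuous_on ({0..t} \<times> UNIV) (\<lambda>(t, x). \<rho> t x)" "continuous_on ({0..t} \<times> UNIV) (\<lambda>(t, x). w t x)"
      by (rule continuous_on_subset[OF density_continuous] continuous_on_subset[OF speed_continuous]; use J in auto)+
    show "((\<lambda>\<tau>. \<rho> \<tau> a * w \<tau> a - \<rho> \<tau> b * w \<tau> b) has_integral integral {a..b} (\<rho> \<tau>) - integral {a..b} (\<rho> 0)) {0..\<tau>}"
      if "\<tau> \<in> {0..t}" "a < b" for \<tau> a b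
      using J that by (intro flux) auto
    show "((\<lambda>\<tau>. q \<tau> x) has_real_derivative w \<tau> (q \<tau> x)) (at \<tau> within {0..t})" if "\<tau> \<in> {0..t}" for \<tau> x
      by (rule flow_deriv_Icc[OF t that])
    show "((\<lambda>\<tau>. q \<tau> x) has_real_derivative w \<tau> (q \<tau> x)) (at \<tau> within {0..t})" if "\<tau> \<in> {0..t}" for \<tau> x
      by (rule flow_deriv_Icc[OF t that])
    show "q \<tau> a \<le> q \<tau> b" if "\<tau> \<in> {0..t}" for \<tau>
      using J that \<open>a \<le> b\<close> by (subst flow_le_iff) auto
  qed
  then show ?thesis by (simp add: flow_0)
qed

text \<open>A negative value would persist on \<open>{y..y + d/2}\<close> by continuity. This
  interval is the image of some \<open>{a..b}\<close>, whose initial mass is nonnegative and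
  conserved.\<close>

lemma density_nonneg:
  assumes t: "t \<in> life_span T"
  shows "\<rho> t y \<ge> 0"
proof (rule ccontr)
  assume neg: "\<not> \<rho> t y \<ge> 0"
  have "\<exists>d>0. \<forall>z\<in>UNIV. dist z y < d \<longrightarrow> dist (\<rho> t z) (\<rho> t y) < - \<rho> t y / 2"
    using density_continuous_in_space[OF t, of UNIV] neg unfolding continuous_on_iff by simp
  then obtain d where d: "d > 0" "\<And>z. \<bar>z - y\<bar> < d \<Longrightarrow> \<bar>\<rho> t z - \<rho> t y\<bar> < - \<rho> t y / 2"
    by (auto simp: dist_real_def)
  obtain a b where ab: "q t a = y" "q t b = y + d/2" using flow_surj[OF t] by metis
  have "q t a < q t b" using ab d by simp
  then have "a \<le> b" using flow_less_iff[OF t] by auto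
  have "0 \<le> integral {a..b} (\<rho> 0)"
    by (intro Henstock_Kurzweil_Integration.integral_nonneg integrable_continuous_real density_continuous_in_space zero_mem_life_span alive initial_nonneg)
  also have "\<dots> = integral {y..y + d/2} (\<rho> t)"
    using mass_conservation[OF t \<open>a \<le> b\<close>] ab by simp
  also have "\<dots> \<le> integral {y..y + d/2} (\<lambda>_. \<rho> t y / 2)"
  proof (intro integral_le integrable_continuous_real density_continuous_in_space[OF t] continuous_intros)
    fix z assume "z \<in> {y..y + d/2}"
    then have "\<bar>\<rho> t z - \<rho> t y\<bar> < - \<rho> t y / 2" using d by (intro d(2)) auto
    then show "\<rho> t z \<le> \<rho> t y / 2" by linarith
  qed
  also have "\<dots> < 0" using d neg by (simp add: mult_less_0_iff)
  finally show False by simp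
qed

lemma emeasure_density_Ioc:
  assumes t: "t \<in> life_span T" and "a \<le> b"
  shows "emeasure (density lborel (\<lambda>x. ennreal (\<rho> t x))) {a<..b} = ennreal (integral {a..b} (\<rho> t))"
proof -
  note [measurable] = density_measurable[OF t]
  have si: "set_integrable lborel {a..b} (\<rho> t)"
    by (intro borel_integrable_atLeastAtMost' density_continuous_in_space t)
  have "emeasure (density lborel (\<lambda>x. ennreal (\<rho> t x))) {a<..b} = (\<integral>\<^sup>+x. ennreal (\<rho> t x) * indicator {a<..b} x \<partial>lborel)"
    by (rule emeasure_density) auto
  also have "\<dots> = (\<integral>\<^sup>+x. ennreal (indicator {a..b} x *\<^sub>R \<rho> t x) \<partial>lborel)"
    using AE_lborel_singleton[of a]
    by (intro nn_integral_cong_AE) (auto elim!: eventually_mono simp: indicator_def)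
  also have "\<dots> = ennreal (LINT x:{a..b}|lborel. \<rho> t x)"
    unfolding set_lebesgue_integral_def using si density_nonneg[OF t]
    by (intro nn_integral_eq_integral) (auto simp: set_integrable_def)
  also have "(LINT x:{a..b}|lborel. \<rho> t x) = integral {a..b} (\<rho> t)"
    by (rule set_borel_integral_eq_integral(2)[OF si])
  finally show ?thesis .
qed

text \<open>Open right rays determine the measures because the total initial mass is finite. A ray
  starting at a trajectory is exhausted by intervals between trajectories; by mass conservation its
  measure is the same supremum at time 0 and at time \<open>t\<close>.\<close>

lemma pushforward:
  assumes t: "t \<in> life_span T"
  shows "distr (density lborel (\<lambda>x. ennreal (\<rho> 0 x))) borel (q t) = density lborel (\<lambda>x. ennreal (\<rho> t x))"
proof -
  define \<mu> where "\<mu> s = density lborel (\<lambda>x. ennreal (\<rho> s x))" for s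
  have J0: "0 \<in> life_span T" by (rule zero_mem_life_span[OF alive])
  note [measurable] = density_measurable[OF t] density_measurable[OF J0] flow_measurable[OF t]
  have sets: "sets (\<mu> s) = sets borel" for s by (simp add: \<mu>_def)
  have tail: "emeasure (\<mu> s) {q s x<..} = (SUP n. ennreal (integral {x..x + real n} (\<rho> 0)))" if s: "s \<in> life_span T" for s x
  proof -
    have "{q s x<..} = (\<Union>n. {q s x<..q s (x + real n)})"
    proof (safe)
      fix y assume "q s x < y"
      obtain z where z: "q s z = y" using flow_surj[OF s] by blast
      obtain n where "z - x \<le> real n" using real_arch_simple by blast
      then have "y \<le> q s (x + real n)" using z flow_le_iff[OF s] by auto
      then show "y \<in> (\<Union>n. {q s x<..q s (x + real n)})" using \<open>q s x < y\<close> by auto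
    qed auto
    also have "emeasure (\<mu> s) \<dots> = (SUP n. emeasure (\<mu> s) {q s x<..q s (x + real n)})"
    proof (rule SUP_emeasure_incseq[symmetric])
      show "incseq (\<lambda>n. {q s x<..q s (x + real n)})"
      proof (rule incseq_SucI)
        fix n
        have "q s (x + real n) \<le> q s (x + real (Suc n))" by (simp add: flow_le_iff[OF s])
        then show "{q s x<..q s (x + real n)} \<subseteq> {q s x<..q s (x + real (Suc n))}" by auto
      qed
    qed (auto simp: sets)
    also have "\<dots> = (SUP n. ennreal (integral {x..x + real n} (\<rho> 0)))"
      using s by (simp add: \<mu>_def emeasure_density_Ioc mass_conservation flow_le_iff)
    finally show ?thesis .
  qed
  have "distr (\<mu> 0) borel (q t) = \<mu> t"
  proof (rule measure_eqI_lessThan)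
    show "sets (distr (\<mu> 0) borel (q t)) = sets borel" "sets (\<mu> t) = sets borel" by (simp_all add: sets)
    fix y
    obtain x where x: "q t x = y" using flow_surj[OF t] by blast
    have "emeasure (distr (\<mu> 0) borel (q t)) {y<..} = emeasure (\<mu> 0) (q t -` {y<..} \<inter> space (\<mu> 0))"
      by (rule emeasure_distr) (auto simp: \<mu>_def)
    also have "q t -` {y<..} \<inter> space (\<mu> 0) = {q 0 x<..}"
      using flow_less_iff[OF t] x by (auto simp: flow_0 \<mu>_def)
    also have "emeasure (\<mu> 0) {q 0 x<..} = emeasure (\<mu> t) {y<..}"
      using tail[OF J0, of x] tail[OF t, of x] x by simp
    finally show "emeasure (distr (\<mu> 0) borel (q t)) {y<..} = emeasure (\<mu> t) {y<..}" .
    have "emeasure (distr (\<mu> 0) borel (q t)) {y<..} \<le> emeasure (distr (\<mu> 0) borel (q t)) (space (distr (\<mu> 0) borel (q t)))"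
      by (rule emeasure_space)
    also have "\<dots> = emeasure (\<mu> 0) (space (\<mu> 0))"
      by (subst emeasure_distr) (auto simp: \<mu>_def)
    also have "\<dots> = (\<integral>\<^sup>+x. ennreal (\<rho> 0 x) \<partial>lborel)"
      unfolding \<mu>_def by (subst emeasure_density) auto
    also have "\<dots> < \<infinity>"
      using initial_integrable initial_nonneg by (subst nn_integral_eq_integral) auto
    finally show "emeasure (distr (\<mu> 0) borel (q t)) {y<..} < \<infinity>" .
  qed
  then show ?thesis by (simp add: \<mu>_def)
qed

text \<open>The substitution \<open>y = q t z\<close> is made through the image measure, so no
  derivative of \<open>q t\<close> enters.\<close>

lemma integral_along_flow:
  assumes t: "t \<in> life_span T" and [measurable]: "h \<in> borel_measurable borel"
  shows "(LINT y|lborel. \<rho> t y * h y) = (LINT z|lborel. \<rho> 0 z * h (q t z))"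
proof -
  have J0: "0 \<in> life_span T" by (rule zero_mem_life_span[OF alive])
  note [measurable] = density_measurable[OF t] density_measurable[OF J0] flow_measurable[OF t]
  have "(LINT y|lborel. \<rho> t y * h y) = integral\<^sup>L (density lborel (\<lambda>x. ennreal (\<rho> t x))) h"
    using density_nonneg[OF t] by (subst integral_density) auto
  also have "\<dots> = integral\<^sup>L (density lborel (\<lambda>x. ennreal (\<rho> 0 x))) (\<lambda>z. h (q t z))"
    unfolding pushforward[OF t, symmetric] by (rule integral_distr) auto
  also have "\<dots> = (LINT z|lborel. \<rho> 0 z * h (q t z))"
    using initial_nonneg by (subst integral_density) auto
  finally show ?thesis .
qed

end

section \<open>Exponential averages and the Jacobian along trajectories\<close>

lemma average_tendsto:
  fixes f :: "real \<Rightarrow> real"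
  assumes "continuous_on UNIV f"
  shows "((\<lambda>y. integral {c..y} f / (y - c)) \<longlongrightarrow> f c) (at_right c)"
proof -
  have "((\<lambda>y. integral {c..y} f) has_real_derivative f c) (at c within {c..c+1})"
    by (intro integral_has_real_derivative continuous_on_subset[OF assms]) auto
  then show ?thesis
    by (simp add: has_field_derivative_iff at_within_Icc_at_right)
qed

context transported_density
begin

text \<open>In these coordinates the density and the domain of integration are frozen at time 0, and
  time enters only through \<open>q t x - q t z\<close>. Values at different times become comparable
  under the integral sign.\<close>

lemma exp_right_along_flow:
  assumes t: "t \<in> life_span T"
  shows "exp_right (\<rho> t) (q t x) = (LINT z|lborel. \<rho> 0 z * (indicator {x..} z * exp (q t x - q t z)))"
proof -
  have "exp_right (\<rho> t) (q t x) = (LINT y|lborel. \<rho> t y * (indicator {q t x..} y * exp (q t x - y)))"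
    unfolding exp_right_def by (intro Bochner_Integration.integral_cong) auto
  also have "\<dots> = (LINT z|lborel. \<rho> 0 z * (indicator {q t x..} (q t z) * exp (q t x - q t z)))"
    by (rule integral_along_flow[OF t]) auto
  also have "\<dots> = (LINT z|lborel. \<rho> 0 z * (indicator {x..} z * exp (q t x - q t z)))"
    by (simp add: indicator_def flow_le_iff[OF t])
  finally show ?thesis .
qed

lemma exp_left_along_flow:
  assumes t: "t \<in> life_span T"
  shows "exp_left (\<rho> t) (q t x) = (LINT z|lborel. \<rho> 0 z * (indicator {..x} z * exp (q t z - q t x)))"
proof -
  have "exp_left (\<rho> t) (q t x) = (LINT y|lborel. \<rho> t y * (indicator {..q t x} y * exp (y - q t x)))"
    unfolding exp_left_def by (intro Bochner_Integration.integral_cong) auto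
  also have "\<dots> = (LINT z|lborel. \<rho> 0 z * (indicator {..q t x} (q t z) * exp (q t z - q t x)))"
    by (rule integral_along_flow[OF t]) auto
  also have "\<dots> = (LINT z|lborel. \<rho> 0 z * (indicator {..x} z * exp (q t z - q t x)))"
    by (simp add: indicator_def flow_le_iff[OF t])
  finally show ?thesis .
qed

lemma along_flow_integrable:
  assumes t: "t \<in> life_span T"
  shows "integrable lborel (\<lambda>z. \<rho> 0 z * (indicator {x..} z * exp (q t x - q t z)))"
    and "integrable lborel (\<lambda>z. \<rho> 0 z * (indicator {..x} z * exp (q t z - q t x)))"
  by (rule Bochner_Integration.integrable_bound[OF initial_integrable];
      use density_measurable[OF zero_mem_life_span[OF alive]] flow_measurable[OF t] in
      \<open>auto intro!: AE_I2 mult_left_le simp: abs_mult indicator_def flow_le_iff[OF t]\<close>)+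

text \<open>On the half-line the exponent \<open>q t x - q t z\<close> is nonpositive, so the
  exponential is at most 1, uniformly in \<open>t\<close>.\<close>

lemma exp_right_le_mass:
  assumes t: "t \<in> life_span T"
  shows "exp_right (\<rho> t) y \<le> (LINT z|lborel. \<rho> 0 z)"
proof -
  obtain x where x: "q t x = y" using flow_surj[OF t] by blast
  have "exp_right (\<rho> t) (q t x) \<le> (LINT z|lborel. \<rho> 0 z)"
    unfolding exp_right_along_flow[OF t]
    using initial_nonneg
    by (intro integral_mono along_flow_integrable initial_integrable t)
       (auto simp: indicator_def flow_le_iff[OF t] intro!: mult_left_le)
  then show ?thesis by (simp add: x)
qed

lemma exp_left_le_mass:
  assumes t: "t \<in> life_span T"
  shows "exp_left (\<rho> t) y \<le> (LINT z|lborel. \<rho> 0 z)"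
proof -
  obtain x where x: "q t x = y" using flow_surj[OF t] by blast
  have "exp_left (\<rho> t) (q t x) \<le> (LINT z|lborel. \<rho> 0 z)"
    unfolding exp_left_along_flow[OF t]
    using initial_nonneg
    by (intro integral_mono along_flow_integrable initial_integrable t)
       (auto simp: indicator_def flow_le_iff[OF t] intro!: mult_left_le)
  then show ?thesis by (simp add: x)
qed

lemma exp_right_nonneg: "t \<in> life_span T \<Longrightarrow> exp_right (\<rho> t) y \<ge> 0"
  and exp_left_nonneg: "t \<in> life_span T \<Longrightarrow> exp_left (\<rho> t) y \<ge> 0"
  unfolding exp_right_def exp_left_def using density_nonneg
  by (auto intro!: integral_nonneg_AE)

text \<open>Once the factor with \<open>q t x\<close> is taken out, only
  \<open>exp (- q t z)\<close> depends on time, and it can only shrink as the trajectories move to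
  the right.\<close>

lemma exp_right_decay:
  assumes s: "s \<in> life_span T" and t: "t \<in> life_span T" and le: "\<And>z. q s z \<le> q t z"
  shows "exp_right (\<rho> t) (q t x) \<le> exp (q t x - q s x) * exp_right (\<rho> s) (q s x)"
proof -
  have "exp_right (\<rho> t) (q t x) \<le> (LINT z|lborel. exp (q t x - q s x) * (\<rho> 0 z * (indicator {x..} z * exp (q s x - q s z))))"
    unfolding exp_right_along_flow[OF t]
  proof (intro integral_mono along_flow_integrable integrable_mult_right s t)
    fix z
    have "\<rho> 0 z * (indicator {x..} z * exp (q t x - q t z)) \<le> \<rho> 0 z * (indicator {x..} z * exp (q t x - q s z))"
      using le[of z] initial_nonneg[of z] by (intro mult_left_mono) auto
    also have "exp (q t x - q s z) = exp (q t x - q s x) * exp (q s x - q s z)" by (simp flip: exp_add)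
    finally show "\<rho> 0 z * (indicator {x..} z * exp (q t x - q t z)) \<le> exp (q t x - q s x) * (\<rho> 0 z * (indicator {x..} z * exp (q s x - q s z)))"
      by (simp add: mult_ac)
  qed
  then show ?thesis by (simp add: exp_right_along_flow[OF s])
qed

lemma exp_left_growth:
  assumes s: "s \<in> life_span T" and t: "t \<in> life_span T" and le: "\<And>z. q s z \<le> q t z"
  shows "exp (q s x - q t x) * exp_left (\<rho> s) (q s x) \<le> exp_left (\<rho> t) (q t x)"
proof -
  have "(LINT z|lborel. exp (q s x - q t x) * (\<rho> 0 z * (indicator {..x} z * exp (q s z - q s x)))) \<le> exp_left (\<rho> t) (q t x)"
    unfolding exp_left_along_flow[OF t]
  proof (intro integral_mono along_flow_integrable integrable_mult_right s t)
    fix z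
    have "exp (q s x - q t x) * exp (q s z - q s x) = exp (q s z - q t x)" by (simp flip: exp_add)
    then have "exp (q s x - q t x) * (\<rho> 0 z * (indicator {..x} z * exp (q s z - q s x))) = \<rho> 0 z * (indicator {..x} z * exp (q s z - q t x))"
      by (simp add: mult_ac)
    also have "\<dots> \<le> \<rho> 0 z * (indicator {..x} z * exp (q t z - q t x))"
      using le[of z] initial_nonneg[of z] by (intro mult_left_mono) auto
    finally show "exp (q s x - q t x) * (\<rho> 0 z * (indicator {..x} z * exp (q s z - q s x))) \<le> \<rho> 0 z * (indicator {..x} z * exp (q t z - q t x))" .
  qed
  then show ?thesis by (simp add: exp_left_along_flow[OF s])
qed

text \<open>Mass conservation on \<open>{x..b n}\<close> reads \<open>Q = P * R\<close>: initial
  average density equals present average density times stretching. The Lipschitz bound on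
  \<open>R\<close> keeps the limit of \<open>P\<close> positive, and then \<open>R = Q / P\<close>
  converges. Thus the stretching has a limit although only the densities are known to be
  continuous.\<close>

lemma flow_difference_quotient:
  fixes x :: real
  defines "b \<equiv> \<lambda>n. x + inverse (real (Suc n))"
  assumes t: "t \<in> life_span T" and pos: "\<rho> 0 x > 0"
  shows density_pos: "\<rho> t (q t x) > 0"
    and flow_quotient_tendsto: "(\<lambda>n. (q t (b n) - q t x) / (b n - x)) \<longlonglongrightarrow> \<rho> 0 x / \<rho> t (q t x)"
    and flow_filterlim: "filterlim (\<lambda>n. q t (b n)) (at_right (q t x)) sequentially"
proof -
  note J0 = zero_mem_life_span[OF alive]
  have b: "b n > x" for n by (simp add: b_def)
  have bx: "b \<longlonglongrightarrow> x" using LIMSEQ_inverse_real_of_nat_add[of x] by (simp add: b_def)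
  have bl: "filterlim b (at_right x) sequentially"
    by (rule tendsto_imp_filterlim_at_right[OF bx]) (simp add: b)
  have "isCont (q t) x" using flow_continuous[OF t] by (simp add: continuous_on_eq_continuous_at)
  from isCont_tendsto_compose[OF this bx] have "(\<lambda>n. q t (b n)) \<longlonglongrightarrow> q t x" .
  then show qb: "filterlim (\<lambda>n. q t (b n)) (at_right (q t x)) sequentially"
    by (rule tendsto_imp_filterlim_at_right) (simp add: b flow_less_iff[OF t])
  define Q where "Q n = integral {x..b n} (\<rho> 0) / (b n - x)" for n
  define P where "P n = integral {q t x..q t (b n)} (\<rho> t) / (q t (b n) - q t x)" for n
  define R where "R n = (q t (b n) - q t x) / (b n - x)" for n
  have Q: "Q \<longlonglongrightarrow> \<rho> 0 x"
    unfolding Q_def[abs_def] by (rule filterlim_compose[OF average_tendsto[OF density_continuous_in_space[OF J0]] bl])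
  have P: "P \<longlonglongrightarrow> \<rho> t (q t x)"
    unfolding P_def[abs_def] by (rule filterlim_compose[OF average_tendsto[OF density_continuous_in_space[OF t]] qb])
  have qpos: "q t (b n) - q t x > 0" for n using b flow_less_iff[OF t] by simp
  have QPR: "Q n = P n * R n" for n
    using qpos[of n] mass_conservation[OF t, of x "b n"] b[of n] by (simp add: Q_def P_def R_def)
  obtain L where L: "\<And>\<tau> x y. \<tau> \<in> {0..t} \<Longrightarrow> \<bar>q \<tau> x - q \<tau> y\<bar> \<le> \<bar>x - y\<bar> * exp (L * \<tau>)"
    using flow_separation[OF t] by metis
  have R: "R n \<le> exp (L * t)" for n
    using L[of t "b n" x] t b[of n] qpos[of n] by (simp add: R_def life_span_def divide_le_eq mult.commute)
  have P0: "P n \<ge> 0" for n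
    unfolding P_def using qpos[of n] density_nonneg[OF t]
    by (intro divide_nonneg_pos Henstock_Kurzweil_Integration.integral_nonneg integrable_continuous_real density_continuous_in_space t) auto
  have "\<rho> 0 x \<le> \<rho> t (q t x) * exp (L * t)"
    by (rule tendsto_le[OF _ tendsto_mult_right[OF P] Q]) (use R P0 QPR in \<open>auto intro!: mult_left_mono always_eventually\<close>)
  then show pos': "\<rho> t (q t x) > 0"
    using pos by (metis exp_gt_zero less_le_trans zero_less_mult_pos2)
  have "eventually (\<lambda>n. P n > 0) sequentially" by (rule order_tendstoD(1)[OF P pos'])
  then have "eventually (\<lambda>n. Q n / P n = R n) sequentially"
    by eventually_elim (simp add: QPR)
  with tendsto_divide[OF Q P] pos' show "(\<lambda>n. (q t (b n) - q t x) / (b n - x)) \<longlonglongrightarrow> \<rho> 0 x / \<rho> t (q t x)"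
    unfolding R_def by (simp add: tendsto_cong)
qed

text \<open>The quotient \<open>\<rho> 0 x / \<rho> t (q t x)\<close> is the Jacobian \<open>q\<^sub>x\<close> of the flow.\<close>

lemma jacobian_integral:
  assumes t: "t \<in> life_span T" and pos: "\<rho> 0 x > 0"
    and w': "\<And>\<tau> y. \<tau> \<in> life_span T \<Longrightarrow> (w \<tau> has_real_derivative w' \<tau> y) (at y)"
  shows "((\<lambda>\<tau>. w' \<tau> (q \<tau> x) * (\<rho> 0 x / \<rho> \<tau> (q \<tau> x))) has_integral (\<rho> 0 x / \<rho> t (q t x) - 1)) {0..t}"
proof -
  define b where "b n = x + inverse (real (Suc n))" for n
  have b: "b n > x" for n by (simp add: b_def)
  note J = Icc_subset_life_span[OF t]
  have t0: "0 \<le> t" using t by (simp add: life_span_def)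
  obtain L where L: "L \<ge> 0" "\<And>\<tau> x y. \<tau> \<in> {0..t} \<Longrightarrow> \<bar>w \<tau> x - w \<tau> y\<bar> \<le> L * \<bar>x - y\<bar>"
    "\<And>\<tau> x y. \<tau> \<in> {0..t} \<Longrightarrow> \<bar>q \<tau> x - q \<tau> y\<bar> \<le> \<bar>x - y\<bar> * exp (L * \<tau>)"
    using flow_separation[OF t] by metis
  show ?thesis
  proof (rule has_integral_dominated_convergence)
    \<comment> \<open>Difference quotients in \<open>x\<close> of the flow equation are integrated
      in time before \<open>n\<close> tends to infinity, so the Jacobian is never differentiated in
      time.\<close>
    show "((\<lambda>\<tau>. (w \<tau> (q \<tau> (b n)) - w \<tau> (q \<tau> x)) / (b n - x)) has_integral
        ((q t (b n) - q t x) / (b n - x) - (q 0 (b n) - q 0 x) / (b n - x))) {0..t}" for n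
    proof (rule fundamental_theorem_of_calculus[OF t0])
      fix \<tau> assume tau: "\<tau> \<in> {0..t}"
      show "((\<lambda>\<tau>. (q \<tau> (b n) - q \<tau> x) / (b n - x)) has_vector_derivative (w \<tau> (q \<tau> (b n)) - w \<tau> (q \<tau> x)) / (b n - x)) (at \<tau> within {0..t})"
        unfolding has_real_derivative_iff_has_vector_derivative[symmetric]
        by (intro DERIV_cdivide DERIV_diff flow_deriv_Icc[OF t tau])
    qed
    \<comment> \<open>The majorant combines the Lipschitz constant of the speed with the largest
      possible growth of the separation up to time \<open>t\<close>.\<close>
    show "(\<lambda>\<tau>::real. L * exp (L * t)) integrable_on {0..t}" by (rule integrable_const_ivl)
    show "\<forall>\<tau>\<in>{0..t}. norm ((w \<tau> (q \<tau> (b n)) - w \<tau> (q \<tau> x)) / (b n - x)) \<le> L * exp (L * t)" for n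
    proof
      fix \<tau> assume tau: "\<tau> \<in> {0..t}"
      have "\<bar>w \<tau> (q \<tau> (b n)) - w \<tau> (q \<tau> x)\<bar> \<le> L * \<bar>q \<tau> (b n) - q \<tau> x\<bar>" by (rule L(2)[OF tau])
      also have "\<dots> \<le> L * (\<bar>b n - x\<bar> * exp (L * \<tau>))" by (intro mult_left_mono L tau)
      also have "\<dots> \<le> L * (\<bar>b n - x\<bar> * exp (L * t))" using tau L(1) by (intro mult_left_mono) (auto intro!: mult_left_mono)
      finally show "norm ((w \<tau> (q \<tau> (b n)) - w \<tau> (q \<tau> x)) / (b n - x)) \<le> L * exp (L * t)"
        using b[of n] by (simp add: divide_le_eq mult_ac)
    qed
    show "\<forall>\<tau>\<in>{0..t}. (\<lambda>n. (w \<tau> (q \<tau> (b n)) - w \<tau> (q \<tau> x)) / (b n - x)) \<longlonglongrightarrow> w' \<tau> (q \<tau> x) * (\<rho> 0 x / \<rho> \<tau> (q \<tau> x))"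
    proof
      fix \<tau> assume "\<tau> \<in> {0..t}"
      then have tau: "\<tau> \<in> life_span T" using J by blast
      have fl: "filterlim (\<lambda>n. q \<tau> (b n)) (at (q \<tau> x)) sequentially"
        using flow_filterlim[OF tau pos] unfolding b_def[symmetric]
        by (rule filterlim_mono) (auto intro: at_le)
      have "((\<lambda>y. (w \<tau> y - w \<tau> (q \<tau> x)) / (y - q \<tau> x)) \<longlongrightarrow> w' \<tau> (q \<tau> x)) (at (q \<tau> x))"
        using w'[OF tau] by (simp add: has_field_derivative_iff)
      from filterlim_compose[OF this fl]
      have "(\<lambda>n. (w \<tau> (q \<tau> (b n)) - w \<tau> (q \<tau> x)) / (q \<tau> (b n) - q \<tau> x)) \<longlonglongrightarrow> w' \<tau> (q \<tau> x)" .
      from tendsto_mult[OF this flow_quotient_tendsto[OF tau pos, folded b_def]]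
      have "(\<lambda>n. (w \<tau> (q \<tau> (b n)) - w \<tau> (q \<tau> x)) / (q \<tau> (b n) - q \<tau> x) * ((q \<tau> (b n) - q \<tau> x) / (b n - x))) \<longlonglongrightarrow> w' \<tau> (q \<tau> x) * (\<rho> 0 x / \<rho> \<tau> (q \<tau> x))" .
      moreover have "q \<tau> (b n) - q \<tau> x \<noteq> 0" for n
        using b[of n] flow_less_iff[OF tau, of x "b n"] by simp
      ultimately show "(\<lambda>n. (w \<tau> (q \<tau> (b n)) - w \<tau> (q \<tau> x)) / (b n - x)) \<longlonglongrightarrow> w' \<tau> (q \<tau> x) * (\<rho> 0 x / \<rho> \<tau> (q \<tau> x))"
        by simp
    qed
    have one: "(q 0 (b n) - q 0 x) / (b n - x) = 1" for n using b[of n] by (simp add: flow_0)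
    show "(\<lambda>n. (q t (b n) - q t x) / (b n - x) - (q 0 (b n) - q 0 x) / (b n - x)) \<longlonglongrightarrow> \<rho> 0 x / \<rho> t (q t x) - 1"
      unfolding one by (intro tendsto_diff tendsto_const flow_quotient_tendsto[OF t pos, folded b_def])
  qed
qed

end

section \<open>Blow-up\<close>

text \<open>A substitute for the derivative bound \<open>\<phi>' \<le> c * C\<close> when
  \<open>\<phi>\<close> is not known to be differentiable: \<open>Suc n\<close> equal steps are
  summed, and \<open>real (Suc n) * (exp (C * (t / real (Suc n))) - 1)\<close> tends to
  \<open>C * t\<close>.\<close>

lemma exponential_increments_imp_linear_growth:
  fixes \<phi> :: "real \<Rightarrow> real"
  assumes t: "0 \<le> t" and inc: "\<And>r s. 0 \<le> r \<Longrightarrow> r \<le> s \<Longrightarrow> s \<le> t \<Longrightarrow> \<phi> s - \<phi> r \<le> c * (exp (C * (s - r)) - 1)"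
  shows "\<phi> t - \<phi> 0 \<le> c * C * t"
proof -
  have "\<phi> t - \<phi> 0 \<le> real (Suc n) * (c * (exp (C * (t / real (Suc n))) - 1))" for n
  proof -
    define h where "h = t / real (Suc n)"
    have h: "h \<ge> 0" "real (Suc n) * h = t" using t by (simp_all add: h_def)
    have "\<phi> (real k * h) - \<phi> 0 \<le> real k * (c * (exp (C * h) - 1))" if "k \<le> Suc n" for k
      using that
    proof (induction k)
      case (Suc k)
      have "real (Suc k) * h \<le> real (Suc n) * h" using Suc.prems h by (intro mult_right_mono) auto
      then have "\<phi> (real (Suc k) * h) - \<phi> (real k * h) \<le> c * (exp (C * (real (Suc k) * h - real k * h)) - 1)"
        using h by (intro inc) (auto intro!: mult_right_mono)
      also have "real (Suc k) * h - real k * h = h" by (simp add: algebra_simps)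
      finally show ?case using Suc by (simp add: algebra_simps)
    qed simp
    from this[of "Suc n"] show ?thesis unfolding h(2) by (simp only: h_def order_refl)
  qed
  moreover have "(\<lambda>n. real (Suc n) * (c * (exp (C * (t / real (Suc n))) - 1))) \<longlonglongrightarrow> c * C * t"
  proof -
    have "(\<lambda>n. real (Suc n) * (exp (y / real (Suc n)) - 1)) \<longlonglongrightarrow> y" for y :: real
    proof (cases "y = 0")
      case False
      then show ?thesis by real_asymp
    qed simp
    from tendsto_mult_left[OF this, of c "C * t"] show ?thesis by (simp add: mult_ac)
  qed
  ultimately show ?thesis by (intro LIMSEQ_le_const) auto
qed

text \<open>Both averages are linear and do not increase the supremum norm. Closeness within
  \<open>e/2\<close> of the densities leaves room for the strict inequality.\<close>

lemma uniform_limit_exp_right_left: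
  fixes m :: "real \<Rightarrow> real \<Rightarrow> real"
  assumes lim: "uniform_limit UNIV m (m t) (at t within J)" and t: "t \<in> J"
    and cont: "\<And>t. t \<in> J \<Longrightarrow> continuous_on UNIV (m t)" and bdd: "\<And>t. t \<in> J \<Longrightarrow> \<exists>K. \<forall>x. \<bar>m t x\<bar> \<le> K"
  shows "uniform_limit UNIV (\<lambda>t. exp_right (m t)) (exp_right (m t)) (at t within J)"
    and "uniform_limit UNIV (\<lambda>t. exp_left (m t)) (exp_left (m t)) (at t within J)"
proof -
  have ev: "\<forall>\<^sub>F \<tau> in at t within J. \<forall>x. dist (exp_right (m \<tau>) x) (exp_right (m t) x) < e \<and> dist (exp_left (m \<tau>) x) (exp_left (m t) x) < e"
    if "e > 0" for e
  proof -
    have "\<forall>\<^sub>F \<tau> in at t within J. \<forall>x\<in>UNIV. dist (m \<tau> x) (m t x) < e/2"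
      using uniform_limitD[OF lim, of "e/2"] that by simp
    moreover have "\<forall>\<^sub>F \<tau> in at t within J. \<tau> \<in> J" by (simp add: eventually_at_filter)
    ultimately show ?thesis
    proof eventually_elim
      case (elim \<tau>)
      obtain K where K: "\<And>x. \<bar>m \<tau> x\<bar> \<le> K" using bdd[OF elim(2)] by blast
      obtain L where L: "\<And>x. \<bar>m t x\<bar> \<le> L" using bdd[OF t] by blast
      have c: "continuous_on UNIV (\<lambda>x. m \<tau> x - m t x)" by (intro continuous_intros cont elim t)
      have b: "\<bar>m \<tau> x - m t x\<bar> \<le> e/2" for x using elim(1) by (simp add: dist_real_def less_imp_le)
      show ?case
      proof
        fix x
        have "\<bar>exp_right (m \<tau>) x - exp_right (m t) x\<bar> \<le> e/2"
          using exp_right_bound[OF c b, of x] exp_right_diff[OF cont[OF elim(2)] K cont[OF t] L] by simp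
        moreover have "\<bar>exp_left (m \<tau>) x - exp_left (m t) x\<bar> \<le> e/2"
          using exp_left_bound[OF c b, of x] exp_left_diff[OF cont[OF elim(2)] K cont[OF t] L] by simp
        ultimately show "dist (exp_right (m \<tau>) x) (exp_right (m t) x) < e \<and> dist (exp_left (m \<tau>) x) (exp_left (m t) x) < e"
          using that by (simp add: dist_real_def)
      qed
    qed
  qed
  show "uniform_limit UNIV (\<lambda>t. exp_right (m t)) (exp_right (m t)) (at t within J)"
    "uniform_limit UNIV (\<lambda>t. exp_left (m t)) (exp_left (m t)) (at t within J)"
    by (rule uniform_limitI, rule eventually_mono[OF ev], assumption, blast)+
qed

text \<open>One density at a time, with abstract speed: the zero-order coefficient is the derivative
  \<open>w'\<close> of the speed in both equations, so the same statement serves \<open>m\<close>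
  and \<open>n\<close>.\<close>

lemma transported_density_of_weak_solution:
  assumes s: "s > 1/2" and flow: "lipschitz_flow T w q" and T: "0 < T"
    and Hs: "\<And>t. t \<in> life_span T \<Longrightarrow> \<rho> t \<in> Hs s"
    and cont: "sobolev_continuous s (life_span T) (\<lambda>t. distr_of (\<rho> t))"
    and C1: "sobolev_C1 (s - 1) (life_span T) (\<lambda>t. distr_of (\<rho> t)) D"
    and w': "\<And>t x. t \<in> life_span T \<Longrightarrow> (w t has_real_derivative w' t x) (at x)"
      "\<And>t. t \<in> life_span T \<Longrightarrow> continuous_on UNIV (w' t)" "\<And>t. t \<in> life_span T \<Longrightarrow> \<exists>K. \<forall>x. \<bar>w' t x\<bar> \<le> K"
    and eq: "\<And>t \<phi>. t \<in> life_span T \<Longrightarrow> \<phi> \<in> schwartz \<Longrightarrow>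
      D t \<phi> + distr_mult (w t) (distr_deriv (distr_of (\<rho> t))) \<phi> = distr_of (\<lambda>x. - w' t x * \<rho> t x) \<phi>"
    and init: "\<And>x. \<rho> 0 x \<ge> 0" "integrable lborel (\<rho> 0)"
  shows "transported_density T w q \<rho>"
proof -
  interpret lipschitz_flow T w q by (rule flow)
  have \<rho>c: "continuous_on UNIV (\<rho> t)" if "t \<in> life_span T" for t using Hs[OF that] by (simp add: Hs_def)
  have \<rho>b: "\<exists>K. \<forall>x. \<bar>\<rho> t x\<bar> \<le> K" if "t \<in> life_span T" for t by (rule Hs_bounded[OF s Hs[OF that]])
  have lim: "uniform_limit UNIV \<rho> (\<rho> t) (at t within life_span T)" if "t \<in> life_span T" for t
    by (rule Hs_continuous_imp_uniform_limit[OF s Hs cont that])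
  have wc: "continuous_on UNIV (w t)" if "t \<in> life_span T" for t
    using w'(1)[OF that] DERIV_isCont continuous_at_imp_continuous_on by blast
  show ?thesis
  proof unfold_locales
    show "continuous_on (life_span T \<times> UNIV) (\<lambda>(t, x). \<rho> t x)"
      by (rule uniform_limit_jointly_continuous[OF lim \<rho>c])
    fix t a b :: real assume t: "t \<in> life_span T" and ab: "a < b"
    note J = Icc_subset_life_span[OF t]
    obtain K where "K \<ge> 0" and K: "\<And>\<tau> x. \<tau> \<in> {0..t} \<Longrightarrow> \<bar>\<rho> \<tau> x\<bar> \<le> K"
      using uniform_limit_bounded_on_compact[OF lim \<rho>b compact_Icc J] by metis
    obtain L where L: "\<forall>\<tau>\<in>{0..t}. \<forall>x. \<bar>w \<tau> x\<bar> \<le> L" using speed_bounded[OF t] by blast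
    show "((\<lambda>\<tau>. \<rho> \<tau> a * w \<tau> a - \<rho> \<tau> b * w \<tau> b) has_integral integral {a..b} (\<rho> t) - integral {a..b} (\<rho> 0)) {0..t}"
    proof (rule flux_identity[OF _ ab])
      fix k \<tau> :: real assume k: "k > 0" and tau: "\<tau> \<in> {0..t}"
      then have tauJ: "\<tau> \<in> life_span T" using J by blast
      obtain B where B: "\<And>x. \<bar>\<rho> \<tau> x\<bar> \<le> B" using \<rho>b[OF tauJ] by blast
      obtain L' where L': "\<And>x. \<bar>w' \<tau> x\<bar> \<le> L'" using w'(3)[OF tauJ] by blast
      have \<phi>: "(\<lambda>x. complex_of_real (logistic_step k a b x)) \<in> schwartz"
        "vderiv (\<lambda>x. complex_of_real (logistic_step k a b x)) = (\<lambda>x. complex_of_real (logistic_kernel k a x - logistic_kernel k b x))"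
        using logistic_step_schwartz[OF k ab] by (simp_all add: logistic_step_def)
      have "D \<tau> (\<lambda>x. complex_of_real (logistic_step k a b x)) =
         complex_of_real (LINT x|lborel. \<rho> \<tau> x * w \<tau> x * (logistic_kernel k a x - logistic_kernel k b x))"
        using L tau by (intro transport_weak_form[OF \<rho>c[OF tauJ] B w'(1)[OF tauJ] _ borel_measurable_continuous_onI[OF w'(2)[OF tauJ]] L' \<phi> eq[OF tauJ \<phi>(1)]]) auto
      moreover have "((\<lambda>\<tau>. distr_of (\<rho> \<tau>) (\<lambda>x. complex_of_real (logistic_step k a b x))) has_vector_derivative
          D \<tau> (\<lambda>x. complex_of_real (logistic_step k a b x))) (at \<tau> within life_span T)"
        using s by (intro sobolev_C1_has_vector_derivative[OF C1 _ \<phi>(1) tauJ]) simp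
      ultimately have "((\<lambda>\<tau>. complex_of_real (LINT x|lborel. \<rho> \<tau> x * logistic_step k a b x)) has_vector_derivative
          complex_of_real (LINT x|lborel. \<rho> \<tau> x * w \<tau> x * (logistic_kernel k a x - logistic_kernel k b x))) (at \<tau> within life_span T)"
        by (simp add: distr_of_real)
      from bounded_linear.has_vector_derivative[OF bounded_linear_Re this]
      have "((\<lambda>\<tau>. LINT x|lborel. \<rho> \<tau> x * logistic_step k a b x) has_real_derivative
          (LINT x|lborel. \<rho> \<tau> x * w \<tau> x * (logistic_kernel k a x - logistic_kernel k b x))) (at \<tau> within life_span T)"
        by (simp add: has_real_derivative_iff_has_vector_derivative)
      then show "((\<lambda>\<tau>. LINT x|lborel. \<rho> \<tau> x * logistic_step k a b x) has_real_derivative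
          (LINT x|lborel. \<rho> \<tau> x * w \<tau> x * (logistic_kernel k a x - logistic_kernel k b x))) (at \<tau> within {0..t})"
        by (rule DERIV_subset) (rule J)
    qed (use J K L t \<rho>c wc in \<open>auto simp: life_span_def\<close>)
  qed (use init T in auto)
qed

text \<open>At the root \<open>r\<close> of the polynomial with \<open>e\<close>, the one with
  \<open>K < e\<close> is already negative; by continuity so it is slightly earlier. The hypothesis
  on \<open>a\<close> makes the discriminant positive and \<open>a\<close> negative, hence
  \<open>r > 0\<close>.\<close>

lemma blow_up_polynomial:
  fixes a e K :: real
  assumes a: "a < - sqrt (2 * e)" and e: "e > 0" and K: "K < e"
  defines "r \<equiv> - (a + sqrt (a\<^sup>2 - 2 * e)) / e"
  shows "0 < r" and "\<exists>t. 0 < t \<and> t < r \<and> 1 + a * t + K * t\<^sup>2 / 2 < 0"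
proof -
  have "sqrt (2 * e) > 0" using e by simp
  then have a0: "a < 0" using a by linarith
  have "(sqrt (2 * e))\<^sup>2 < (- a)\<^sup>2" using a \<open>sqrt (2 * e) > 0\<close> by (intro power_strict_mono) auto
  then have disc: "a\<^sup>2 - 2 * e > 0" using e by simp
  define d where "d = sqrt (a\<^sup>2 - 2 * e)"
  have d2: "d\<^sup>2 = a\<^sup>2 - 2 * e" using disc by (simp add: d_def)
  have "d < sqrt (a\<^sup>2)" unfolding d_def using e by (intro real_sqrt_less_mono) simp
  then have "d < - a" using a0 by simp
  then show r: "0 < r" unfolding r_def d_def[symmetric] using e by simp
  have "e * r = - (a + d)" unfolding r_def d_def[symmetric] using e by simp
  then have er: "d = - (e * r + a)" by simp
  have "e * (2 + 2 * a * r + e * r\<^sup>2) = 0" using d2 unfolding er by (simp add: power2_eq_square algebra_simps)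
  then have root: "1 + a * r + e * r\<^sup>2 / 2 = 0" using e by auto
  have "K * r\<^sup>2 < e * r\<^sup>2" using K r by simp
  then have neg: "1 + a * r + K * r\<^sup>2 / 2 < 0" using root by simp
  have "((\<lambda>t. 1 + a * t + K * t\<^sup>2 / 2) \<longlongrightarrow> 1 + a * r + K * r\<^sup>2 / 2) (at_left r)"
    by (intro tendsto_intros) auto
  then have "\<forall>\<^sub>F t in at_left r. 1 + a * t + K * t\<^sup>2 / 2 < 0" using neg by (rule order_tendstoD)
  moreover have "\<forall>\<^sub>F t in at_left r. t \<in> {0<..<r}" by (rule eventually_at_left_real[OF r])
  ultimately have "\<forall>\<^sub>F t in at_left r. 0 < t \<and> t < r \<and> 1 + a * t + K * t\<^sup>2 / 2 < 0"
    by eventually_elim auto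
  then show "\<exists>t. 0 < t \<and> t < r \<and> 1 + a * t + K * t\<^sup>2 / 2 < 0"
    using eventually_happens'[OF trivial_limit_at_left_real] by blast
qed

lemma solution_flow:
  assumes s: "s > 1/2" and T: "0 < T"
    and m: "\<forall>t\<in>life_span T. m t \<in> Hs s" "sobolev_continuous s (life_span T) (\<lambda>t. distr_of (m t))"
    and n: "\<forall>t\<in>life_span T. n t \<in> Hs s" "sobolev_continuous s (life_span T) (\<lambda>t. distr_of (n t))"
    and q: "is_flow T m n q"
  shows "lipschitz_flow T (\<lambda>t. speed (m t) (n t)) q"
    and "\<And>t x. t \<in> life_span T \<Longrightarrow> (speed (m t) (n t) has_real_derivative big_M (m t) (n t) x) (at x)"
    and "\<And>t. t \<in> life_span T \<Longrightarrow> continuous_on UNIV (big_M (m t) (n t))"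
    and "\<And>t. t \<in> life_span T \<Longrightarrow> \<exists>K. \<forall>x. \<bar>big_M (m t) (n t) x\<bar> \<le> K"
    and "\<And>t x. t \<in> life_span T \<Longrightarrow> speed (m t) (n t) x = exp_right (m t) x * exp_left (n t) x"
    and "\<And>t x. t \<in> life_span T \<Longrightarrow> big_M (m t) (n t) x = n t x * exp_right (m t) x - m t x * exp_left (n t) x"
proof -
  have c: "continuous_on UNIV (m t)" "continuous_on UNIV (n t)" if "t \<in> life_span T" for t
    using m(1) n(1) that by (auto simp: Hs_def)
  have b: "\<exists>K. \<forall>x. \<bar>m t x\<bar> \<le> K" "\<exists>K. \<forall>x. \<bar>n t x\<bar> \<le> K" if "t \<in> life_span T" for t
    using Hs_bounded[OF s] m(1) n(1) that by auto
  have lim: "uniform_limit UNIV m (m t) (at t within life_span T)" "uniform_limit UNIV n (n t) (at t within life_span T)"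
    if "t \<in> life_span T" for t
    using Hs_continuous_imp_uniform_limit[OF s _ m(2) that] Hs_continuous_imp_uniform_limit[OF s _ n(2) that] m(1) n(1) by auto
  have ul: "\<exists>K\<ge>0. \<forall>\<tau>\<in>{0..t}. \<forall>x. \<bar>m \<tau> x\<bar> \<le> K \<and> \<bar>n \<tau> x\<bar> \<le> K" if t: "t \<in> life_span T" for t
  proof -
    obtain K where "K \<ge> 0" and K: "\<And>\<tau> x. \<tau> \<in> {0..t} \<Longrightarrow> \<bar>m \<tau> x\<bar> \<le> K"
      using uniform_limit_bounded_on_compact[OF lim(1) b(1) compact_Icc Icc_subset_life_span[OF t]] by metis
    obtain L where "L \<ge> 0" and L: "\<And>\<tau> x. \<tau> \<in> {0..t} \<Longrightarrow> \<bar>n \<tau> x\<bar> \<le> L"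
      using uniform_limit_bounded_on_compact[OF lim(2) b(2) compact_Icc Icc_subset_life_span[OF t]] by metis
    show ?thesis
      by (rule exI[of _ "max K L"]) (use \<open>K \<ge> 0\<close> K L in \<open>auto simp: le_max_iff_disj\<close>)
  qed
  have local_eqs: "speed (m t) (n t) x = exp_right (m t) x * exp_left (n t) x"
    "big_M (m t) (n t) x = n t x * exp_right (m t) x - m t x * exp_left (n t) x"
    "(speed (m t) (n t) has_real_derivative big_M (m t) (n t) x) (at x)"
    "continuous_on UNIV (exp_right (m t))" "continuous_on UNIV (exp_left (n t))"
    if t: "t \<in> life_span T" for t x
  proof -
    obtain K L where K: "\<And>x. \<bar>m t x\<bar> \<le> K" and L: "\<And>x. \<bar>n t x\<bar> \<le> L" using b[OF t] by blast
    note ctx = c(1)[OF t] K c(2)[OF t] L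
    show "speed (m t) (n t) x = exp_right (m t) x * exp_left (n t) x" by (rule speed_eq[OF ctx])
    show "big_M (m t) (n t) x = n t x * exp_right (m t) x - m t x * exp_left (n t) x" by (rule big_M_eq[OF ctx])
    show "(speed (m t) (n t) has_real_derivative big_M (m t) (n t) x) (at x)" by (rule speed_has_derivative[OF ctx])
    show "continuous_on UNIV (exp_right (m t))"
      by (rule DERIV_continuous_on) (rule exp_right_has_derivative[OF c(1)[OF t] K])
    show "continuous_on UNIV (exp_left (n t))"
      by (rule DERIV_continuous_on) (rule exp_left_has_derivative[OF c(2)[OF t] L])
  qed
  have bounds: "\<bar>speed (m t) (n t) x\<bar> \<le> K * K" "\<bar>big_M (m t) (n t) x\<bar> \<le> 2 * (K * K)"
    if t: "t \<in> life_span T" and K: "\<forall>x. \<bar>m t x\<bar> \<le> K \<and> \<bar>n t x\<bar> \<le> K" for t x K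
  proof -
    have A: "\<bar>exp_right (m t) x\<bar> \<le> K" using K by (intro exp_right_bound c t) auto
    have B: "\<bar>exp_left (n t) x\<bar> \<le> K" using K by (intro exp_left_bound c t) auto
    have K0: "K \<ge> 0" using A by linarith
    show "\<bar>speed (m t) (n t) x\<bar> \<le> K * K"
      unfolding local_eqs(1)[OF t] abs_mult by (intro mult_mono A B K0) auto
    have "\<bar>big_M (m t) (n t) x\<bar> \<le> \<bar>n t x\<bar> * \<bar>exp_right (m t) x\<bar> + \<bar>m t x\<bar> * \<bar>exp_left (n t) x\<bar>"
      unfolding local_eqs(2)[OF t] by (metis abs_mult abs_triangle_ineq4)
    also have "\<dots> \<le> K * K + K * K" using K by (intro add_mono mult_mono A B K0) auto
    finally show "\<bar>big_M (m t) (n t) x\<bar> \<le> 2 * (K * K)" by simp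
  qed
  show sp: "speed (m t) (n t) x = exp_right (m t) x * exp_left (n t) x"
    and "(speed (m t) (n t) has_real_derivative big_M (m t) (n t) x) (at x)"
    and "big_M (m t) (n t) x = n t x * exp_right (m t) x - m t x * exp_left (n t) x"
    if "t \<in> life_span T" for t x
    using local_eqs[OF that] by auto
  show "continuous_on UNIV (big_M (m t) (n t))" if t: "t \<in> life_span T" for t
  proof -
    have "continuous_on UNIV (\<lambda>x. n t x * exp_right (m t) x - m t x * exp_left (n t) x)"
      by (intro continuous_intros c local_eqs t)
    then show ?thesis by (simp add: local_eqs(2)[OF t, symmetric])
  qed
  show "\<exists>K. \<forall>x. \<bar>big_M (m t) (n t) x\<bar> \<le> K" if t: "t \<in> life_span T" for t
  proof -
    obtain K where "\<forall>\<tau>\<in>{0..t}. \<forall>x. \<bar>m \<tau> x\<bar> \<le> K \<and> \<bar>n \<tau> x\<bar> \<le> K" using ul[OF t] by blast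
    moreover have "t \<in> {0..t}" using t by (simp add: life_span_def)
    ultimately show ?thesis using bounds(2)[OF t] by blast
  qed
  show "lipschitz_flow T (\<lambda>t. speed (m t) (n t)) q"
  proof
    have "continuous_on (life_span T \<times> UNIV) (\<lambda>p. (case p of (t, x) \<Rightarrow> exp_right (m t) x) * (case p of (t, x) \<Rightarrow> exp_left (n t) x))"
      using uniform_limit_exp_right_left(1)[OF lim(1) _ c(1) b(1)] uniform_limit_exp_right_left(2)[OF lim(2) _ c(2) b(2)]
      by (intro continuous_on_mult uniform_limit_jointly_continuous local_eqs) auto
    then show "continuous_on (life_span T \<times> UNIV) (\<lambda>(t, x). speed (m t) (n t) x)"
      by (rule continuous_on_eq) (auto simp: local_eqs(1))
    fix t assume t: "t \<in> life_span T"
    obtain K where K: "K \<ge> 0" "\<forall>\<tau>\<in>{0..t}. \<forall>x. \<bar>m \<tau> x\<bar> \<le> K \<and> \<bar>n \<tau> x\<bar> \<le> K" using ul[OF t] by blast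
    have J: "\<tau> \<in> life_span T" if "\<tau> \<in> {0..t}" for \<tau> using Icc_subset_life_span[OF t] that by blast
    show "\<exists>K. \<forall>\<tau>\<in>{0..t}. \<forall>x. \<bar>speed (m \<tau>) (n \<tau>) x\<bar> \<le> K"
      using bounds(1)[OF J] K(2) by (intro exI[of _ "K * K"]) blast
    show "\<exists>L\<ge>0. \<forall>\<tau>\<in>{0..t}. \<forall>x y. \<bar>speed (m \<tau>) (n \<tau>) x - speed (m \<tau>) (n \<tau>) y\<bar> \<le> L * \<bar>x - y\<bar>"
    proof (intro exI[of _ "2 * (K * K)"] conjI ballI allI)
      fix \<tau> x y assume tau: "\<tau> \<in> {0..t}"
      have "norm (speed (m \<tau>) (n \<tau>) x - speed (m \<tau>) (n \<tau>) y) \<le> 2 * (K * K) * norm (x - y)"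
        by (rule field_differentiable_bound[where S=UNIV])
           (use local_eqs(3)[OF J[OF tau]] bounds(2)[OF J[OF tau]] K(2) tau in auto)
      then show "\<bar>speed (m \<tau>) (n \<tau>) x - speed (m \<tau>) (n \<tau>) y\<bar> \<le> 2 * (K * K) * \<bar>x - y\<bar>" by simp
    qed (use K in simp)
  next
    show "q 0 x = x" for x using q by (simp add: is_flow_def)
    show "((\<lambda>\<tau>. q \<tau> x) has_real_derivative speed (m t) (n t) (q t x)) (at t within life_span T)" if "t \<in> life_span T" for t x
      using q that by (simp add: is_flow_def)
  qed
qed

text \<open>Since trajectories move to the right, \<open>exp (- q) * A\<close> decreases and \<open>exp q * B\<close> increases
  along the trajectory \<open>q\<close> of \<open>x\<close>.\<close>

lemma jacobian_upper_bound:
  fixes w w' :: "real \<Rightarrow> real \<Rightarrow> real"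
  assumes m: "transported_density T w q m" and n: "transported_density T w q n"
    and w': "\<And>t y. t \<in> life_span T \<Longrightarrow> (w t has_real_derivative w' t y) (at y)"
    and w: "\<And>t y. t \<in> life_span T \<Longrightarrow> w t y = exp_right (m t) y * exp_left (n t) y"
    and w'_eq: "\<And>t y. t \<in> life_span T \<Longrightarrow> w' t y = n t y * exp_right (m t) y - m t y * exp_left (n t) y"
    and pos: "m 0 x > 0" "n 0 x > 0" and t: "t \<in> life_span T"
  defines "H1 \<equiv> (LINT y|lborel. m 0 y)" and "H2 \<equiv> (LINT y|lborel. n 0 y)"
  shows "0 < 1 + w' 0 x * t + (n 0 x * H1 + m 0 x * H2) * (H1 * H2) * t\<^sup>2 / 2"
proof -
  interpret m: transported_density T w q m by (rule m)
  interpret n: transported_density T w q n by (rule n)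
  note J = Icc_subset_life_span[OF t]
  have t0: "0 \<le> t" using t by (simp add: life_span_def)
  have H: "H1 \<ge> 0" "H2 \<ge> 0" unfolding H1_def H2_def using m.initial_nonneg n.initial_nonneg by auto
  have w0: "0 \<le> w \<tau> y" "w \<tau> y \<le> H1 * H2" if "\<tau> \<in> life_span T" for \<tau> y
    unfolding w[OF that] H1_def H2_def
    using m.exp_right_nonneg[OF that] n.exp_left_nonneg[OF that] m.exp_right_le_mass[OF that] n.exp_left_le_mass[OF that] H
    by (auto intro!: mult_mono mult_nonneg_nonneg simp: H1_def H2_def)
  have mono: "q r y \<le> q s y" "q s y - q r y \<le> H1 * H2 * (s - r)" if rs: "0 \<le> r" "r \<le> s" "s \<le> t" for r s y
  proof -
    have c: "continuous_on {r..s} (\<lambda>\<tau>. q \<tau> y)"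
      by (rule continuous_on_subset[OF m.flow_continuous_in_time[OF t]]) (use rs in auto)
    have d: "((\<lambda>\<tau>. q \<tau> y) has_real_derivative w \<tau> (q \<tau> y)) (at \<tau>)" if "r < \<tau>" "\<tau> < s" for \<tau>
      by (rule m.flow_deriv_at[OF t]) (use rs that in auto)
    have j: "\<tau> \<in> life_span T" if "r < \<tau>" "\<tau> < s" for \<tau> using J rs that by auto
    show "q r y \<le> q s y"
      by (rule DERIV_nonneg_imp_increasing_open[OF rs(2) _ c]) (use d w0 j in blast)
    have "q s y - H1 * H2 * s \<le> q r y - H1 * H2 * r"
    proof (rule DERIV_nonpos_imp_decreasing_open[OF rs(2)])
      fix \<tau> assume tau: "r < \<tau>" "\<tau> < s"
      have "((\<lambda>\<tau>. q \<tau> y - H1 * H2 * \<tau>) has_real_derivative w \<tau> (q \<tau> y) - H1 * H2) (at \<tau>)"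
        by (auto intro!: derivative_eq_intros d[OF tau])
      then show "\<exists>d. ((\<lambda>\<tau>. q \<tau> y - H1 * H2 * \<tau>) has_real_derivative d) (at \<tau>) \<and> d \<le> 0"
        using w0(2)[OF j[OF tau], of "q \<tau> y"] by (intro exI conjI) auto
    qed (intro continuous_intros c)
    then show "q s y - q r y \<le> H1 * H2 * (s - r)" by (simp add: algebra_simps)
  qed
  define A where "A \<tau> = exp_right (m \<tau>) (q \<tau> x)" for \<tau>
  define B where "B \<tau> = exp_left (n \<tau>) (q \<tau> x)" for \<tau>
  define g where "g \<tau> = n 0 x * A \<tau> - m 0 x * B \<tau>" for \<tau>
  have gb: "g s - g r \<le> (n 0 x * H1 + m 0 x * H2) * (exp (H1 * H2 * (s - r)) - 1)" if rs: "0 \<le> r" "r \<le> s" "s \<le> t" for r s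
  proof -
    have j: "r \<in> life_span T" "s \<in> life_span T" using J rs by auto
    define d where "d = q s x - q r x"
    \<comment> \<open>As the speed is at most \<open>H1 * H2\<close>, this bounds
      \<open>exp d\<close> by a quantity that depends on elapsed time only.\<close>
    define E where "E = exp (H1 * H2 * (s - r))"
    have d: "0 \<le> d" "exp d \<le> E" using mono[OF rs, of x] by (auto simp: d_def E_def)
    have A: "0 \<le> A r" "A r \<le> H1" unfolding A_def H1_def by (intro m.exp_right_nonneg m.exp_right_le_mass j)+
    have B: "0 \<le> B r" "B r \<le> H2" unfolding B_def H2_def by (intro n.exp_left_nonneg n.exp_left_le_mass j)+
    have "A s \<le> exp d * A r"
      unfolding A_def d_def by (rule m.exp_right_decay[OF j mono(1)[OF rs]])
    then have "A s - A r \<le> (exp d - 1) * A r" by (simp add: algebra_simps)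
    also have "\<dots> \<le> (E - 1) * H1" using A d by (intro mult_mono) (auto intro: order_trans[OF _ d(2)])
    finally have A': "A s - A r \<le> (E - 1) * H1" .
    have "exp (- d) * B r \<le> B s"
      unfolding B_def d_def using n.exp_left_growth[OF j mono(1)[OF rs], of x] by simp
    then have "B r - B s \<le> (1 - exp (- d)) * B r" by (simp add: algebra_simps)
    also have "\<dots> \<le> (E - 1) * H2"
    proof (intro mult_mono B)
      \<comment> \<open>This gives \<open>1 - exp (- d) \<le> exp d - 1\<close>, so the loss in
        \<open>B\<close> is controlled by the same factor as the gain in \<open>A\<close>.\<close>
      have "2 \<le> exp d + exp (- d)"
        using cosh_real_ge_1[of d] by (simp add: cosh_def)
      then show "1 - exp (- d) \<le> E - 1" using d by simp
      show "0 \<le> E - 1" using d by (meson diff_ge_0_iff_ge one_le_exp_iff order_trans)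
    qed
    finally have B': "B r - B s \<le> (E - 1) * H2" .
    have "g s - g r = n 0 x * (A s - A r) + m 0 x * (B r - B s)" by (simp add: g_def algebra_simps)
    also have "\<dots> \<le> n 0 x * ((E - 1) * H1) + m 0 x * ((E - 1) * H2)"
      using pos by (intro add_mono mult_left_mono A' B') auto
    finally show ?thesis by (simp add: E_def algebra_simps)
  qed
  define K where "K = (n 0 x * H1 + m 0 x * H2) * (H1 * H2)"
  have g_le: "g \<tau> \<le> g 0 + K * \<tau>" if "\<tau> \<in> {0..t}" for \<tau>
    using exponential_increments_imp_linear_growth[of \<tau> g "n 0 x * H1 + m 0 x * H2" "H1 * H2"] gb that
    by (auto simp: K_def)
  \<comment> \<open>Both ratios are limits of the same difference quotients of the flow. One factor
    \<open>X\<close> therefore turns both current densities into their initial values.\<close>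
  have quot: "m 0 x / m \<tau> (q \<tau> x) = n 0 x / n \<tau> (q \<tau> x)" if "\<tau> \<in> life_span T" for \<tau>
    using LIMSEQ_unique[OF m.flow_quotient_tendsto[OF that pos(1)] n.flow_quotient_tendsto[OF that pos(2)]] .
  have "((\<lambda>\<tau>. w' \<tau> (q \<tau> x) * (m 0 x / m \<tau> (q \<tau> x))) has_integral (m 0 x / m t (q t x) - 1)) {0..t}"
    by (rule m.jacobian_integral[OF t pos(1) w'])
  moreover have "w' \<tau> (q \<tau> x) * (m 0 x / m \<tau> (q \<tau> x)) = g \<tau>" if "\<tau> \<in> {0..t}" for \<tau>
  proof -
    have j: "\<tau> \<in> life_span T" using J that by blast
    have p: "m \<tau> (q \<tau> x) > 0" "n \<tau> (q \<tau> x) > 0"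
      by (rule m.density_pos[OF j pos(1)] n.density_pos[OF j pos(2)])+
    define X where "X = m 0 x / m \<tau> (q \<tau> x)"
    have "m \<tau> (q \<tau> x) * X = m 0 x" unfolding X_def using p by simp
    moreover have "n \<tau> (q \<tau> x) * X = n 0 x" unfolding X_def quot[OF j] using p by simp
    ultimately have X: "m \<tau> (q \<tau> x) * X = m 0 x" "n \<tau> (q \<tau> x) * X = n 0 x" .
    have "w' \<tau> (q \<tau> x) * X = (n \<tau> (q \<tau> x) * X) * A \<tau> - (m \<tau> (q \<tau> x) * X) * B \<tau>"
      unfolding w'_eq[OF j] A_def B_def by (simp add: algebra_simps)
    then show ?thesis by (simp add: X g_def flip: X_def)
  qed
  ultimately have "(g has_integral (m 0 x / m t (q t x) - 1)) {0..t}"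
    by (rule has_integral_eq[rotated])
  moreover have "((\<lambda>\<tau>. g 0 + K * \<tau>) has_integral ((g 0 * t + K * t\<^sup>2 / 2) - (g 0 * 0 + K * 0\<^sup>2 / 2))) {0..t}"
    by (rule fundamental_theorem_of_calculus[OF t0])
       (auto intro!: derivative_eq_intros simp: has_real_derivative_iff_has_vector_derivative[symmetric])
  ultimately have "m 0 x / m t (q t x) - 1 \<le> (g 0 * t + K * t\<^sup>2 / 2) - (g 0 * 0 + K * 0\<^sup>2 / 2)"
    by (rule has_integral_le) (rule g_le)
  moreover have "m 0 x / m t (q t x) > 0" using m.density_pos[OF t pos(1)] pos by simp
  moreover have "g 0 = w' 0 x"
    using w'_eq[OF zero_mem_life_span[OF m.alive], of x] by (simp add: g_def A_def B_def m.flow_0)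
  ultimately show ?thesis by (simp add: K_def)
qed

theorem theorem4p3:
  fixes s x0 H1 H2 \<delta> T1 :: real and T :: ereal
    and m0 n0 :: "real \<Rightarrow> real" and m n q :: "real \<Rightarrow> real \<Rightarrow> real"
    and M N :: "real \<Rightarrow> real"
  assumes "s > 1/2"
    and "m0 \<in> Hs s" and "integrable lborel m0"
    and "n0 \<in> Hs s" and "integrable lborel n0"
    and "is_maximal_solution s m0 n0 T m n"
    and "\<And>x. m0 x \<ge> 0" and "\<And>x. n0 x \<ge> 0"
    and "m0 x0 > 0" and "n0 x0 > 0"
    and "is_flow T m n q"
  defines "M \<equiv> (\<lambda>t. big_M (m t) (n t) (q t x0))"
    and "N \<equiv> (\<lambda>t. m t (q t x0) + n t (q t x0))"
    and "H1 \<equiv> (LINT x|lborel. m0 x)"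
    and "H2 \<equiv> (LINT x|lborel. n0 x)"
    and "\<delta> \<equiv> 3/2 * (H1 + H2) ^ 3"
    and "T1 \<equiv> - (M 0 + sqrt ((M 0)\<^sup>2 - 2 * \<delta> * N 0)) / (\<delta> * N 0)"
  assumes "M 0 < - sqrt (2 * \<delta> * N 0)"
  shows "\<exists>T0::real. T = ereal T0 \<and> 0 < T0 \<and> T0 \<le> T1 \<and>
           (T0 = T1 \<longrightarrow> Liminf (at_left T0) (\<lambda>t. ereal ((T0 - t) * M t)) \<le> -1)"
proof -
  have T: "0 < T" and sol: "is_solution s m0 n0 T m n"
    using assms(6) by (auto simp: is_maximal_solution_def)
  have init: "m 0 = m0" "n 0 = n0"
    and Hs: "\<forall>t\<in>life_span T. m t \<in> Hs s" "\<forall>t\<in>life_span T. n t \<in> Hs s"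
    and cont: "sobolev_continuous s (life_span T) (\<lambda>t. distr_of (m t))" "sobolev_continuous s (life_span T) (\<lambda>t. distr_of (n t))"
    using sol by (auto simp: is_solution_def)
  obtain m' n' where C1: "sobolev_C1 (s - 1) (life_span T) (\<lambda>t. distr_of (m t)) m'"
      "sobolev_C1 (s - 1) (life_span T) (\<lambda>t. distr_of (n t)) n'"
    and eqs: "\<And>t \<phi>. t \<in> life_span T \<Longrightarrow> \<phi> \<in> schwartz \<Longrightarrow>
           m' t \<phi> + distr_mult (speed (m t) (n t)) (distr_deriv (distr_of (m t))) \<phi>
             = distr_of (\<lambda>x. - big_M (m t) (n t) x * m t x) \<phi>"
      "\<And>t \<phi>. t \<in> life_span T \<Longrightarrow> \<phi> \<in> schwartz \<Longrightarrow>
           n' t \<phi> + distr_mult (speed (m t) (n t)) (distr_deriv (distr_of (n t))) \<phi>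
             = distr_of (\<lambda>x. - big_M (m t) (n t) x * n t x) \<phi>"
    using sol unfolding is_solution_def by blast
  note flow = solution_flow[OF assms(1) T Hs(1) cont(1) Hs(2) cont(2) assms(11)]
  have tm: "transported_density T (\<lambda>t. speed (m t) (n t)) q m"
    using assms(3,7) Hs(1)
    by (intro transported_density_of_weak_solution[OF assms(1) flow(1) T _ cont(1) C1(1) flow(2-4) eqs(1)])
       (auto simp: init)
  have tn: "transported_density T (\<lambda>t. speed (m t) (n t)) q n"
    using assms(5,8) Hs(2)
    by (intro transported_density_of_weak_solution[OF assms(1) flow(1) T _ cont(2) C1(2) flow(2-4) eqs(2)])
       (auto simp: init)
  note T0 = zero_mem_life_span[OF T]
  interpret m: transported_density T "\<lambda>t. speed (m t) (n t)" q m by (rule tm)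
  interpret n: transported_density T "\<lambda>t. speed (m t) (n t)" q n by (rule tn)
  have H: "H1 \<ge> 0" "H2 \<ge> 0" unfolding H1_def H2_def using assms(7,8) by auto
  have N0: "N 0 = m0 x0 + n0 x0" by (simp add: N_def m.flow_0 init)
  have M0: "M 0 = big_M (m 0) (n 0) x0" by (simp add: M_def m.flow_0)
  have "\<delta> \<ge> 0" unfolding \<delta>_def using H by simp
  then have "M 0 < 0" using assms(18) N0 assms(9,10) by (smt (verit) real_sqrt_ge_zero zero_le_mult_iff)
  \<comment> \<open>A negative \<open>M 0\<close> must come from the term
    \<open>m 0 x0 * exp_left (n 0) x0\<close>, which the mass \<open>H2\<close> bounds. Positivity
    makes \<open>\<delta> * N 0\<close> positive and the next comparison strict.\<close>
  have "H2 > 0"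
  proof (rule ccontr)
    assume "\<not> H2 > 0"
    then have "exp_left (n 0) x0 \<le> 0" using n.exp_left_le_mass[OF T0, of x0] by (simp add: H2_def init)
    then have "m 0 x0 * exp_left (n 0) x0 \<le> 0" using assms(9) by (intro mult_nonneg_nonpos) (simp_all add: init)
    moreover have "0 \<le> n 0 x0 * exp_right (m 0) x0"
      using assms(10) by (intro mult_nonneg_nonneg m.exp_right_nonneg[OF T0]) (simp add: init)
    ultimately have "M 0 \<ge> 0" unfolding M0 flow(6)[OF T0] by linarith
    with \<open>M 0 < 0\<close> show False by simp
  qed
  define K where "K = (n0 x0 * H1 + m0 x0 * H2) * (H1 * H2)"
  \<comment> \<open>Each factor is enlarged crudely, \<open>H1 * H2\<close> to
    \<open>(H1 + H2)\<^sup>2\<close> and the other to \<open>N 0 * (H1 + H2)\<close>; the strict gap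
    comes from the factor 3/2 in \<open>\<delta>\<close>.\<close>
  have K: "K < \<delta> * N 0"
  proof -
    have S: "0 < H1 + H2" using H \<open>H2 > 0\<close> by simp
    have "n0 x0 * H1 + m0 x0 * H2 \<le> n0 x0 * (H1 + H2) + m0 x0 * (H1 + H2)"
      using H assms(9,10) by (intro add_mono mult_left_mono) auto
    then have "n0 x0 * H1 + m0 x0 * H2 \<le> N 0 * (H1 + H2)" by (simp add: N0 algebra_simps)
    moreover have "H1 * H2 \<le> (H1 + H2)\<^sup>2" using H by (simp add: power2_sum)
    ultimately have "K \<le> N 0 * (H1 + H2) * (H1 + H2)\<^sup>2"
      unfolding K_def using H S assms(9,10) by (intro mult_mono) (auto simp: N0)
    also have "\<dots> = N 0 * (H1 + H2) ^ 3" by (simp add: power2_eq_square power3_eq_cube)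
    also have "\<dots> < 3/2 * (N 0 * (H1 + H2) ^ 3)" using S assms(9,10) by (simp add: N0)
    finally show ?thesis by (simp add: \<delta>_def mult_ac)
  qed
  have "\<delta> * N 0 > 0" unfolding \<delta>_def using H \<open>H2 > 0\<close> assms(9,10) by (simp add: N0)
  note poly = blow_up_polynomial[OF _ this K, of "M 0"]
  have "0 < T1" and "\<exists>t. 0 < t \<and> t < T1 \<and> 1 + M 0 * t + K * t\<^sup>2 / 2 < 0"
    using poly assms(18) by (simp_all add: T1_def mult.assoc)
  then obtain t where t: "0 < t" "t < T1" "1 + M 0 * t + K * t\<^sup>2 / 2 < 0" by blast
  have "t \<notin> life_span T"
  proof
    assume "t \<in> life_span T"
    from jacobian_upper_bound[OF tm tn flow(2) flow(5) flow(6) _ _ this, of x0]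
    have "0 < 1 + M 0 * t + K * t\<^sup>2 / 2"
      using assms(9,10) by (simp add: init M0 K_def H1_def H2_def)
    with t(3) show False by simp
  qed
  then have "T \<le> ereal t" using t(1) by (simp add: life_span_def)
  with T obtain T0 where "T = ereal T0" "0 < T0" "T0 \<le> t"
    by (cases T) auto
  then show ?thesis using t(2) by (intro exI[of _ T0]) auto
qed

end
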